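(* Let $k\geq3$, let $q>1$ be a prime power, let $P$ be a permutation-invariant probability distribution on $(\mathbb F_q\setminus\{0\})^k$ and assume $0<d<d_k$. Let $\mathbf A,\mathbf y$ be the random linear system described in the context. Then $$\lim_{n\to\infty}\mathbb E\Big[\big\langle\|\omega(\mathbf x,\mathbf x')-\bar\omega\|_{TV}\big\rangle_{\mathbf A,\mathbf y}\ \Big|\ \exists x\in\mathbb F_q^n:\mathbf Ax=\mathbf y\Big]=0.$$
   Context: $\rho_{k,d}=\sup\{x\in[0,1]:x=1-\exp(-dx^{k-1})\}$ and $d_k=\inf\{d>0:\ \rho_{k,d}-d\rho_{k,d}^{k-1}+(1-1/k)d\rho_{k,d}^k<0\}$. Random model: $\mathbf m\sim\mathrm{Po}(dn/k)$; independently for each row $i\le\mathbf m$ choose uniformly random positions $1\leq\alpha_{i,1}<\cdots<\alpha_{i,k}\leq n$ and independently a $k$-tuple $(a_{i,1},\ldots,a_{i,k})$ from $P$; row $i$ of $\mathbf A$ has entry $a_{i,h}$ at position $\alpha_{i,h}$ and zeros elsewhere; given $\mathbf m$, $\mathbf y\in\mathbb F_q^{\mathbf m}$ is uniform and independent of $\mathbf A$. For $x,x'\in\mathbb F_q^n$ the overlap $\omega(x,x')$ is the $q\times q$ matrix with entries $\omega_{\sigma,\tau}(x,x')=\frac1n\sum_{i=1}^n\mathbf 1\{x_i=\sigma,x'_i=\tau\}$ ($\sigma,\tau\in\mathbb F_q$), viewed as a probability distribution on $\mathbb F_q\times\mathbb F_q$; $\bar\omega$ is the uniform distribution on $\mathbb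 F_q\times\mathbb F_q$; $\|\cdot\|_{TV}$ is total variation distance. For a solvable system $(A,y)$, $\langle\cdot\rangle_{A,y}$ denotes expectation over two independent uniformly random solutions $\mathbf x,\mathbf x'$ of $Ax=y$. *)

theory Defs
  imports
    "HOL-Probability.Probability"
    "HOL-Combinatorics.Permutations"
    "Jordan_Normal_Form.Matrix"
begin

unbundle no vec_syntax
hide_const (open) Finite_Cartesian_Product.vec Finite_Cartesian_Product.row
  Finite_Cartesian_Product.mat
hide_type (open) Finite_Cartesian_Product.vec

definition rho :: "nat \<Rightarrow> real \<Rightarrow> real" where
  "rho k d = Sup {x \<in> {0..1}. x = 1 - exp (- d * x ^ (k - 1))}"

definition d_crit :: "nat \<Rightarrow> real" where
  "d_crit k = Inf {d. d > 0 \<and>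
     rho k d - d * rho k d ^ (k - 1) + (1 - 1 / real k) * d * rho k d ^ k < 0}"

text \<open>A finite field with q elements is a type \<open>'a :: {finite, field}\<close> with \<open>CARD('a) = q\<close>.
  Tuples of length \<open>k\<close> are lists. Column positions are numbered from 0.\<close>

definition perm_invariant_nonzero :: "nat \<Rightarrow> 'a :: zero list pmf \<Rightarrow> bool" where
  "perm_invariant_nonzero k P \<longleftrightarrow>
     set_pmf P \<subseteq> {a. length a = k \<and> 0 \<notin> set a} \<and>
     (\<forall>\<pi>. \<pi> permutes {..<k} \<longrightarrow> map_pmf (permute_list \<pi>) P = P)"

definition positions :: "nat \<Rightarrow> nat \<Rightarrow> nat list set" where
  "positions n k = {\<alpha>. length \<alpha> = k \<and> sorted_wrt (<) \<alpha> \<and> set \<alpha> \<subseteq> {..<n}}"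

text \<open>As the positions are distinct, at most one summand below is nonzero.\<close>

definition sparse_row :: "nat \<Rightarrow> nat list \<Rightarrow> 'a :: comm_monoid_add list \<Rightarrow> 'a vec" where
  "sparse_row n \<alpha> a = vec n (\<lambda>j. \<Sum>h<length \<alpha>. if \<alpha> ! h = j then a ! h else 0)"

text \<open>For \<open>n < k\<close> there are no positions to choose from and the following distributions
  carry no meaning; only \<open>n \<ge> k\<close> matters for limits in \<open>n\<close>.\<close>

definition row_pmf :: "nat \<Rightarrow> nat \<Rightarrow> 'a :: comm_monoid_add list pmf \<Rightarrow> 'a vec pmf" where
  "row_pmf n k P = do {
     \<alpha> \<leftarrow> pmf_of_set (positions n k);
     a \<leftarrow> P;
     return_pmf (sparse_row n \<alpha> a)
   }"

definition system_pmf ::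
  "nat \<Rightarrow> nat \<Rightarrow> real \<Rightarrow> 'a :: comm_monoid_add list pmf \<Rightarrow> ('a mat \<times> 'a vec) pmf" where
  "system_pmf n k d P = do {
     m \<leftarrow> poisson_pmf (d * real n / real k);
     rs \<leftarrow> replicate_pmf m (row_pmf n k P);
     y \<leftarrow> pmf_of_set (carrier_vec m);
     return_pmf (mat_of_rows n rs, y)
   }"

definition solutions :: "nat \<Rightarrow> 'a :: semiring_0 mat \<Rightarrow> 'a vec \<Rightarrow> 'a vec set" where
  "solutions n A y = {x \<in> carrier_vec n. A *\<^sub>v x = y}"

definition overlap :: "nat \<Rightarrow> 'a vec \<Rightarrow> 'a vec \<Rightarrow> 'a \<times> 'a \<Rightarrow> real" where
  "overlap n x x' = (\<lambda>(\<sigma>, \<tau>). real (card {i \<in> {..<n}. x $ i = \<sigma> \<and> x' $ i = \<tau>}) / real n)"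

definition overlap_bar :: "'a :: finite \<times> 'a \<Rightarrow> real" where
  "overlap_bar = (\<lambda>_. 1 / real CARD('a \<times> 'a))"

definition tv_dist :: "('b :: finite \<Rightarrow> real) \<Rightarrow> ('b \<Rightarrow> real) \<Rightarrow> real" where
  "tv_dist \<mu> \<nu> = (\<Sum>z\<in>UNIV. \<bar>\<mu> z - \<nu> z\<bar>) / 2"

text \<open>Expectation over two independent uniformly random solutions; meaningful only for
  solvable systems.\<close>

definition gibbs_avg2 ::
  "nat \<Rightarrow> 'a :: semiring_0 mat \<Rightarrow> 'a vec \<Rightarrow> ('a vec \<Rightarrow> 'a vec \<Rightarrow> real) \<Rightarrow> real" where
  "gibbs_avg2 n A y f = measure_pmf.expectation
     (pair_pmf (pmf_of_set (solutions n A y)) (pmf_of_set (solutions n A y)))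
     (\<lambda>(x, x'). f x x')"

text \<open>The event that the system is solvable has positive probability, since the Poisson
  variable vanishes with positive probability; hence conditioning via \<open>cond_pmf\<close> is
  legitimate.\<close>

definition solvable :: "nat \<Rightarrow> ('a :: semiring_0 mat \<times> 'a vec) set" where
  "solvable n = {(A, y). \<exists>x\<in>carrier_vec n. A *\<^sub>v x = y}"

end

theory Submission
  imports Defs "HOL-Combinatorics.Multiset_Permutations"
begin

text \<open>Conditionally on solvability, a uniform right-hand side makes \<open>x\<close> uniform on \<open>F_q^n\<close> and
  \<open>z = x' - x\<close> an independent uniform kernel vector, while the matrix is reweighted by
  \<open>w = q^(rank - m)\<close>. Hence the overlap is nearly uniform once most pairs of coordinates of \<open>z\<close> are
  independent and the mean of \<open>w\<close>, the probability of being solvable, stays away from zero.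

  Comparing \<open>n\<close> with \<open>n + 1\<close> columns (Aizenman-Sims-Starr), after pinning boundedly many random
  coordinates to destroy dependencies, bounds the mean nullity by \<open>n\<close> times the maximum of a function
  \<open>Phi\<close> of the fraction of frozen coordinates. Below \<open>d_k\<close> this maximum is \<open>1 - d/k\<close>, so almost all
  rows increase the rank; the chance that a new row is redundant increases with the number of rows,
  so it must vanish strictly below \<open>d_k\<close>. If many pairs of coordinates were dependent, then two new
  rows would be dependent with positive probability; hence most pairs are independent and most
  kernel vectors have nearly uniform composition. The mean number of such balanced kernel vectors is
  \<open>O(q^(n - m))\<close>: the correction to the uniform count is cubic or higher in the imbalance as
  \<open>k \<ge> 3\<close>. This bounds the mean of \<open>1/w\<close> on a likely event, hence the mean of \<open>w\<close> from below.\<close>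

text \<open>The comparison controls the nullity only up to o(n), whereas \<open>w\<close> decays
  exponentially in the number of redundant rows, so conditioning on solvability might favour
  atypical matrices. This gap shapes the second half of the proof: monotonicity in the number of
  rows turns the o(n) bound into one for single rows, at the price of working at a slightly larger
  density \<open>d'\<close> that is still subcritical, and the control of \<open>w\<close> to
  constant order comes from counting. Only the upper bound on the nullity requires work:
  \<open>n\<close> minus the number of rows is always a lower bound, and to leading order the two
  agree below the threshold. The true fraction of frozen coordinates is never determined. The gain
  from a new column and the loss from the extra rows are estimated for the same system, hence by the
  same fraction, and the worst value is taken. Pinning lowers the nullity by at most a constant,
  which disappears on the scale of \<open>n\<close>; this is why the number of pins must stay
  bounded while \<open>n\<close> grows.\<close>

abbreviation expt :: "'b pmf \<Rightarrow> ('b \<Rightarrow> real) \<Rightarrow> real" where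
  "expt M f \<equiv> measure_pmf.expectation M f"

abbreviation prob :: "'b pmf \<Rightarrow> 'b set \<Rightarrow> real" where
  "prob M A \<equiv> measure_pmf.prob M A"

section \<open>Expectations of bounded functions and independent samples\<close>

lemma integrable_pmf_bounded:
  fixes f :: "'b \<Rightarrow> real"
  assumes "\<And>x. \<bar>f x\<bar> \<le> B"
  shows "integrable (measure_pmf M) f"
  by (rule measure_pmf.integrable_const_bound[where B = B]) (use assms in auto)

lemma abs_expt_le:
  assumes "\<And>x. \<bar>f x\<bar> \<le> B"
  shows "\<bar>expt M f\<bar> \<le> B"
proof -
  have "\<bar>expt M f\<bar> \<le> expt M (\<lambda>x. \<bar>f x\<bar>)" by (rule integral_abs_bound)
  also have "\<dots> \<le> expt M (\<lambda>_. B)"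
    by (intro integral_mono integrable_pmf_bounded[where B = B]) (use assms in auto, fastforce)
  finally show ?thesis by simp
qed

lemma expt_mono:
  assumes "integrable (measure_pmf M) f" "integrable (measure_pmf M) g"
    and "\<And>x. x \<in> set_pmf M \<Longrightarrow> f x \<le> g x"
  shows "expt M f \<le> expt M g"
  using assms by (intro integral_mono_AE) (auto simp: AE_measure_pmf_iff)

lemma expt_cong:
  assumes "\<And>x. x \<in> set_pmf M \<Longrightarrow> f x = g x"
  shows "expt M f = expt M g"
  using assms by (intro integral_cong_AE) (auto simp: AE_measure_pmf_iff)

lemma expt_le_const:
  assumes "integrable (measure_pmf M) f" "\<And>x. x \<in> set_pmf M \<Longrightarrow> f x \<le> c"
  shows "expt M f \<le> c"
  using expt_mono[OF assms(1), of "\<lambda>_. c"] assms(2) by simp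

lemma expt_ge_const:
  assumes "integrable (measure_pmf M) f" "\<And>x. x \<in> set_pmf M \<Longrightarrow> c \<le> f x"
  shows "c \<le> expt M f"
  using expt_mono[OF _ assms(1), of "\<lambda>_. c"] assms(2) by simp

lemma expt_bind:
  assumes "\<And>x. \<bar>f x\<bar> \<le> B"
  shows "expt (bind_pmf M N) f = expt M (\<lambda>x. expt (N x) f)"
  unfolding measure_pmf_bind
  by (rule integral_bind[where K = "count_space UNIV" and B = B and B' = 1])
     (use assms in \<open>auto simp: measure_pmf.emeasure_space_1[unfolded space_measure_pmf] space_subprob_algebra
       measure_pmf.finite_measure_axioms intro: prob_space_imp_subprob_space measure_pmf.prob_space_axioms\<close>)

lemma expt_pair:
  assumes "\<And>x y. \<bar>f (x, y)\<bar> \<le> B"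
  shows "expt (pair_pmf M N) f = expt M (\<lambda>x. expt N (\<lambda>y. f (x, y)))"
proof -
  have *: "\<bar>f z\<bar> \<le> B" for z using assms by (cases z) auto
  have **: "\<bar>expt M f\<bar> \<le> B" for M by (rule abs_expt_le) (rule *)
  show ?thesis
    unfolding pair_pmf_def by (simp add: expt_bind[OF *] **)
qed

lemma expt_swap:
  assumes "\<And>x y. \<bar>f x y\<bar> \<le> B"
  shows "expt M (\<lambda>x. expt N (\<lambda>y. f x y)) = expt N (\<lambda>y. expt M (\<lambda>x. f x y))"
proof -
  have "expt M (\<lambda>x. expt N (\<lambda>y. f x y)) = expt (bind_pmf M (\<lambda>x. bind_pmf N (\<lambda>y. return_pmf (x, y)))) (\<lambda>(x, y). f x y)"
    by (subst expt_bind[where B = B], use assms in force, subst expt_bind[where B = B], use assms in force, simp)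
  also have "bind_pmf M (\<lambda>x. bind_pmf N (\<lambda>y. return_pmf (x, y))) = bind_pmf N (\<lambda>y. bind_pmf M (\<lambda>x. return_pmf (x, y)))"
    by (rule bind_commute_pmf)
  also have "expt \<dots> (\<lambda>(x, y). f x y) = expt N (\<lambda>y. expt M (\<lambda>x. f x y))"
    by (subst expt_bind[where B = B], use assms in force, subst expt_bind[where B = B], use assms in force, simp)
  finally show ?thesis .
qed

lemma expt_swap_finite:
  fixes f :: "'b \<Rightarrow> 'c \<Rightarrow> real"
  assumes "finite (set_pmf M)" "\<And>x. integrable (measure_pmf N) (f x)"
  shows "expt M (\<lambda>x. expt N (f x)) = expt N (\<lambda>y. expt M (\<lambda>x. f x y))"
  using assms by (simp add: integral_measure_pmf_real[OF assms(1)] Bochner_Integration.integral_sum)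

lemma expt_replicate_Suc:
  assumes "\<And>x. \<bar>f x\<bar> \<le> B"
  shows "expt (replicate_pmf (Suc m) R) f = expt R (\<lambda>x. expt (replicate_pmf m R) (\<lambda>xs. f (x # xs)))"
  using assms by (simp add: expt_bind[where B = B] map_pmf_def[symmetric])

lemma expt_replicate_add:
  assumes "\<And>x. \<bar>f x\<bar> \<le> B"
  shows "expt (replicate_pmf (m + n) R) f =
    expt (replicate_pmf m R) (\<lambda>xs. expt (replicate_pmf n R) (\<lambda>ys. f (xs @ ys)))"
  using assms by (simp add: replicate_pmf_distrib expt_bind[where B = B] map_pmf_def[symmetric])

lemma expt_replicate_snoc:
  assumes "\<And>x. \<bar>f x\<bar> \<le> B"
  shows "expt (replicate_pmf (Suc m) R) f = expt (replicate_pmf m R) (\<lambda>xs. expt R (\<lambda>x. f (xs @ [x])))"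
  using expt_replicate_add[OF assms, of m 1 R] unfolding replicate_pmf_1
  by simp

lemma expt_replicate_filter:
  "expt (replicate_pmf m R) (\<lambda>xs. real (length (filter Q xs))) = m * prob R {x. Q x}"
proof (induction m)
  case (Suc m)
  have len: "length xs \<le> m" if "xs \<in> set_pmf (replicate_pmf m R)" for xs m
    using that by (auto simp: set_replicate_pmf)
  have int: "integrable (replicate_pmf m R) (\<lambda>xs. real (length (filter Q xs)))" for m
    by (rule measure_pmf.integrable_const_bound[where B = m])
       (use len in \<open>auto simp: AE_measure_pmf_iff intro: order_trans[OF length_filter_le]\<close>)
  \<comment> \<open>The truncation by \<open>min\<close> changes nothing on lists of length
    \<open>Suc m\<close>, but bounds the function on all lists, as \<open>expt_replicate_Suc\<close>
    demands.\<close>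
  let ?f = "\<lambda>xs. real (min (Suc m) (length (filter Q xs)))"
  let ?g = "\<lambda>xs. real (length (filter Q xs))"
  have "expt (replicate_pmf (Suc m) R) ?g = expt (replicate_pmf (Suc m) R) ?f"
    by (rule expt_cong) (use len order_trans[OF length_filter_le len] in fastforce)
  also have "\<dots> = expt R (\<lambda>x. expt (replicate_pmf m R) (\<lambda>xs. ?f (x # xs)))"
    by (rule expt_replicate_Suc[where B = "Suc m"]) auto
  also have "\<dots> = expt R (\<lambda>x. expt (replicate_pmf m R) (\<lambda>xs. indicator {x. Q x} x + ?g xs))"
  proof (intro expt_cong)
    fix x xs assume "xs \<in> set_pmf (replicate_pmf m R)"
    then have "length (filter Q xs) \<le> m" using order_trans[OF length_filter_le len] by blast
    then show "?f (x # xs) = indicator {x. Q x} x + ?g xs" by (auto simp: indicator_def)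
  qed
  also have "\<dots> = expt R (\<lambda>x. indicator {x. Q x} x + m * prob R {x. Q x})"
    using int Suc.IH by simp
  also have "\<dots> = prob R {x. Q x} + m * prob R {x. Q x}"
    by (subst Bochner_Integration.integral_add)
       (auto intro: integrable_pmf_bounded[where B = 1])
  finally show ?case by (simp add: algebra_simps)
qed simp

lemma prob_replicate_all:
  "prob (replicate_pmf m R) {xs. \<forall>x\<in>set xs. Q x} = prob R {x. Q x} ^ m"
proof (induction m)
  case (Suc m)
  have "prob (replicate_pmf (Suc m) R) {xs. \<forall>x\<in>set xs. Q x}
    = expt (replicate_pmf (Suc m) R) (indicator {xs. \<forall>x\<in>set xs. Q x})" by simp
  also have "\<dots> = expt R (\<lambda>x. expt (replicate_pmf m R) (\<lambda>xs. indicator {xs. \<forall>x\<in>set xs. Q x} (x # xs)))"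
    by (rule expt_replicate_Suc[where B = 1]) auto
  also have "\<dots> = expt R (\<lambda>x. expt (replicate_pmf m R) (\<lambda>xs. indicator {x. Q x} x * indicator {xs. \<forall>x\<in>set xs. Q x} xs))"
    by (intro expt_cong) (auto simp: indicator_def)
  also have "\<dots> = prob R {x. Q x} * prob R {x. Q x} ^ m"
    using Suc by simp
  finally show ?case by simp
qed auto

section \<open>Poisson mixtures\<close>

text \<open>This is the Poisson generating function. It evaluates averages of
  \<open>(1 - p) ^ m\<close> and dominates every integrand that grows at most exponentially in the
  number of rows.\<close>

lemma expt_poisson_power:
  assumes "0 < l" "0 \<le> B"
  shows "integrable (poisson_pmf l) (\<lambda>m. B ^ m)" "expt (poisson_pmf l) (\<lambda>m. B ^ m) = exp (l * (B - 1))"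
proof -
  have s: "(\<lambda>m. pmf (poisson_pmf l) m * B ^ m) sums (exp (l * B) * exp (- l))"
    using sums_mult2[OF exp_converges[of "l * B"], of "exp (- l)"] assms
    by (simp add: power_mult_distrib field_simps)
  have e: "exp (l * B) * exp (- l) = exp (l * (B - 1))"
    by (simp add: exp_add[symmetric] algebra_simps)
  have abs: "summable (\<lambda>m. norm (pmf (poisson_pmf l) m * B ^ m))"
    using sums_summable[OF s] assms by simp
  have m: "measure_pmf (poisson_pmf l) = density (count_space UNIV) (\<lambda>m. ennreal (pmf (poisson_pmf l) m))"
    by (rule measure_pmf_eq_density)
  have i: "integrable (count_space UNIV) (\<lambda>m. pmf (poisson_pmf l) m * B ^ m)"
    using abs by (subst integrable_count_space_nat_iff) simp
  show "integrable (poisson_pmf l) (\<lambda>m. B ^ m)"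
    unfolding m using i by (subst integrable_real_density) auto
  have "expt (poisson_pmf l) (\<lambda>m. B ^ m) = integral\<^sup>L (count_space UNIV) (\<lambda>m. pmf (poisson_pmf l) m * B ^ m)"
    unfolding m by (subst integral_real_density) auto
  also have "\<dots> = (\<Sum>m. pmf (poisson_pmf l) m * B ^ m)"
    using i by (rule integral_count_space_nat)
  also have "\<dots> = exp (l * (B - 1))" using s e by (simp add: sums_iff)
  finally show "expt (poisson_pmf l) (\<lambda>m. B ^ m) = exp (l * (B - 1))" .
qed

lemma integrable_poisson:
  fixes f :: "nat \<Rightarrow> real"
  assumes "0 < l" "0 \<le> B" "\<And>m. \<bar>f m\<bar> \<le> C * B ^ m"
  shows "integrable (poisson_pmf l) f"
  by (rule Bochner_Integration.integrable_bound[OF integrable_mult_right[OF expt_poisson_power(1)[OF assms(1,2)], of C]])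
     (use assms(3) in \<open>auto intro!: order_trans[OF _ abs_ge_self]\<close>)

lemma of_nat_le_two_power: "real m \<le> 2 ^ m"
  by (metis less_exp of_nat_less_iff of_nat_power of_nat_numeral less_imp_le)

lemma of_nat_Suc_le_two_power: "1 + real m \<le> 2 ^ m"
proof -
  have "Suc m \<le> 2 ^ m" by (simp add: Suc_leI)
  then have "real (Suc m) \<le> real (2 ^ m)" by (simp only: of_nat_le_iff)
  then show ?thesis by simp
qed

lemma integrable_poisson_real:
  assumes "0 < l" shows "integrable (poisson_pmf l) real"
  by (rule integrable_poisson[OF assms, of 2 _ 1]) (auto simp: of_nat_le_two_power)

lemma expt_poisson_real:
  assumes "0 < l" shows "expt (poisson_pmf l) real = l"
proof -
  have s: "(\<lambda>m. pmf (poisson_pmf l) m * real m) sums l"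
  proof -
    have "(\<lambda>m. pmf (poisson_pmf l) (Suc m) * real (Suc m)) sums (l * (exp l * exp (- l)))"
      using sums_mult[OF sums_mult2[OF exp_converges[of l], of "exp (- l)"], of l] assms
      by (simp del: of_nat_Suc add: fact_Suc) (simp add: field_simps del: of_nat_Suc)
    then have "(\<lambda>m. pmf (poisson_pmf l) (Suc m) * real (Suc m)) sums l"
      by (simp add: exp_minus)
    then show ?thesis by (subst (asm) sums_Suc_iff) simp
  qed
  have m: "measure_pmf (poisson_pmf l) = density (count_space UNIV) (\<lambda>m. ennreal (pmf (poisson_pmf l) m))"
    by (rule measure_pmf_eq_density)
  have i: "integrable (count_space UNIV) (\<lambda>m. pmf (poisson_pmf l) m * real m)"
    using sums_summable[OF s] by (subst integrable_count_space_nat_iff) simp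
  have "expt (poisson_pmf l) real = integral\<^sup>L (count_space UNIV) (\<lambda>m. pmf (poisson_pmf l) m * real m)"
    unfolding m by (subst integral_real_density) auto
  also have "\<dots> = (\<Sum>m. pmf (poisson_pmf l) m * real m)"
    using i by (rule integral_count_space_nat)
  finally show ?thesis using s by (simp add: sums_iff)
qed

text \<open>Poisson thinning. It makes the number of rows through a given column independent of the
  number of rows that avoid it.\<close>

lemma poisson_binomial_split:
  assumes "0 < l1" "0 < l2"
  shows "bind_pmf (poisson_pmf (l1 + l2)) (\<lambda>m. map_pmf (\<lambda>j. (j, m - j)) (binomial_pmf m (l1 / (l1 + l2))))
    = pair_pmf (poisson_pmf l1) (poisson_pmf l2)"
proof (rule pmf_eqI)
  fix z :: "nat \<times> nat"
  obtain a b where z: "z = (a, b)" by (cases z)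
  define p where "p = l1 / (l1 + l2)"
  have p: "0 \<le> p" "p \<le> 1" "1 - p = l2 / (l1 + l2)" using assms by (auto simp: p_def field_simps)
  have 1: "pmf (map_pmf (\<lambda>j. (j, m - j)) (binomial_pmf m p)) (a, b) = (if m = a + b then pmf (binomial_pmf m p) a else 0)" for m
  proof -
    have "pmf (map_pmf (\<lambda>j. (j, m - j)) (binomial_pmf m p)) (a, b) = prob (binomial_pmf m p) {j. j = a \<and> m - j = b}"
      by (simp add: pmf_map vimage_def)
    also have "\<dots> = prob (binomial_pmf m p) ({j. j = a \<and> m - j = b} \<inter> {..m})"
      by (rule measure_eq_AE) (use p set_pmf_binomial_eq[OF p(1,2), of m] in \<open>auto simp: AE_measure_pmf_iff split: if_splits\<close>)
    also have "{j. j = a \<and> m - j = b} \<inter> {..m} = (if m = a + b then {a} else {})" by auto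
    finally show ?thesis by (auto simp: measure_pmf_single)
  qed
  have "pmf (bind_pmf (poisson_pmf (l1 + l2)) (\<lambda>m. map_pmf (\<lambda>j. (j, m - j)) (binomial_pmf m p))) z
    = expt (poisson_pmf (l1 + l2)) (\<lambda>m. if m = a + b then pmf (binomial_pmf m p) a else 0)"
    by (simp add: pmf_bind z 1)
  also have "\<dots> = pmf (poisson_pmf (l1 + l2)) (a + b) * pmf (binomial_pmf (a + b) p) a"
    by (subst integral_measure_pmf[of "{a + b}"]) (auto split: if_splits)
  also have "\<dots> = pmf (poisson_pmf l1) a * pmf (poisson_pmf l2) b"
  proof -
    have s: "l1 + l2 > 0" using assms by simp
    have "pmf (binomial_pmf (a + b) p) a = ((a + b) choose a) * p ^ a * (1 - p) ^ b"
      using p by simp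
    moreover have "real ((a + b) choose a) = fact (a + b) / (fact a * fact b)"
      by (simp add: binomial_fact)
    moreover have "p ^ a * (1 - p) ^ b = l1 ^ a * l2 ^ b / (l1 + l2) ^ (a + b)"
      unfolding p(3) by (simp add: p_def power_divide power_add)
    ultimately have "pmf (binomial_pmf (a + b) p) a
      = (fact (a + b) / (fact a * fact b)) * (l1 ^ a * l2 ^ b / (l1 + l2) ^ (a + b))"
      by (simp only: mult.assoc)
    moreover have "exp (- (l1 + l2)) = exp (- l1) * exp (- l2)" by (simp add: exp_add[symmetric])
    ultimately show ?thesis using assms s
      by (simp only: pmf_poisson) (simp add: field_simps)
  qed
  finally show "pmf (bind_pmf (poisson_pmf (l1 + l2)) (\<lambda>m. map_pmf (\<lambda>j. (j, m - j)) (binomial_pmf m (l1 / (l1 + l2))))) z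
     = pmf (pair_pmf (poisson_pmf l1) (poisson_pmf l2)) z"
    by (simp add: z p_def pmf_pair)
qed

text \<open>A kernel depends only on the set of rows, so order and multiplicity are forgotten;
  merging independent samples then becomes a union.\<close>

definition poisson_set :: "real \<Rightarrow> 'r pmf \<Rightarrow> 'r set pmf" where
  "poisson_set l R = bind_pmf (poisson_pmf l) (\<lambda>m. map_pmf set (replicate_pmf m R))"

text \<open>Each draw chooses its component by its own coin. Once the order is forgotten, only the
  number \<open>j\<close> of heads matters, and it is binomial.\<close>

lemma set_replicate_mixture:
  assumes "0 \<le> p" "p \<le> 1"
  shows "map_pmf set (replicate_pmf m (bind_pmf (bernoulli_pmf p) (\<lambda>b. if b then R1 else R2))) =
    bind_pmf (binomial_pmf m p) (\<lambda>j. map_pmf (\<lambda>(xs, ys). set xs \<union> set ys)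
      (pair_pmf (replicate_pmf j R1) (replicate_pmf (m - j) R2)))"
proof (induction m)
  case (Suc m)
  define M where "M = bind_pmf (bernoulli_pmf p) (\<lambda>b. if b then R1 else R2)"
  define F where "F = (\<lambda>a b. map_pmf (\<lambda>(xs, ys). set xs \<union> set ys) (pair_pmf (replicate_pmf a R1) (replicate_pmf b R2)))"
  have F1: "F (Suc a) b = bind_pmf R1 (\<lambda>x. map_pmf (insert x) (F a b))" for a b
    by (simp add: F_def pair_pmf_def map_pmf_def bind_assoc_pmf bind_return_pmf)
  have F2: "F a (Suc b) = bind_pmf R2 (\<lambda>x. map_pmf (insert x) (F a b))" for a b
    unfolding F_def pair_pmf_def map_pmf_def
    by (simp add: bind_assoc_pmf bind_return_pmf bind_commute_pmf[of _ R2])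
  have "map_pmf set (replicate_pmf (Suc m) M) = bind_pmf M (\<lambda>x. map_pmf (insert x) (map_pmf set (replicate_pmf m M)))"
    by (simp add: map_pmf_def bind_assoc_pmf bind_return_pmf)
  also have "\<dots> = bind_pmf M (\<lambda>x. bind_pmf (binomial_pmf m p) (\<lambda>j. map_pmf (insert x) (F j (m - j))))"
    using Suc by (simp add: M_def F_def map_bind_pmf)
  also have "\<dots> = bind_pmf (bernoulli_pmf p) (\<lambda>b. bind_pmf (binomial_pmf m p) (\<lambda>j. bind_pmf (if b then R1 else R2) (\<lambda>x. map_pmf (insert x) (F j (m - j)))))"
    unfolding M_def bind_assoc_pmf by (subst bind_commute_pmf) (rule refl)
  also have "\<dots> = bind_pmf (bernoulli_pmf p) (\<lambda>b. bind_pmf (binomial_pmf m p) (\<lambda>j. F ((if b then 1 else 0) + j) (Suc m - ((if b then 1 else 0) + j))))"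
  proof (intro bind_pmf_cong refl)
    fix b j assume "j \<in> set_pmf (binomial_pmf m p)"
    then have "j \<le> m" using set_pmf_binomial_eq[OF assms, of m] by (auto split: if_splits)
    then show "bind_pmf (if b then R1 else R2) (\<lambda>x. map_pmf (insert x) (F j (m - j))) = F ((if b then 1 else 0) + j) (Suc m - ((if b then 1 else 0) + j))"
      by (simp add: F1 F2 Suc_diff_le)
  qed
  also have "\<dots> = bind_pmf (binomial_pmf (Suc m) p) (\<lambda>j. F j (Suc m - j))"
    using assms by (simp add: binomial_pmf_Suc bind_assoc_pmf bind_return_pmf)
  finally show ?case by (simp add: M_def F_def)
qed (use assms in \<open>simp add: binomial_pmf_0 bind_return_pmf pair_pmf_def\<close>)

text \<open>Colouring of a Poisson sample. The two colours will be the rows that avoid the new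
  column and the rows that use it.\<close>

lemma poisson_set_mixture:
  assumes "0 < l1" "0 < l2"
  shows "poisson_set (l1 + l2) (bind_pmf (bernoulli_pmf (l1 / (l1 + l2))) (\<lambda>b. if b then R1 else R2))
    = map_pmf (\<lambda>(X, Y). X \<union> Y) (pair_pmf (poisson_set l1 R1) (poisson_set l2 R2))"
proof -
  define p where "p = l1 / (l1 + l2)"
  have p: "0 \<le> p" "p \<le> 1" using assms by (auto simp: p_def field_simps)
  define F where "F = (\<lambda>a b. map_pmf (\<lambda>(xs, ys). set xs \<union> set ys) (pair_pmf (replicate_pmf a R1) (replicate_pmf b R2)))"
  have "poisson_set (l1 + l2) (bind_pmf (bernoulli_pmf p) (\<lambda>b. if b then R1 else R2))
    = bind_pmf (poisson_pmf (l1 + l2)) (\<lambda>m. bind_pmf (binomial_pmf m p) (\<lambda>j. F j (m - j)))"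
    unfolding poisson_set_def F_def by (subst set_replicate_mixture[OF p]) (rule refl)
  also have "\<dots> = bind_pmf (bind_pmf (poisson_pmf (l1 + l2)) (\<lambda>m. map_pmf (\<lambda>j. (j, m - j)) (binomial_pmf m p))) (\<lambda>(a, b). F a b)"
    by (simp add: bind_assoc_pmf map_pmf_def bind_return_pmf)
  also have "\<dots> = bind_pmf (poisson_pmf l1) (\<lambda>a. bind_pmf (poisson_pmf l2) (\<lambda>b. F a b))"
    unfolding p_def poisson_binomial_split[OF assms]
    by (simp add: pair_pmf_def bind_assoc_pmf bind_return_pmf)
  also have "\<dots> = map_pmf (\<lambda>(X, Y). X \<union> Y) (pair_pmf (poisson_set l1 R1) (poisson_set l2 R2))"
    unfolding F_def poisson_set_def pair_pmf_def map_pmf_def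
    by (simp add: bind_assoc_pmf bind_return_pmf bind_commute_pmf[of _ "poisson_pmf l2"])
  finally show ?thesis by (simp add: p_def)
qed

lemma poisson_set_add:
  assumes "0 < l1" "0 < l2"
  shows "poisson_set (l1 + l2) R
    = map_pmf (\<lambda>(X, Y). X \<union> Y) (pair_pmf (poisson_set l1 R) (poisson_set l2 R))"
  using poisson_set_mixture[OF assms, of R R] by simp

lemma expt_poisson_set:
  assumes "\<And>X. \<bar>f X\<bar> \<le> B"
  shows "expt (poisson_set l R) f = expt (poisson_pmf l) (\<lambda>m. expt (replicate_pmf m R) (\<lambda>xs. f (set xs)))"
  unfolding poisson_set_def using assms by (subst expt_bind[where B = B]) auto

section \<open>Kernels of sparse systems\<close>

text \<open>A sparse row is kept as its list of positions with its list of entries, a vector of length \<open>n\<close>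
  as a function vanishing from \<open>n\<close> on; so the same row acts on vectors of every length. Ranks are
  only seen through the cardinalities of kernels.\<close>

type_synonym 'a srow = "nat list \<times> 'a list"

definition lin :: "'a srow \<Rightarrow> (nat \<Rightarrow> 'a) \<Rightarrow> 'a :: {finite, field}" where
  "lin r x = (\<Sum>h<length (fst r). snd r ! h * x (fst r ! h))"

text \<open>A pin is itself a row, the equation \<open>x i = 0\<close>, so that pins and random rows
  obey the same lemmas.\<close>

definition pin :: "nat \<Rightarrow> 'a :: {finite, field} srow" where
  "pin i = ([i], [1])"

definition space_n :: "nat \<Rightarrow> (nat \<Rightarrow> 'a :: {finite, field}) set" where
  "space_n n = {x. \<forall>i\<ge>n. x i = 0}"

definition ker :: "nat \<Rightarrow> 'a srow set \<Rightarrow> (nat \<Rightarrow> 'a :: {finite, field}) set" where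
  "ker n S = {x \<in> space_n n. \<forall>r\<in>S. lin r x = 0}"

text \<open>Membership of \<open>r\<close> in the row span of \<open>S\<close> on the first
  \<open>n\<close> coordinates, expressed dually.\<close>

definition vanish :: "nat \<Rightarrow> 'a srow set \<Rightarrow> 'a :: {finite, field} srow \<Rightarrow> bool" where
  "vanish n S r \<longleftrightarrow> (\<forall>x\<in>ker n S. lin r x = 0)"

abbreviation frozen :: "nat \<Rightarrow> 'a :: {finite, field} srow set \<Rightarrow> nat \<Rightarrow> bool" where
  "frozen n S i \<equiv> vanish n S (pin i)"

abbreviation frozen_set :: "nat \<Rightarrow> 'a :: {finite, field} srow set \<Rightarrow> nat set" where
  "frozen_set n S \<equiv> {i. i < n \<and> frozen n S i}"

definition nul :: "nat \<Rightarrow> 'a :: {finite, field} srow set \<Rightarrow> real" where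
  "nul n S = log CARD('a) (card (ker n S))"

lemma card_field_gt_1: "real CARD('a :: {finite, field}) > 1"
proof -
  have "card {0, 1 :: 'a} \<le> CARD('a)" by (intro card_mono) auto
  then show ?thesis by simp
qed

lemma lin_pin [simp]: "lin (pin i) x = x i"
  by (simp add: lin_def pin_def)

lemma lin_lincomb: "lin r (\<lambda>i. x i + c * y i) = lin r x + c * lin r y"
  by (simp add: lin_def sum.distrib sum_distrib_left algebra_simps)

lemma lin_zero [simp]: "lin r (\<lambda>_. 0) = 0"
  by (simp add: lin_def)

lemma lin_scale: "lin r (\<lambda>i. c * y i) = c * lin r y"
  using lin_lincomb[of r "\<lambda>_. 0" c y] by simp

lemma zero_in_ker [simp]: "(\<lambda>_. 0) \<in> ker n S"
  by (simp add: ker_def space_n_def)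

lemma ker_lincomb: "x \<in> ker n S \<Longrightarrow> y \<in> ker n S \<Longrightarrow> (\<lambda>i. x i + c * y i) \<in> ker n S"
  by (auto simp: ker_def space_n_def lin_lincomb)

lemma ker_diff: "x \<in> ker n S \<Longrightarrow> y \<in> ker n S \<Longrightarrow> (\<lambda>i. x i - y i) \<in> ker n S"
  using ker_lincomb[of x n S y "-1"] by simp

lemma ker_scale: "x \<in> ker n S \<Longrightarrow> (\<lambda>i. c * x i) \<in> ker n S"
  using ker_lincomb[of "\<lambda>_. 0" n S x c] by simp

lemma ker_empty [simp]: "ker n {} = space_n n"
  by (simp add: ker_def)

lemma ker_mono: "S \<subseteq> S' \<Longrightarrow> ker n S' \<subseteq> ker n S"
  by (auto simp: ker_def)

lemma ker_insert: "ker n (insert r S) = {x \<in> ker n S. lin r x = 0}"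
  by (auto simp: ker_def)

lemma vanish_mono: "vanish n S r \<Longrightarrow> S \<subseteq> S' \<Longrightarrow> vanish n S' r"
  using ker_mono[of S S' n] by (auto simp: vanish_def)

lemma frozen_iff: "frozen n S i \<longleftrightarrow> (\<forall>x\<in>ker n S. x i = 0)"
  by (simp add: vanish_def)

lemma bij_space_n: "bij_betw (\<lambda>x i. if i < n then x i else 0) ({..<n} \<rightarrow>\<^sub>E (UNIV :: 'a set)) (space_n n :: (nat \<Rightarrow> 'a :: {finite, field}) set)"
  by (rule bij_betwI[where g = "\<lambda>x. restrict x {..<n}"])
     (auto simp: space_n_def PiE_def extensional_def fun_eq_iff)

lemma finite_space_n [simp]: "finite (space_n n :: (nat \<Rightarrow> 'a :: {finite, field}) set)"
  using bij_betw_finite[OF bij_space_n[of n, where 'a = 'a]] by (simp add: finite_PiE)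

lemma card_space_n: "card (space_n n :: (nat \<Rightarrow> 'a :: {finite, field}) set) = CARD('a) ^ n"
  using bij_betw_same_card[OF bij_space_n[of n, where 'a = 'a]] by (simp add: card_PiE)

lemma ker_subset_space: "ker n S \<subseteq> space_n n" by (auto simp: ker_def)

lemma finite_ker [simp]: "finite (ker n S)"
  by (rule finite_subset[OF ker_subset_space]) simp

lemma card_ker_pos: "card (ker n S) > 0"
  using zero_in_ker[of n S] finite_ker[of n S] card_gt_0_iff by blast

text \<open>A kernel vector on which \<open>r\<close> takes the value 1 spans a complement of the
  smaller kernel in the larger one.\<close>

lemma card_ker_insert:
  fixes S :: "'a :: {finite, field} srow set"
  assumes "\<not> vanish n S r"
  shows "card (ker n S) = CARD('a) * card (ker n (insert r S))"
proof -
  obtain v0 where v0: "v0 \<in> ker n S" "lin r v0 \<noteq> 0" using assms by (auto simp: vanish_def)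
  define v where "v = (\<lambda>i. inverse (lin r v0) * v0 i)"
  have v: "v \<in> ker n S" "lin r v = 1" unfolding v_def using v0 by (auto intro: ker_scale simp: lin_scale)
  have "bij_betw (\<lambda>(c, x) i. x i + c * v i) ((UNIV :: 'a set) \<times> ker n (insert r S)) (ker n S)"
  proof (rule bij_betwI[where g = "\<lambda>x. (lin r x, \<lambda>i. x i + (- lin r x) * v i)"])
    show "(\<lambda>(c, x) i. x i + c * v i) \<in> UNIV \<times> ker n (insert r S) \<rightarrow> ker n S"
      using v by (auto simp: ker_insert intro: ker_lincomb)
    show "(\<lambda>x. (lin r x, \<lambda>i. x i + (- lin r x) * v i)) \<in> ker n S \<rightarrow> UNIV \<times> ker n (insert r S)"
      using v unfolding ker_insert by (auto intro: ker_lincomb simp only: lin_lincomb) simp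
  qed (use v in \<open>auto simp: ker_insert lin_lincomb fun_eq_iff\<close>)
  then have "card (ker n S) = card ((UNIV :: 'a set) \<times> ker n (insert r S))"
    using bij_betw_same_card by force
  then show ?thesis by (simp add: card_cartesian_product)
qed

lemma ker_insert_vanish: "vanish n S r \<Longrightarrow> ker n (insert r S) = ker n S"
  by (auto simp: ker_insert vanish_def)

lemma nul_insert:
  fixes S :: "'a :: {finite, field} srow set"
  shows "nul n (insert r S) = nul n S - (if vanish n S r then 0 else 1)"
proof (cases "vanish n S r")
  case False
  have "log CARD('a) (CARD('a) * card (ker n (insert r S))) = 1 + log CARD('a) (card (ker n (insert r S)))"
    using card_field_gt_1[where 'a = 'a] card_ker_pos[of n "insert r S"] by (simp add: log_mult card_gt_0_iff)
  then show ?thesis using False card_ker_insert[OF False] by (simp add: nul_def)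
qed (simp add: nul_def ker_insert_vanish)

lemma card_ker_le_imp_nul_le:
  fixes S :: "'a :: {finite, field} srow set"
  shows "ker n S \<subseteq> ker n' S' \<Longrightarrow> nul n S \<le> nul n' S'"
  unfolding nul_def using card_field_gt_1[where 'a = 'a] card_ker_pos[of n S] card_mono[OF finite_ker]
  by (subst log_le_cancel_iff) (auto simp: card_ker_pos)

lemma nul_mono: "S \<subseteq> S' \<Longrightarrow> nul n S' \<le> nul n S"
  by (intro card_ker_le_imp_nul_le ker_mono)

lemma nul_empty [simp]: "nul n ({} :: 'a :: {finite, field} srow set) = n"
  using card_field_gt_1[where 'a = 'a] by (simp add: nul_def card_space_n log_nat_power)

lemma nul_nonneg: "0 \<le> nul n (S :: 'a :: {finite, field} srow set)"
  unfolding nul_def using card_field_gt_1[where 'a = 'a] card_ker_pos[of n S]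
  by (intro zero_le_log_cancel_iff[THEN iffD2]) auto

lemma nul_le: "nul n S \<le> n" using nul_mono[of "{}" S n] by simp

lemma nul_abs_le: "\<bar>nul n S\<bar> \<le> n" using nul_nonneg[of n S] nul_le[of n S] by simp

lemma card_ker_eq_powr: "real (card (ker n (S :: 'a :: {finite, field} srow set))) = CARD('a) powr nul n S"
  unfolding nul_def using card_field_gt_1[where 'a = 'a] card_ker_pos[of n S] by simp

text \<open>A row that is redundant for \<open>S\<close> stays redundant when rows are added, so
  only the other rows can lower the nullity, each by at most one.\<close>

lemma nul_union_ge:
  "nul n (S \<union> set rs) \<ge> nul n S - length (filter (\<lambda>r. \<not> vanish n S r) rs)"
proof (induction rs rule: rev_induct)
  case (snoc r rs)
  have "vanish n (S \<union> set rs) r" if "vanish n S r" using that by (rule vanish_mono) auto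
  then show ?case using snoc nul_insert[of n r "S \<union> set rs"] by auto
qed simp

definition rows_below :: "nat \<Rightarrow> 'a srow set" where
  "rows_below n = {r. set (fst r) \<subseteq> {..<n}}"

lemma lin_upd: "r \<in> rows_below n \<Longrightarrow> lin r (x(n := c)) = lin r x"
  unfolding lin_def rows_below_def
  by (rule sum.cong) (auto dest!: nth_mem)

lemma ker_Suc_pin:
  assumes "S \<subseteq> rows_below n"
  shows "ker (Suc n) (insert (pin n) S) = ker n S"
proof -
  have "x \<in> space_n (Suc n) \<and> x n = 0 \<longleftrightarrow> x \<in> space_n n" for x :: "nat \<Rightarrow> 'a"
    by (auto simp: space_n_def) (metis le_antisym not_less_eq_eq)
  then show ?thesis by (auto simp: ker_def)
qed

lemma nul_Suc:
  assumes "S \<subseteq> rows_below n"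
  shows "nul (Suc n) S = nul n S + 1"
proof -
  have "(\<lambda>_. 0)(n := 1) \<in> ker (Suc n) S"
    using assms lin_upd[of _ n "\<lambda>_. 0" 1] by (auto simp: ker_def space_n_def)
  then have "\<not> vanish (Suc n) S (pin n)" by (auto simp: vanish_def intro!: bexI)
  moreover have "nul (Suc n) (insert (pin n) S) = nul n S"
    using ker_Suc_pin[OF assms] by (simp add: nul_def)
  ultimately show ?thesis using nul_insert[of "Suc n" "pin n" S] by simp
qed

lemma pin_in_rows_below: "pin i \<in> rows_below n \<longleftrightarrow> i < n"
  by (auto simp: rows_below_def pin_def)

lemma lin_eq_0: "(\<And>h. h < length (fst r) \<Longrightarrow> x (fst r ! h) = 0) \<Longrightarrow> lin r x = 0"
  by (simp add: lin_def)

lemma frozen_imp_vanish: "(\<And>i. i \<in> set (fst r) \<Longrightarrow> frozen n S i) \<Longrightarrow> vanish n S r"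
  unfolding vanish_def by (auto intro!: lin_eq_0)

text \<open>A triangular form of linear dependence between unfrozen coordinates, chosen because its
  probability telescopes along a sequence of pins.\<close>

definition related :: "nat \<Rightarrow> 'a :: {finite, field} srow set \<Rightarrow> nat list \<Rightarrow> bool" where
  "related n S js \<longleftrightarrow> (\<exists>l<length js. \<not> frozen n S (js ! l) \<and> frozen n (S \<union> pin ` set (take l js)) (js ! l))"

lemma related_append: "related n S us \<Longrightarrow> related n S (us @ vs)"
  unfolding related_def by (force simp: nth_append)

lemma related_snoc:
  "related n S (js @ [j]) \<longleftrightarrow> related n S js \<or> (\<not> frozen n S j \<and> frozen n (S \<union> pin ` set js) j)"
proof -
  have *: "(\<exists>l<length (js @ [j]). Q l) \<longleftrightarrow> (\<exists>l<length js. Q l) \<or> Q (length js)" for Q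
    by (auto simp: less_Suc_eq)
  show ?thesis unfolding related_def * by (simp add: nth_append cong: conj_cong)
qed

text \<open>Without a relation, every row with an unfrozen old position is independent of the rows
  before it: some kernel vector of \<open>S\<close> is zero on all their positions and on column
  \<open>n\<close>, but not on this row. The system \<open>S'\<close> is left open because it is
  used both for \<open>S\<close> itself and for \<open>S\<close> with column \<open>n\<close>
  pinned.\<close>

lemma nul_rows_drop:
  fixes S :: "'a :: {finite, field} srow set"
  assumes S: "S \<subseteq> rows_below n" and S': "ker n S \<subseteq> ker (Suc n) S'"
    and rs: "\<And>\<alpha> a. (\<alpha>, a) \<in> set rs \<Longrightarrow> set \<alpha> \<subseteq> {..<n} \<and> length a = Suc (length \<alpha>) \<and> 0 \<notin> set a"
    and "\<not> related n S (concat (map fst rs))"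
  shows "nul (Suc n) (S' \<union> (\<lambda>(\<alpha>, a). (\<alpha> @ [n], a)) ` set rs)
    \<le> nul (Suc n) S' - length (filter (\<lambda>r. \<not> (\<forall>i\<in>set (fst r). frozen n S i)) rs)"
  using rs assms(4)
proof (induction rs rule: rev_induct)
  case (snoc r rs)
  obtain \<alpha> a where r: "r = (\<alpha>, a)" by (cases r)
  let ?f = "\<lambda>(\<alpha>, a). (\<alpha> @ [n], a :: 'a list)"
  have IH: "nul (Suc n) (S' \<union> ?f ` set rs)
    \<le> nul (Suc n) S' - length (filter (\<lambda>r. \<not> (\<forall>i\<in>set (fst r). frozen n S i)) rs)"
    using snoc.prems related_append[of n S "concat (map fst rs)" "fst r"] by (intro snoc.IH) auto
  have un: "S' \<union> ?f ` set (rs @ [r]) = insert (\<alpha> @ [n], a) (S' \<union> ?f ` set rs)" by (auto simp: r)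
  show ?case
  proof (cases "\<forall>i\<in>set \<alpha>. frozen n S i")
    case True
    then show ?thesis using IH nul_insert[of "Suc n" "(\<alpha> @ [n], a)" "S' \<union> ?f ` set rs"]
      unfolding un by (auto simp: r split: if_splits)
  next
    case False
    \<comment> \<open>At the last unfrozen position, the later positions are frozen anyway and the
      absence of a relation allows the earlier ones to be zero, so a single term of the row
      survives.\<close>
    define l where "l = (GREATEST l. l < length \<alpha> \<and> \<not> frozen n S (\<alpha> ! l))"
    have ex: "\<exists>l. l < length \<alpha> \<and> \<not> frozen n S (\<alpha> ! l)" using False by (auto simp: in_set_conv_nth)
    have l: "l < length \<alpha>" "\<not> frozen n S (\<alpha> ! l)"
      using GreatestI_ex_nat[OF ex, of "length \<alpha>"] by (auto simp: l_def)
    have gr: "frozen n S (\<alpha> ! l')" if "l < l'" "l' < length \<alpha>" for l'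
      using Greatest_le_nat[of "\<lambda>l. l < length \<alpha> \<and> \<not> frozen n S (\<alpha> ! l)" l' "length \<alpha>"] that
      unfolding l_def[symmetric] by auto
    let ?js = "concat (map fst rs)"
    let ?pre = "?js @ take l \<alpha>"
    have "\<not> frozen n (S \<union> pin ` set ?pre) (\<alpha> ! l)"
    proof
      assume fr: "frozen n (S \<union> pin ` set ?pre) (\<alpha> ! l)"
      have "related n S (?js @ \<alpha>)"
        unfolding related_def
      proof (intro exI[of _ "length ?js + l"] conjI)
        show "length ?js + l < length (?js @ \<alpha>)" using l by simp
        show "\<not> frozen n S ((?js @ \<alpha>) ! (length ?js + l))" using l by (simp only: nth_append_length_plus) simp
        show "frozen n (S \<union> pin ` set (take (length ?js + l) (?js @ \<alpha>))) ((?js @ \<alpha>) ! (length ?js + l))"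
          using fr by (simp only: nth_append_length_plus take_append) simp
      qed
      then show False using snoc.prems(2) by (simp add: r)
    qed
    then obtain v where v: "v \<in> ker n (S \<union> pin ` set ?pre)" "v (\<alpha> ! l) \<noteq> 0" by (auto simp: vanish_def)
    have vS: "v \<in> ker n S" using v ker_mono[of S "S \<union> pin ` set ?pre" n] by auto
    have v0: "v i = 0" if "i \<in> set ?pre" for i using v(1) that by (fastforce simp: ker_def simp flip: lin_pin)
    have vn: "v n = 0" using vS by (auto simp: ker_def space_n_def)
    have "lin (\<alpha>' @ [n], a') v = 0" if "(\<alpha>', a') \<in> set rs" for \<alpha>' a'
    proof (rule lin_eq_0)
      fix h assume "h < length (fst (\<alpha>' @ [n], a'))"
      then show "v (fst (\<alpha>' @ [n], a') ! h) = 0"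
        using that vn by (auto simp: nth_append intro!: v0 bexI[of _ "(\<alpha>', a')"])
    qed
    then have vk: "v \<in> ker (Suc n) (S' \<union> ?f ` set rs)" using vS S' by (auto simp: ker_def)
    have "lin (\<alpha> @ [n], a) v = (\<Sum>h<Suc (length \<alpha>). if h = l then a ! l * v (\<alpha> ! l) else 0)"
    proof -
      have "a ! h * v ((\<alpha> @ [n]) ! h) = (if h = l then a ! l * v (\<alpha> ! l) else 0)" if "h < Suc (length \<alpha>)" for h
      proof -
        consider "h < l" | "h = l" | "l < h" "h < length \<alpha>" | "h = length \<alpha>" using \<open>h < Suc _\<close> by linarith
        then show ?thesis
        proof cases
          case 1
          then have "\<alpha> ! h \<in> set ?pre" using l by (auto simp: in_set_conv_nth intro!: exI[of _ h])
          then show ?thesis using 1 l v0 by (auto simp: nth_append)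
        next
          case 3
          then show ?thesis using gr[of h] vS by (auto simp: nth_append frozen_iff)
        qed (use l vn in \<open>auto simp: nth_append\<close>)
      qed
      then show ?thesis unfolding lin_def by (intro sum.cong) auto
    qed
    also have "\<dots> = a ! l * v (\<alpha> ! l)" using l by (simp add: sum.delta)
    also have "\<dots> \<noteq> 0"
    proof -
      have "a ! l \<in> set a" "0 \<notin> set a" using snoc.prems(1)[of \<alpha> a] l by (auto simp: r)
      then show ?thesis using v by auto
    qed
    finally have "\<not> vanish (Suc n) (S' \<union> ?f ` set rs) (\<alpha> @ [n], a)" using vk by (auto simp: vanish_def)
    then show ?thesis using IH nul_insert[of "Suc n" "(\<alpha> @ [n], a)" "S' \<union> ?f ` set rs"] False
      unfolding un by (auto simp: r)
  qed
qed simp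

text \<open>If every new row has an unfrozen old position, column \<open>n\<close> adds a free
  dimension and each row removes one. A row whose old positions are all frozen reduces to a nonzero
  multiple of \<open>x n\<close>, so column \<open>n\<close> acts as if pinned: the free dimension
  is lost once, however many such rows there are.\<close>

lemma nul_cavity_le:
  fixes S :: "'a :: {finite, field} srow set"
  assumes S: "S \<subseteq> rows_below n"
    and rs: "\<And>\<alpha> a. (\<alpha>, a) \<in> set rs \<Longrightarrow> set \<alpha> \<subseteq> {..<n} \<and> length a = Suc (length \<alpha>) \<and> 0 \<notin> set a"
    and nr: "\<not> related n S (concat (map fst rs))"
  shows "nul (Suc n) (S \<union> (\<lambda>(\<alpha>, a). (\<alpha> @ [n], a)) ` set rs)
    \<le> nul n S + 1 - length (filter (\<lambda>r. \<not> (\<forall>i\<in>set (fst r). frozen n S i)) rs)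
       - (if \<forall>r\<in>set rs. \<not> (\<forall>i\<in>set (fst r). frozen n S i) then 0 else 1)"
proof (cases "\<forall>r\<in>set rs. \<not> (\<forall>i\<in>set (fst r). frozen n S i)")
  case True
  have "ker n S \<subseteq> ker (Suc n) S" by (auto simp: ker_def space_n_def)
  from nul_rows_drop[OF S this rs nr] show ?thesis using True nul_Suc[OF S] by simp
next
  case False
  then obtain \<alpha> a where r: "(\<alpha>, a) \<in> set rs" "\<forall>i\<in>set \<alpha>. frozen n S i" by auto
  let ?f = "\<lambda>(\<alpha>, a). (\<alpha> @ [n], a :: 'a list)"
  let ?S' = "insert (pin n) S"
  have "x n = 0" if x: "x \<in> ker (Suc n) (S \<union> ?f ` set rs)" for x
  proof -
    have "lin (\<alpha> @ [n], a) x = 0" using x r by (force simp: ker_def)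
    have xx: "x(n := 0) \<in> ker n S"
      using x lin_upd[of _ n x 0] S by (auto simp: ker_def space_n_def)
    have "x i = 0" if "i \<in> set \<alpha>" for i
    proof -
      have "(x(n := 0)) i = 0" using r(2) that xx by (auto simp: frozen_iff simp del: fun_upd_apply)
      moreover have "i \<noteq> n" using rs[OF r(1)] that by auto
      ultimately show ?thesis by simp
    qed
    then have "lin (\<alpha> @ [n], a) x = a ! length \<alpha> * x n"
      by (simp add: lin_def nth_append)
    moreover have "a ! length \<alpha> \<noteq> 0" using rs[OF r(1)] by (metis lessI nth_mem)
    ultimately show ?thesis using \<open>lin (\<alpha> @ [n], a) x = 0\<close> by simp
  qed
  then have "ker (Suc n) (S \<union> ?f ` set rs) \<subseteq> ker (Suc n) (?S' \<union> ?f ` set rs)"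
    by (auto simp: ker_def)
  then have "nul (Suc n) (S \<union> ?f ` set rs) \<le> nul (Suc n) (?S' \<union> ?f ` set rs)"
    by (rule card_ker_le_imp_nul_le)
  also have "\<dots> \<le> nul (Suc n) ?S' - length (filter (\<lambda>r. \<not> (\<forall>i\<in>set (fst r). frozen n S i)) rs)"
    using nul_rows_drop[OF S _ rs nr, of ?S'] ker_Suc_pin[OF S] by simp
  also have "nul (Suc n) ?S' = nul n S" using ker_Suc_pin[OF S] by (simp add: nul_def)
  finally show ?thesis using False by (subst if_not_P) auto
qed

text \<open>The coordinates \<open>i\<close> and \<open>j\<close> are independent functionals, so
  they take every pair of values on the kernel, and each fibre is a translate of their joint
  kernel.\<close>

lemma card_fibre_pair:
  fixes S :: "'a :: {finite, field} srow set"
  assumes "\<not> frozen n S i" "\<not> frozen n (insert (pin i) S) j"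
  shows "card {x \<in> ker n S. x i = s \<and> x j = t} * CARD('a) ^ 2 = card (ker n S)"
proof -
  obtain v where v: "v \<in> ker n S" "v i \<noteq> 0" using assms(1) by (auto simp: vanish_def)
  obtain w where w: "w \<in> ker n S" "w i = 0" "w j \<noteq> 0" using assms(2) by (auto simp: vanish_def ker_insert)
  define a where "a = s / v i"
  define b where "b = (t - a * v j) / w j"
  define u where "u = (\<lambda>h. (0 + a * v h) + b * w h)"
  have u: "u \<in> ker n S" unfolding u_def using v w by (intro ker_lincomb) (auto simp: ker_scale)
  have us: "u i = s" "u j = t" using v w by (auto simp: u_def a_def b_def)
  have "bij_betw (\<lambda>x h. x h + u h) (ker n (insert (pin j) (insert (pin i) S))) {x \<in> ker n S. x i = s \<and> x j = t}"
  proof (rule bij_betwI[where g = "\<lambda>x h. x h - u h"])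
    show "(\<lambda>x h. x h + u h) \<in> ker n (insert (pin j) (insert (pin i) S)) \<rightarrow> {x \<in> ker n S. x i = s \<and> x j = t}"
      using u us ker_lincomb[of _ n S u 1] by (auto simp: ker_insert)
    show "(\<lambda>x h. x h - u h) \<in> {x \<in> ker n S. x i = s \<and> x j = t} \<rightarrow> ker n (insert (pin j) (insert (pin i) S))"
      using u us by (auto simp: ker_insert ker_diff)
  qed auto
  then have "card {x \<in> ker n S. x i = s \<and> x j = t} = card (ker n (insert (pin j) (insert (pin i) S)))"
    by (rule bij_betw_same_card[symmetric])
  then show ?thesis using card_ker_insert[OF assms(1)] card_ker_insert[OF assms(2)]
    by (simp add: power2_eq_square mult.commute mult.left_commute)
qed

section \<open>The random row\<close>

lemma card_positions_subset:
  assumes "C \<subseteq> {..<n}"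
  shows "card {\<alpha> \<in> positions n k. set \<alpha> \<subseteq> C} = (card C choose k)"
proof -
  have f: "finite C" using assms finite_subset by blast
  have "bij_betw set {\<alpha> \<in> positions n k. set \<alpha> \<subseteq> C} {A. A \<subseteq> C \<and> card A = k}"
  proof (rule bij_betwI[where g = sorted_list_of_set])
    show "set \<in> {\<alpha> \<in> positions n k. set \<alpha> \<subseteq> C} \<rightarrow> {A. A \<subseteq> C \<and> card A = k}"
      by (auto simp: positions_def strict_sorted_iff distinct_card)
    show "sorted_list_of_set \<in> {A. A \<subseteq> C \<and> card A = k} \<rightarrow> {\<alpha> \<in> positions n k. set \<alpha> \<subseteq> C}"
    proof
      fix A assume A: "A \<in> {A. A \<subseteq> C \<and> card A = k}"
      then have "finite A" using f finite_subset by blast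
      then show "sorted_list_of_set A \<in> {\<alpha> \<in> positions n k. set \<alpha> \<subseteq> C}"
        using A assms by (simp add: positions_def) blast
    qed
    show "sorted_list_of_set (set \<alpha>) = \<alpha>" if "\<alpha> \<in> {\<alpha> \<in> positions n k. set \<alpha> \<subseteq> C}" for \<alpha>
      using that by (intro sorted_list_of_set.idem_if_sorted_distinct) (simp_all add: positions_def strict_sorted_iff)
    show "set (sorted_list_of_set A) = A" if "A \<in> {A. A \<subseteq> C \<and> card A = k}" for A
      using that f finite_subset[of A C] by simp
  qed
  then show ?thesis by (simp add: bij_betw_same_card n_subsets f)
qed

lemma card_positions: "card (positions n k) = (n choose k)"
  using card_positions_subset[of "{..<n}" n k] by (simp add: positions_def)

lemma finite_positions [simp]: "finite (positions n k)"
  by (rule finite_subset[OF _ finite_lists_length_eq[of "{..<n}" k]]) (auto simp: positions_def)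

lemma positions_nonempty: "k \<le> n \<Longrightarrow> positions n k \<noteq> {}"
  using card_positions[of n k] by (metis binomial_eq_0_iff card.empty leD)

lemma positions_Suc: "positions (Suc n) (Suc k) = positions n (Suc k) \<union> (\<lambda>\<alpha>. \<alpha> @ [n]) ` positions n k"
proof (intro equalityI subsetI)
  fix \<alpha> assume a: "\<alpha> \<in> positions (Suc n) (Suc k)"
  then obtain \<beta> x where b: "\<alpha> = \<beta> @ [x]" by (cases \<alpha> rule: rev_cases) (auto simp: positions_def)
  show "\<alpha> \<in> positions n (Suc k) \<union> (\<lambda>\<alpha>. \<alpha> @ [n]) ` positions n k"
  proof (cases "x = n")
    case True
    then show ?thesis using a by (auto simp: b positions_def sorted_wrt_append)
  next
    case False
    then have "x < n" using a by (auto simp: b positions_def)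
    then show ?thesis using a by (auto simp: b positions_def sorted_wrt_append intro: less_trans)
  qed
next
  fix \<alpha> assume "\<alpha> \<in> positions n (Suc k) \<union> (\<lambda>\<alpha>. \<alpha> @ [n]) ` positions n k"
  then show "\<alpha> \<in> positions (Suc n) (Suc k)"
    by (auto simp: positions_def sorted_wrt_append less_Suc_eq)
qed

lemma pmf_of_set_Un:
  assumes "finite A" "finite B" "A \<noteq> {}" "B \<noteq> {}" "A \<inter> B = {}"
  shows "pmf_of_set (A \<union> B) = bind_pmf (bernoulli_pmf (card A / (card A + card B)))
    (\<lambda>b. if b then pmf_of_set A else pmf_of_set B)"
proof (rule pmf_eqI)
  fix x
  have c: "card A > 0" "card B > 0" using assms by (auto simp: card_gt_0_iff)
  have p: "0 \<le> card A / (card A + card B :: real)" "card A / (card A + card B :: real) \<le> 1"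
    "1 - card A / (card A + card B :: real) = card B / (card A + card B)"
    using c by (auto simp: field_simps)
  show "pmf (pmf_of_set (A \<union> B)) x = pmf (bind_pmf (bernoulli_pmf (card A / (card A + card B)))
    (\<lambda>b. if b then pmf_of_set A else pmf_of_set B)) x"
    unfolding pmf_bind using p(1,2) assms c
    by (subst integral_bernoulli_pmf) (auto simp: card_Un_disjoint indicator_def divide_simps)
qed

definition urow :: "nat \<Rightarrow> nat \<Rightarrow> 'a list pmf \<Rightarrow> 'a srow pmf" where
  "urow n k P = pair_pmf (pmf_of_set (positions n k)) P"

text \<open>Columns are numbered from 0, so \<open>n\<close> is the new column of a system with
  \<open>Suc n\<close> columns and, being the largest, stands last. The parameter \<open>k\<close>
  counts the old positions only; rows of size \<open>k\<close> arise from
  \<open>k - 1\<close>.\<close>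

definition lastrow :: "nat \<Rightarrow> nat \<Rightarrow> 'a list pmf \<Rightarrow> 'a srow pmf" where
  "lastrow n k P = map_pmf (\<lambda>(\<alpha>, a). (\<alpha> @ [n], a)) (urow n k P)"

text \<open>A row of size \<open>k + 1\<close> misses a given one of the \<open>n + 1\<close>
  columns with probability 1 - (k + 1) / (n + 1).\<close>

lemma urow_Suc:
  assumes "Suc k \<le> n"
  shows "urow (Suc n) (Suc k) P = bind_pmf (bernoulli_pmf (real (n - k) / real (Suc n)))
    (\<lambda>b. if b then urow n (Suc k) P else lastrow n k P)"
proof -
  let ?A = "positions n (Suc k)" and ?B = "(\<lambda>\<alpha>. \<alpha> @ [n]) ` positions n k"
  have inj: "inj_on (\<lambda>\<alpha>. \<alpha> @ [n]) (positions n k)" by (auto simp: inj_on_def)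
  have dis: "?A \<inter> ?B = {}" by (auto simp: positions_def)
  have "card ?A + card ?B = (Suc n choose Suc k)"
    using inj by (simp add: card_positions card_image)
  moreover have "(Suc n - Suc k) * (Suc n choose Suc k) = Suc n * (n choose Suc k)"
    using binomial_absorb_comp[of "Suc n" "Suc k"] by simp
  then have "real (n - k) * real (Suc n choose Suc k) = real (Suc n) * real (n choose Suc k)"
    by (metis diff_Suc_Suc of_nat_mult)
  moreover have "(Suc n choose Suc k) > 0" using assms by simp
  ultimately have r: "card ?A / (card ?A + card ?B :: real) = real (n - k) / real (Suc n)"
    by (simp add: card_positions field_simps flip: of_nat_add del: of_nat_Suc binomial_Suc_Suc)
  have B: "pmf_of_set ?B = map_pmf (\<lambda>\<alpha>. \<alpha> @ [n]) (pmf_of_set (positions n k))"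
    using inj assms positions_nonempty[of k n] by (intro map_pmf_of_set_inj[symmetric]) auto
  have "pmf_of_set (positions (Suc n) (Suc k)) = bind_pmf (bernoulli_pmf (real (n - k) / real (Suc n)))
    (\<lambda>b. if b then pmf_of_set ?A else pmf_of_set ?B)"
    unfolding positions_Suc
    by (subst pmf_of_set_Un) (use assms positions_nonempty[of "Suc k" n] positions_nonempty[of k n] dis r in auto)
  then show ?thesis unfolding urow_def lastrow_def B pair_pmf_def
    by (auto simp: bind_assoc_pmf map_pmf_def bind_return_pmf intro!: bind_pmf_cong split: if_splits)
qed

lemma prob_positions_subset:
  assumes "C \<subseteq> {..<n}" "k \<le> n"
  shows "prob (pmf_of_set (positions n k)) {\<alpha>. set \<alpha> \<subseteq> C} = (card C choose k) / (n choose k)"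
proof -
  have "positions n k \<inter> {\<alpha>. set \<alpha> \<subseteq> C} = {\<alpha> \<in> positions n k. set \<alpha> \<subseteq> C}" by auto
  then show ?thesis using assms positions_nonempty
    by (simp add: measure_pmf_of_set card_positions card_positions_subset)
qed

lemma Suc_times_binomial_Suc: "real (Suc k) * real (m choose Suc k) = real (m - k) * real (m choose k)"
  unfolding of_nat_mult[symmetric] by (simp only: binomial_absorption binomial_absorb_comp)

lemma binomial_ratio_Suc:
  assumes "Suc k \<le> n"
  shows "real (f choose Suc k) / real (n choose Suc k) = real (f choose k) / real (n choose k) * (real (f - k) / real (n - k))"
proof -
  have "real (f choose Suc k) = real (f - k) * real (f choose k) / Suc k"
    "real (n choose Suc k) = real (n - k) * real (n choose k) / Suc k"
    using Suc_times_binomial_Suc[of k f] Suc_times_binomial_Suc[of k n] by (simp_all add: field_simps del: of_nat_Suc)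
  then show ?thesis by (simp add: mult.commute del: of_nat_Suc)
qed

text \<open>Drawing without replacement: each successive factor (f - j) / (n - j) is at most f /
  n.\<close>

lemma binomial_ratio_le:
  assumes "f \<le> n" "k \<le> n"
  shows "real (f choose k) / real (n choose k) \<le> (f / n) ^ k"
  using assms(2)
proof (induction k)
  case (Suc k)
  have "real (f - k) * n \<le> real f * real (n - k)"
  proof (cases "k \<le> f")
    case True
    then have "real (f - k) * n = f * real n - k * real n" by (simp add: of_nat_diff algebra_simps)
    moreover have "real f * real (n - k) = f * real n - k * real f" using Suc.prems by (simp add: of_nat_diff algebra_simps)
    ultimately show ?thesis using assms(1) by (simp add: mult_left_mono)
  qed simp
  then have "real (f - k) / real (n - k) \<le> f / n" using Suc.prems by (simp add: field_simps)
  then show ?case unfolding binomial_ratio_Suc[OF Suc.prems]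
    unfolding power_Suc2 using Suc by (intro mult_mono) auto
qed simp

lemma binomial_ratio_nonneg_le_1: "f \<le> n \<Longrightarrow> 0 \<le> real (f choose k) / real (n choose k) \<and> real (f choose k) / real (n choose k) \<le> 1"
  by (cases "k \<le> n") (auto simp: binomial_right_mono divide_le_eq_1)

lemma binomial_ratio_ge:
  assumes "f \<le> n" "k \<le> n"
  shows "(f / n) ^ k - real (k ^ 2) / n \<le> real (f choose k) / real (n choose k)"
  using assms(2)
proof (induction k)
  case (Suc k)
  let ?x = "real (f choose k) / real (n choose k)"
  have n: "n > 0" using Suc.prems by simp
  have al: "0 \<le> f / real n" "f / real n \<le> 1" using assms n by auto
  have x: "0 \<le> ?x" "?x \<le> 1" using binomial_ratio_nonneg_le_1[OF assms(1), of k] by auto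
  have k2: "real (k ^ 2) / n + k / n \<le> real ((Suc k) ^ 2) / n"
    by (simp add: power2_eq_square add_divide_distrib[symmetric] divide_right_mono)
  show ?case
  proof (cases "f < k")
    \<comment> \<open>Here the truncated difference \<open>f - k\<close> is 0. The fraction
      \<open>f / n\<close> is below \<open>k / n\<close>, so the left side of the claim is not
      positive.\<close>
    case True
    have "(f / n) ^ Suc k \<le> f / n" using mult_left_mono[OF power_le_one[OF al] al(1), of k] by simp
    also have "\<dots> \<le> k / n" using True by (simp add: divide_right_mono)
    also have "\<dots> \<le> real ((Suc k) ^ 2) / n" using k2 by (smt (verit) divide_nonneg_nonneg of_nat_0_le_iff)
    finally show ?thesis by (smt (verit) divide_nonneg_nonneg of_nat_0_le_iff)
  next
    case False
    have "(f / n) ^ Suc k - real ((Suc k) ^ 2) / n \<le> f / n * ((f / n) ^ k - real (k ^ 2) / n) - k / n"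
    proof -
      have "f / n * (real (k ^ 2) / n) \<le> 1 * (real (k ^ 2) / n)" using al by (intro mult_right_mono) auto
      then show ?thesis using k2 by (simp add: algebra_simps)
    qed
    also have "\<dots> \<le> f / n * ?x - k / n * ?x"
    proof -
      have "f / n * ((f / n) ^ k - real (k ^ 2) / n) \<le> f / n * ?x" using Suc al by (intro mult_left_mono) auto
      moreover have "k / n * ?x \<le> k / n * 1" using x by (intro mult_left_mono) auto
      ultimately show ?thesis by simp
    qed
    also have "\<dots> = ?x * ((real f - real k) / n)" by (simp add: algebra_simps diff_divide_distrib)
    also have "\<dots> \<le> ?x * (real (f - k) / real (n - k))"
      using False x Suc.prems by (intro mult_left_mono) (auto simp: of_nat_diff intro!: divide_left_mono)
    finally show ?thesis unfolding binomial_ratio_Suc[OF Suc.prems] .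
  qed
qed simp

section \<open>Independent uniform coordinates in place of increasing positions\<close>

lemma replicate_map_pmf: "replicate_pmf m (map_pmf f R) = map_pmf (map f) (replicate_pmf m R)"
  by (induction m) (simp_all add: map_pmf_def bind_assoc_pmf bind_return_pmf)

lemma pmf_replicate: "length xs = m \<Longrightarrow> pmf (replicate_pmf m R) xs = prod_list (map (pmf R) xs)"
proof (induction m arbitrary: xs)
  case (Suc m)
  then obtain y ys where xs: "xs = y # ys" "length ys = m" by (cases xs) auto
  have "replicate_pmf (Suc m) R = map_pmf (\<lambda>(x, xs). x # xs) (pair_pmf R (replicate_pmf m R))"
    by (simp add: pair_pmf_def map_pmf_def bind_assoc_pmf bind_return_pmf)
  moreover have "pmf (map_pmf (\<lambda>(x, xs). x # xs) (pair_pmf R (replicate_pmf m R))) (case (y, ys) of (x, xs) \<Rightarrow> x # xs)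
     = pmf (pair_pmf R (replicate_pmf m R)) (y, ys)"
    by (rule pmf_map_inj') (auto simp: inj_def)
  ultimately show ?case using Suc.IH[of ys] xs by (simp add: pmf_pair)
qed simp

lemma finite_set_replicate_pmf: "finite (set_pmf R) \<Longrightarrow> finite (set_pmf (replicate_pmf m R))"
  unfolding set_replicate_pmf by (rule finite_subset[OF _ finite_lists_length_eq[of "set_pmf R" m]]) auto

abbreviation ucoord :: "nat \<Rightarrow> nat pmf" where
  "ucoord n \<equiv> pmf_of_set {..<n}"

lemma expt_replicate_ucoord:
  assumes "0 < n"
  shows "expt (replicate_pmf k (ucoord n)) f = (\<Sum>\<beta>\<in>{\<beta>. set \<beta> \<subseteq> {..<n} \<and> length \<beta> = k}. f \<beta>) / real n ^ k"
proof -
  let ?L = "{\<beta>. set \<beta> \<subseteq> {..<n} \<and> length \<beta> = k}"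
  have L: "finite ?L" by (rule finite_lists_length_eq) simp
  have p: "pmf (replicate_pmf k (ucoord n)) \<beta> = 1 / real n ^ k" if "\<beta> \<in> ?L" for \<beta>
  proof -
    have "map (pmf (ucoord n)) \<beta> = map (\<lambda>_. 1 / n) \<beta>"
      using that assms by (intro map_cong refl) (auto simp: lessThan_empty_iff indicator_def)
    then show ?thesis using that
      by (subst pmf_replicate) (auto simp: map_replicate_const prod_list_replicate power_divide)
  qed
  have "expt (replicate_pmf k (ucoord n)) f = (\<Sum>\<beta>\<in>?L. f \<beta> * pmf (replicate_pmf k (ucoord n)) \<beta>)"
    using assms by (intro integral_measure_pmf_real L) (auto simp: set_replicate_pmf lessThan_empty_iff)
  then show ?thesis by (simp add: p sum_divide_distrib)
qed

text \<open>The constant is far from sharp, but it only multiplies an error that pinning makes arbitrarily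
  small.\<close>

lemma expt_positions_le:
  assumes "0 < k" "k \<le> n" "\<And>x. 0 \<le> f x" "\<And>x. f x \<le> B"
  shows "expt (pmf_of_set (positions n k)) f \<le> real k ^ k * expt (replicate_pmf k (ucoord n)) f"
proof -
  have n: "n > 0" using assms by simp
  let ?R = "replicate_pmf k (ucoord n)"
  have "(\<Sum>\<alpha>\<in>positions n k. f \<alpha>) \<le> (\<Sum>\<beta>\<in>{\<beta>. set \<beta> \<subseteq> {..<n} \<and> length \<beta> = k}. f \<beta>)"
    using assms(3) by (intro sum_mono2 finite_lists_length_eq) (auto simp: positions_def)
  then have 1: "(\<Sum>\<alpha>\<in>positions n k. f \<alpha>) * (1 / n) ^ k \<le> expt ?R f"
    by (simp add: expt_replicate_ucoord[OF n] power_divide divide_right_mono)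
  have "(real n / k) ^ k \<le> (n choose k)" using binomial_ge_n_over_k_pow_k[of k n] assms by simp
  then have b: "real n ^ k \<le> real k ^ k * (n choose k)" using assms by (simp add: power_divide field_simps)
  have "expt (pmf_of_set (positions n k)) f = (\<Sum>\<alpha>\<in>positions n k. f \<alpha>) / (n choose k)"
    using positions_nonempty[OF assms(2)] by (subst integral_pmf_of_set) (auto simp: card_positions)
  also have "\<dots> \<le> (\<Sum>\<alpha>\<in>positions n k. f \<alpha>) * (real k ^ k * (1 / n) ^ k)"
  proof -
    have "1 / real (n choose k) \<le> real k ^ k * (1 / n) ^ k"
      using b n assms(2) by (simp add: field_simps power_divide)
    then show ?thesis using mult_left_mono[of "1 / real (n choose k)" _ "\<Sum>\<alpha>\<in>positions n k. f \<alpha>"]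
      by (simp add: sum_nonneg assms(3))
  qed
  also have "\<dots> \<le> real k ^ k * expt ?R f"
    using mult_left_mono[OF 1, of "real k ^ k"] by (simp add: algebra_simps)
  finally show ?thesis .
qed

text \<open>Each block of positions costs one factor \<open>k ^ k\<close>. The total is exponential
  in the number of blocks, which a Poisson average tolerates.\<close>

lemma expt_blocks_le:
  assumes "0 < k" "k \<le> n" "\<And>x. 0 \<le> f x" "\<And>x. f x \<le> B"
  shows "expt (replicate_pmf m (pmf_of_set (positions n k))) (\<lambda>\<alpha>s. f (concat \<alpha>s))
    \<le> (real k ^ k) ^ m * expt (replicate_pmf (m * k) (ucoord n)) f"
  using assms(3,4)
proof (induction m arbitrary: f)
  case (Suc m)
  let ?R = "pmf_of_set (positions n k)"
  have ab: "\<bar>f x\<bar> \<le> B" for x using Suc.prems by (simp add: abs_le_iff order_trans[of _ 0])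
  have int: "integrable (measure_pmf M) (\<lambda>x. expt (N x) (\<lambda>y. f (g x y)))" for M :: "nat list pmf" and N :: "nat list \<Rightarrow> 'z pmf" and g
    by (rule integrable_pmf_bounded[where B = B], rule abs_expt_le) (rule ab)
  have "expt (replicate_pmf (Suc m) ?R) (\<lambda>\<alpha>s. f (concat \<alpha>s)) = expt ?R (\<lambda>\<alpha>. expt (replicate_pmf m ?R) (\<lambda>\<alpha>s. f (\<alpha> @ concat \<alpha>s)))"
    using ab by (subst expt_replicate_Suc[where B = B]) auto
  also have "\<dots> \<le> expt ?R (\<lambda>\<alpha>. (real k ^ k) ^ m * expt (replicate_pmf (m * k) (ucoord n)) (\<lambda>ys. f (\<alpha> @ ys)))"
  proof (intro expt_mono int integrable_mult_right)
    fix \<alpha>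
    show "expt (replicate_pmf m ?R) (\<lambda>\<alpha>s. f (\<alpha> @ concat \<alpha>s))
      \<le> (real k ^ k) ^ m * expt (replicate_pmf (m * k) (ucoord n)) (\<lambda>ys. f (\<alpha> @ ys))"
      by (rule Suc.IH[of "\<lambda>ys. f (\<alpha> @ ys)"]) (auto intro: Suc.prems)
  qed
  also have "\<dots> = (real k ^ k) ^ m * expt ?R (\<lambda>\<alpha>. expt (replicate_pmf (m * k) (ucoord n)) (\<lambda>ys. f (\<alpha> @ ys)))"
    by simp
  also have "\<dots> \<le> (real k ^ k) ^ m * (real k ^ k * expt (replicate_pmf k (ucoord n)) (\<lambda>\<alpha>. expt (replicate_pmf (m * k) (ucoord n)) (\<lambda>ys. f (\<alpha> @ ys))))"
    using Suc.prems by (intro mult_left_mono expt_positions_le[where B = B] assms expt_le_const expt_ge_const integrable_pmf_bounded[where B = B] ab) auto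
  also have "expt (replicate_pmf k (ucoord n)) (\<lambda>\<alpha>. expt (replicate_pmf (m * k) (ucoord n)) (\<lambda>ys. f (\<alpha> @ ys)))
     = expt (replicate_pmf (Suc m * k) (ucoord n)) f"
    using expt_replicate_add[of f B k "m * k"] ab by simp
  finally show ?case by (simp add: mult.commute mult.left_commute)
qed simp

section \<open>Pinning\<close>

text \<open>Pinning a uniformly random number of random coordinates removes almost all dependencies
  between randomly chosen coordinates: a dependency that is created by a random coordinate is paid
  for by the decay of the probability of being unfrozen, and the latter telescopes.\<close>

definition pins :: "nat \<Rightarrow> nat \<Rightarrow> 'a :: {finite, field} srow set pmf" where
  "pins T n = bind_pmf (pmf_of_set {..<T}) (\<lambda>\<theta>. map_pmf (\<lambda>ps. pin ` set ps) (replicate_pmf \<theta> (ucoord n)))"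

lemma finite_set_pins: "n > 0 \<Longrightarrow> T > 0 \<Longrightarrow> finite (set_pmf (pins T n))"
  unfolding pins_def by (auto simp: lessThan_empty_iff intro!: finite_set_replicate_pmf)

lemma expt_pins:
  assumes "\<And>Q. \<bar>f Q\<bar> \<le> B" "T > 0"
  shows "expt (pins T n) f = (\<Sum>\<theta><T. expt (replicate_pmf \<theta> (ucoord n)) (\<lambda>ps. f (pin ` set ps))) / T"
  unfolding pins_def using assms
  by (subst expt_bind[where B = B]) (auto simp: integral_pmf_of_set lessThan_empty_iff)

text \<open>If the first relation appears at the \<open>l\<close>-th random coordinate, that
  coordinate was unfrozen and becomes frozen by pinning \<open>l\<close> further random coordinates.
  The probability of this is the drop of the unfrozen fraction from \<open>\<theta>\<close> to
  \<open>\<theta> + l\<close> pins, since fresh coordinates appended to pins are distributed like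
  more pins.\<close>

lemma expt_related_le:
  fixes S :: "'a :: {finite, field} srow set"
  assumes "n > 0" "T > 0"
  shows "expt (pins T n) (\<lambda>Q. expt (replicate_pmf L (ucoord n)) (\<lambda>js. of_bool (related n (S \<union> Q) js))) \<le> real L ^ 2 / T"
proof -
  define unfr :: "'a srow set \<Rightarrow> real" where
    "unfr S = expt (ucoord n) (\<lambda>j. of_bool (\<not> frozen n S j))" for S
  have unfr_bd: "0 \<le> unfr S" "unfr S \<le> 1" "\<bar>unfr S\<bar> \<le> 1" for S
    unfolding unfr_def
    by (auto intro!: expt_le_const expt_ge_const abs_expt_le integrable_pmf_bounded[where B = 1])
  define g where "g \<theta> = expt (replicate_pmf \<theta> (ucoord n)) (\<lambda>ps. unfr (S \<union> pin ` set ps))" for \<theta>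
  have g: "0 \<le> g \<theta>" "g \<theta> \<le> 1" for \<theta>
    unfolding g_def by (auto intro!: expt_le_const expt_ge_const integrable_pmf_bounded[where B = 1] unfr_bd)
  have one: "expt (replicate_pmf L (ucoord n)) (\<lambda>js. of_bool (related n S js))
     \<le> (\<Sum>l<L. unfr S - expt (replicate_pmf l (ucoord n)) (\<lambda>js. unfr (S \<union> pin ` set js)))" for S
  proof (induction L)
    case (Suc L)
    have "expt (replicate_pmf (Suc L) (ucoord n)) (\<lambda>js. of_bool (related n S js))
      = expt (replicate_pmf L (ucoord n)) (\<lambda>js. expt (ucoord n) (\<lambda>j. of_bool (related n S (js @ [j]))))"
      by (rule expt_replicate_snoc[where B = 1]) auto
    also have "\<dots> \<le> expt (replicate_pmf L (ucoord n)) (\<lambda>js. expt (ucoord n) (\<lambda>j.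
        of_bool (related n S js) + (of_bool (\<not> frozen n S j) - of_bool (\<not> frozen n (S \<union> pin ` set js) j))))"
    proof (intro expt_mono)
      fix js j
      show "of_bool (related n S (js @ [j])) \<le> (of_bool (related n S js) + (of_bool (\<not> frozen n S j) - of_bool (\<not> frozen n (S \<union> pin ` set js) j)) :: real)"
        using vanish_mono[of n S "pin j" "S \<union> pin ` set js"] by (auto simp: related_snoc of_bool_def)
    qed (auto intro!: integrable_pmf_bounded[where B = 3] abs_expt_le)
    also have "\<dots> = expt (replicate_pmf L (ucoord n)) (\<lambda>js. of_bool (related n S js) + (unfr S - unfr (S \<union> pin ` set js)))"
      unfolding unfr_def
      by (intro expt_cong) (simp add: integrable_pmf_bounded[where B = 1])
    also have "\<dots> = expt (replicate_pmf L (ucoord n)) (\<lambda>js. of_bool (related n S js)) +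
       (unfr S - expt (replicate_pmf L (ucoord n)) (\<lambda>js. unfr (S \<union> pin ` set js)))"
      by (simp add: integrable_pmf_bounded[where B = 1] unfr_bd)
    finally show ?case using Suc by simp
  qed (simp add: related_def)
  \<comment> \<open>Shifting by one more pin leaves only two boundary terms in the sum over
    \<open>\<theta>\<close>, whose difference is at most 1 as \<open>g\<close> lies between 0 and
    1.\<close>
  have tele: "(\<Sum>\<theta><T. g \<theta> - g (\<theta> + l)) \<le> l" for l
  proof (induction l)
    case (Suc l)
    have "(\<Sum>\<theta><T. g (\<theta> + l)) - (\<Sum>\<theta><T. g (\<theta> + Suc l)) = g l - g (T + l)"
    proof -
      have "(\<Sum>\<theta><T. g (\<theta> + l) - g (\<theta> + Suc l)) = g l - g (T + l)"
        using sum_lessThan_telescope'[of "\<lambda>\<theta>. g (\<theta> + l)" T] by simp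
      then show ?thesis by (simp add: sum_subtractf)
    qed
    then show ?case using Suc g[of l] g[of "T + l"] by (simp add: sum_subtractf)
  qed (simp add: sum_subtractf)
  have two: "expt (replicate_pmf \<theta> (ucoord n)) (\<lambda>ps. expt (replicate_pmf L (ucoord n)) (\<lambda>js. of_bool (related n (S \<union> pin ` set ps) js)))
     \<le> (\<Sum>l<L. g \<theta> - g (\<theta> + l))" for \<theta>
  proof -
    have i1: "\<bar>expt (replicate_pmf l (ucoord n)) (\<lambda>js. unfr (S \<union> js'  \<union> pin ` set js))\<bar> \<le> 1" for js' l
      by (rule abs_expt_le) (rule unfr_bd)
    have i1': "integrable (measure_pmf M) (\<lambda>ps. expt (replicate_pmf l (ucoord n)) (\<lambda>js. unfr (S \<union> pin ` set ps \<union> pin ` set js)))" for M l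
      by (rule integrable_pmf_bounded[where B = 1]) (rule i1)
    have i2: "integrable (measure_pmf M) (\<lambda>ps. unfr (S \<union> pin ` set ps))" for M
      by (rule integrable_pmf_bounded[where B = 1]) (rule unfr_bd)
    have "expt (replicate_pmf \<theta> (ucoord n)) (\<lambda>ps. expt (replicate_pmf L (ucoord n)) (\<lambda>js. of_bool (related n (S \<union> pin ` set ps) js)))
      \<le> expt (replicate_pmf \<theta> (ucoord n)) (\<lambda>ps. \<Sum>l<L. unfr (S \<union> pin ` set ps)
          - expt (replicate_pmf l (ucoord n)) (\<lambda>js. unfr (S \<union> pin ` set ps \<union> pin ` set js)))"
    proof (rule expt_mono)
      show "integrable (replicate_pmf \<theta> (ucoord n)) (\<lambda>ps. expt (replicate_pmf L (ucoord n)) (\<lambda>js. of_bool (related n (S \<union> pin ` set ps) js)))"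
        by (auto intro!: integrable_pmf_bounded[where B = 1] abs_expt_le)
    qed (intro one Bochner_Integration.integrable_sum Bochner_Integration.integrable_diff i1' i2)+
    also have "\<dots> = (\<Sum>l<L. g \<theta> - g (\<theta> + l))"
    proof -
      have "g (\<theta> + l) = expt (replicate_pmf \<theta> (ucoord n)) (\<lambda>ps. expt (replicate_pmf l (ucoord n))
          (\<lambda>js. unfr (S \<union> pin ` set ps \<union> pin ` set js)))" for l
        by (simp add: g_def expt_replicate_add[where B = 1] unfr_bd image_Un Un_assoc)
      then show ?thesis by (simp add: i1' i2 Bochner_Integration.integral_sum) (simp add: g_def)
    qed
    finally show ?thesis .
  qed
  have "expt (pins T n) (\<lambda>Q. expt (replicate_pmf L (ucoord n)) (\<lambda>js. of_bool (related n (S \<union> Q) js)))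
    = (\<Sum>\<theta><T. expt (replicate_pmf \<theta> (ucoord n)) (\<lambda>ps. expt (replicate_pmf L (ucoord n)) (\<lambda>js. of_bool (related n (S \<union> pin ` set ps) js)))) / T"
    by (rule expt_pins[where B = 1], rule abs_expt_le) (auto intro: assms)
  also have "\<dots> \<le> (\<Sum>\<theta><T. \<Sum>l<L. g \<theta> - g (\<theta> + l)) / T"
    by (intro divide_right_mono sum_mono two) auto
  also have "(\<Sum>\<theta><T. \<Sum>l<L. g \<theta> - g (\<theta> + l)) = (\<Sum>l<L. \<Sum>\<theta><T. g \<theta> - g (\<theta> + l))"
    by (rule sum.swap)
  also have "\<dots> \<le> (\<Sum>l<L. real L)" using tele by (intro sum_mono) (force intro: order_trans)
  finally show ?thesis by (simp add: power2_eq_square divide_right_mono)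
qed

text \<open>Each pin hits the additional coordinate with probability 1 / (n + 1), and moving one pin
  changes the nullity by at most 1.\<close>

lemma expt_replicate_pins_Suc_le:
  assumes "n > 0"
  shows "expt (replicate_pmf \<theta> (ucoord (Suc n))) (\<lambda>ps. nul n' (S \<union> pin ` set ps))
    \<le> expt (replicate_pmf \<theta> (ucoord n)) (\<lambda>ps. nul n' (S \<union> pin ` set ps)) + \<theta> / Suc n"
proof (induction \<theta> arbitrary: S)
  case (Suc \<theta>)
  let ?N = "\<lambda>S n. expt (replicate_pmf \<theta> (ucoord n)) (\<lambda>ps. nul n' (S \<union> pin ` set ps))"
  have bd: "\<bar>?N S n\<bar> \<le> n'" for S n by (rule abs_expt_le) (rule nul_abs_le)
  have rep: "expt (replicate_pmf (Suc \<theta>) (ucoord m)) (\<lambda>ps. nul n' (S \<union> pin ` set ps)) = expt (ucoord m) (\<lambda>j. ?N (insert (pin j) S) m)" for m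
    by (subst expt_replicate_Suc[where B = n']) (auto simp: nul_abs_le)
  have int: "integrable (measure_pmf M) (\<lambda>j. ?N (insert (pin j) S) m)" for M m
    by (rule integrable_pmf_bounded[where B = n']) (rule bd)
  define X where "X = ?N S n"
  have osc: "?N (insert (pin j) S) n \<le> X \<and> X - 1 \<le> ?N (insert (pin j) S) n" for j
  proof -
    have b: "nul n' (insert (pin j) S \<union> R) \<le> nul n' (S \<union> R) \<and> nul n' (S \<union> R) - 1 \<le> nul n' (insert (pin j) S \<union> R)" for R
      using nul_insert[of n' "pin j" "S \<union> R"] by auto
    have i: "integrable (measure_pmf M) (\<lambda>ps. nul n' (S \<union> pin ` set ps))" for M S
      by (rule integrable_pmf_bounded[where B = n']) (rule nul_abs_le)
    have "?N (insert (pin j) S) n \<le> ?N S n"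
      using b by (intro expt_mono i) blast
    moreover have "expt (replicate_pmf \<theta> (ucoord n)) (\<lambda>ps. nul n' (S \<union> pin ` set ps) - 1) \<le> ?N (insert (pin j) S) n"
      using b by (intro expt_mono Bochner_Integration.integrable_diff i) (blast | simp)+
    moreover have "expt (replicate_pmf \<theta> (ucoord n)) (\<lambda>ps. nul n' (S \<union> pin ` set ps) - 1) = X - 1"
      unfolding X_def by (subst Bochner_Integration.integral_diff) (auto intro: i)
    ultimately show ?thesis by (simp add: X_def)
  qed
  let ?h = "\<lambda>j. ?N (insert (pin j) S) n"
  have "expt (ucoord (Suc n)) (\<lambda>j. ?N (insert (pin j) S) (Suc n)) \<le> expt (ucoord (Suc n)) (\<lambda>j. ?h j + \<theta> / Suc n)"
    by (intro expt_mono int Bochner_Integration.integrable_add Suc.IH) auto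
  also have "\<dots> = expt (ucoord (Suc n)) ?h + \<theta> / Suc n" using int by simp
  also have "expt (ucoord (Suc n)) ?h = ((\<Sum>j<n. ?h j) + ?h n) / Suc n"
    by (subst integral_pmf_of_set) (auto simp: lessThan_empty_iff)
  also have "\<dots> \<le> (\<Sum>j<n. ?h j) / n + 1 / Suc n"
  proof -
    have "(\<Sum>j<n. ?h j) \<ge> (\<Sum>j<n. X - 1)" using osc by (intro sum_mono) auto
    then have "(\<Sum>j<n. ?h j) \<ge> n * (X - 1)" by simp
    moreover have "n * ?h n \<le> n * X" using osc[of n] by (intro mult_left_mono) auto
    ultimately have "n * ?h n \<le> (\<Sum>j<n. ?h j) + n" by (simp add: algebra_simps)
    then have "?h n \<le> ((\<Sum>j<n. ?h j) + n) / n" using assms by (simp add: pos_le_divide_eq mult.commute)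
    then have "?h n \<le> (\<Sum>j<n. ?h j) / n + 1" using assms by (simp add: add_divide_distrib)
    then have "(\<Sum>j<n. ?h j) + ?h n \<le> (\<Sum>j<n. ?h j) / n * real (Suc n) + 1"
      using assms by (simp add: distrib_left add_divide_distrib)
    then have "((\<Sum>j<n. ?h j) + ?h n) / Suc n \<le> ((\<Sum>j<n. ?h j) / n * real (Suc n) + 1) / Suc n"
      by (rule divide_right_mono) simp
    then show ?thesis by (simp only: add_divide_distrib) simp
  qed
  also have "(\<Sum>j<n. ?h j) / n = expt (ucoord n) ?h"
    using assms by (subst integral_pmf_of_set) (auto simp: lessThan_empty_iff)
  finally show ?case unfolding rep by (simp add: add_divide_distrib)
qed simp

lemma expt_pins_Suc_le:
  assumes "n > 0" "T > 0"
  shows "expt (pins T (Suc n)) (\<lambda>Q. nul n' (S \<union> Q)) \<le> expt (pins T n) (\<lambda>Q. nul n' (S \<union> Q)) + T / Suc n"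
proof -
  have "expt (pins T (Suc n)) (\<lambda>Q. nul n' (S \<union> Q))
    = (\<Sum>\<theta><T. expt (replicate_pmf \<theta> (ucoord (Suc n))) (\<lambda>ps. nul n' (S \<union> pin ` set ps))) / T"
    by (rule expt_pins[where B = n']) (auto simp: nul_abs_le assms)
  also have "\<dots> \<le> (\<Sum>\<theta><T. expt (replicate_pmf \<theta> (ucoord n)) (\<lambda>ps. nul n' (S \<union> pin ` set ps)) + T / Suc n) / T"
  proof (intro divide_right_mono sum_mono)
    fix \<theta> assume "\<theta> \<in> {..<T}"
    then have "\<theta> / Suc n \<le> T / Suc n" by (intro divide_right_mono) auto
    then show "expt (replicate_pmf \<theta> (ucoord (Suc n))) (\<lambda>ps. nul n' (S \<union> pin ` set ps))
      \<le> expt (replicate_pmf \<theta> (ucoord n)) (\<lambda>ps. nul n' (S \<union> pin ` set ps)) + T / Suc n"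
      using expt_replicate_pins_Suc_le[OF assms(1), of \<theta> n' S] by linarith
  qed auto
  also have "\<dots> = expt (pins T n) (\<lambda>Q. nul n' (S \<union> Q)) + T / Suc n"
    using assms by (subst expt_pins[where B = n' and T = T]) (auto simp: nul_abs_le sum.distrib add_divide_distrib)
  finally show ?thesis .
qed

section \<open>Upper bound on the nullity\<close>

lemma cavity_mono:
  fixes d p p' :: real
  assumes "0 < d" "0 \<le> p" "p \<le> p'"
  shows "exp (- (d * p)) - d * (1 - p) \<le> exp (- (d * p')) - d * (1 - p')"
proof -
  have "1 + (- (d * (p' - p))) \<le> exp (- (d * (p' - p)))"
    using exp_ge_add_one_self[of "- (d * (p' - p))"] by simp
  then have "exp (- (d * p)) * (1 - exp (- (d * (p' - p)))) \<le> 1 * (d * (p' - p))"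
    using assms by (intro mult_mono) auto
  moreover have "exp (- (d * p)) * exp (- (d * (p' - p))) = exp (- (d * p'))"
    by (simp add: exp_add[symmetric] algebra_simps)
  ultimately show ?thesis by (simp add: algebra_simps)
qed

locale sparse_system =
  fixes k :: nat and P :: "'a :: {finite, field} list pmf"
  assumes k_ge_3: "k \<ge> 3" and P_inv: "perm_invariant_nonzero k P"
begin

abbreviation urows :: "nat \<Rightarrow> nat \<Rightarrow> 'a srow list pmf" where
  "urows n m \<equiv> replicate_pmf m (urow n k P)"

lemma set_P: "a \<in> set_pmf P \<Longrightarrow> length a = k \<and> 0 \<notin> set a"
  using P_inv unfolding perm_invariant_nonzero_def by auto

lemma k_pos: "0 < k" using k_ge_3 by simp

lemma finite_set_P: "finite (set_pmf P)"
  by (rule finite_subset[OF _ finite_lists_length_eq[of UNIV k]]) (use set_P in auto)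

lemma set_urow:
  assumes "j \<le> n" "r \<in> set_pmf (urow n j P)"
  shows "fst r \<in> positions n j" "length (snd r) = k" "0 \<notin> set (snd r)"
  using assms set_P positions_nonempty[of j n] by (auto simp: urow_def set_pmf_of_set)

lemma set_urow_below:
  assumes "k \<le> n" "r \<in> set_pmf (urow n k P)" shows "r \<in> rows_below n"
  using set_urow(1)[OF assms] by (auto simp: rows_below_def positions_def)

lemma prob_urow_fst:
  "prob (urow n j P) {r. Q (fst r)} = prob (pmf_of_set (positions n j)) {\<alpha>. Q \<alpha>}"
proof -
  have "pmf_of_set (positions n j) = map_pmf fst (urow n j P)" by (simp add: urow_def map_fst_pair_pmf)
  then show ?thesis by (simp add: vimage_def)
qed

lemma prob_urow_subset:
  assumes "C \<subseteq> {..<n}" "j \<le> n"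
  shows "prob (urow n j P) {r. set (fst r) \<subseteq> C} = (card C choose j) / (n choose j)"
  unfolding prob_urow_fst[where Q = "\<lambda>\<alpha>. set \<alpha> \<subseteq> C"] by (rule prob_positions_subset[OF assms])

lemma prob_frozen_row:
  assumes "j \<le> n"
  shows "prob (urow n j P) {r. \<forall>i\<in>set (fst r). frozen n S i} = (card (frozen_set n S) choose j) / (n choose j)"
proof -
  have "prob (urow n j P) {r. \<forall>i\<in>set (fst r). frozen n S i} = prob (urow n j P) {r. set (fst r) \<subseteq> frozen_set n S}"
    using set_urow(1)[OF assms] by (intro measure_eq_AE) (auto simp: AE_measure_pmf_iff positions_def)
  then show ?thesis using prob_urow_subset[of "frozen_set n S" n j] assms by auto
qed

text \<open>The probability that the hypothesis of \<open>nul_cavity_le\<close> fails for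
  \<open>m\<close> new rows.\<close>

definition rel_err :: "nat \<Rightarrow> 'a srow set \<Rightarrow> nat \<Rightarrow> real" where
  "rel_err n S m = expt (replicate_pmf m (pmf_of_set (positions n (k - 1)))) (\<lambda>\<alpha>s. of_bool (related n S (concat \<alpha>s)))"

lemma rel_err_bounds: "0 \<le> rel_err n S m" "rel_err n S m \<le> 1"
  unfolding rel_err_def by (auto intro!: expt_ge_const expt_le_const integrable_pmf_bounded[where B = 1])

lemma integrable_rel_err: "0 < l \<Longrightarrow> integrable (poisson_pmf l) (\<lambda>m. (1 + real m) * rel_err n S m)"
  using mult_mono[OF of_nat_Suc_le_two_power rel_err_bounds(2)] rel_err_bounds(1)
  by (intro integrable_poisson[where B = 2 and C = 1]) (auto simp: abs_mult)

text \<open>The probability that the old positions of a new row are all frozen is \<open>p\<close>.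
  Among \<open>m\<close> rows, \<open>m * (1 - p)\<close> are expected to lower the nullity, and
  with probability \<open>(1 - p) ^ m\<close> the new column stays free; the Poisson averages are
  \<open>d * (1 - p)\<close> and \<open>exp (- (d * p))\<close>.\<close>

lemma expt_cavity_le:
  assumes n: "k \<le> n" and S: "S \<subseteq> rows_below n" and d: "0 < d"
  defines "p \<equiv> (card (frozen_set n S) choose (k - 1)) / (n choose (k - 1))"
  shows "expt (poisson_set d (lastrow n (k - 1) P)) (\<lambda>V. nul (Suc n) (S \<union> V))
    \<le> nul n S + exp (- (d * p)) - d * (1 - p) + expt (poisson_pmf d) (\<lambda>m. (1 + real m) * rel_err n S m)"
proof -
  let ?R = "urow n (k - 1) P" and ?f = "\<lambda>(\<alpha>, a :: 'a list). (\<alpha> @ [n], a)"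
  let ?NF = "\<lambda>r. \<not> (\<forall>i\<in>set (fst r). frozen n S i)"
  have p: "0 \<le> p" "p \<le> 1" using binomial_ratio_nonneg_le_1[of "card (frozen_set n S)" n "k - 1"]
      card_mono[of "{..<n}" "frozen_set n S"] by (auto simp: p_def)
  have pr: "prob ?R {r. ?NF r} = 1 - p"
  proof -
    have "{r. ?NF r} = space ?R - {r. \<forall>i\<in>set (fst r). frozen n S i}" by auto
    then have "prob ?R {r. ?NF r} = 1 - prob ?R {r. \<forall>i\<in>set (fst r). frozen n S i}"
      by (simp only: measure_pmf.prob_compl sets_measure_pmf UNIV_I)
    then show ?thesis using prob_frozen_row[of "k - 1" n S] n by (simp add: p_def)
  qed
  have per: "expt (replicate_pmf m (lastrow n (k - 1) P)) (\<lambda>xs. nul (Suc n) (S \<union> set xs))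
     \<le> nul n S - m * (1 - p) + (1 - p) ^ m + (1 + real m) * rel_err n S m" for m
  proof -
    let ?rel = "\<lambda>rs. related n S (concat (map fst rs))"
    have "expt (replicate_pmf m (lastrow n (k - 1) P)) (\<lambda>xs. nul (Suc n) (S \<union> set xs))
      = expt (replicate_pmf m ?R) (\<lambda>rs. nul (Suc n) (S \<union> ?f ` set rs))"
      unfolding lastrow_def replicate_map_pmf by simp
    \<comment> \<open>If the rows are related, only the trivial increase by one is used; the weight
      \<open>1 + m\<close> then offsets the subtracted count, which is at most \<open>m\<close>. As
      before, \<open>min\<close> only ensures boundedness.\<close>
    also have "\<dots> \<le> expt (replicate_pmf m ?R) (\<lambda>rs. nul n S - real (min m (length (filter ?NF rs)))
       + indicator {rs. \<forall>r\<in>set rs. ?NF r} rs + (1 + real m) * of_bool (?rel rs))"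
    proof (rule expt_mono)
      show "integrable (replicate_pmf m ?R) (\<lambda>rs. nul (Suc n) (S \<union> ?f ` set rs))"
        by (rule integrable_pmf_bounded) (rule nul_abs_le)
      show "integrable (replicate_pmf m ?R) (\<lambda>rs. nul n S - real (min m (length (filter ?NF rs)))
       + indicator {rs. \<forall>r\<in>set rs. ?NF r} rs + (1 + real m) * of_bool (?rel rs))"
        by (intro Bochner_Integration.integrable_add Bochner_Integration.integrable_diff integrable_mult_right)
           (auto intro: integrable_pmf_bounded[where B = m] integrable_pmf_bounded[where B = 1])
      fix rs assume "rs \<in> set_pmf (replicate_pmf m ?R)"
      then have rs: "set rs \<subseteq> set_pmf ?R" "length rs = m" by (auto simp: set_replicate_pmf)
      have le: "length (filter ?NF rs) \<le> m" using rs length_filter_le[of ?NF rs] by simp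
      have rs': "set \<alpha> \<subseteq> {..<n} \<and> length a = Suc (length \<alpha>) \<and> 0 \<notin> set a" if "(\<alpha>, a) \<in> set rs" for \<alpha> a
      proof -
        have "k - 1 \<le> n" "(\<alpha>, a) \<in> set_pmf ?R" using that rs n by auto
        from set_urow[OF this] show ?thesis using k_pos by (simp add: positions_def)
      qed
      show "nul (Suc n) (S \<union> ?f ` set rs) \<le> nul n S - real (min m (length (filter ?NF rs)))
       + indicator {rs. \<forall>r\<in>set rs. ?NF r} rs + (1 + real m) * of_bool (?rel rs)"
      proof (cases "?rel rs")
        case True
        have "nul (Suc n) (S \<union> ?f ` set rs) \<le> nul (Suc n) S" by (rule nul_mono) auto
        then show ?thesis using True nul_Suc[OF S] le by (auto simp: min_def indicator_def)
      next
        case False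
        define A where "A \<longleftrightarrow> (\<forall>r\<in>set rs. ?NF r)"
        have "indicator {rs. \<forall>r\<in>set rs. ?NF r} rs = (if A then 1 else 0 :: real)" by (simp add: A_def indicator_def)
        then show ?thesis using False le nul_cavity_le[OF S rs' False] unfolding A_def[symmetric]
          by (simp only: min_absorb2 split: if_splits) (simp_all only: of_bool_def if_False mult_zero_right, simp_all)
      qed
    qed
    also have "\<dots> = nul n S - expt (replicate_pmf m ?R) (\<lambda>rs. real (min m (length (filter ?NF rs))))
       + prob (replicate_pmf m ?R) {rs. \<forall>r\<in>set rs. ?NF r}
       + (1 + real m) * expt (replicate_pmf m ?R) (\<lambda>rs. of_bool (?rel rs))"
    proof -
      have i: "integrable (replicate_pmf m ?R) (\<lambda>rs. real (min m (length (filter ?NF rs))))"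
        "integrable (replicate_pmf m ?R) (indicator {rs. \<forall>r\<in>set rs. ?NF r} :: _ \<Rightarrow> real)"
        "integrable (replicate_pmf m ?R) (\<lambda>rs. of_bool (?rel rs) :: real)"
        by (auto intro: integrable_pmf_bounded[where B = m] integrable_pmf_bounded[where B = 1])
      have gen: "expt N (\<lambda>x. c - f x + g x + c' * h x) = c - expt N f + expt N g + c' * expt N h"
        if "integrable N f" "integrable N g" "integrable N h" for N :: "'a srow list pmf" and f g h c c'
        using that by simp
      show ?thesis unfolding gen[OF i] by simp
    qed
    also have "expt (replicate_pmf m ?R) (\<lambda>rs. real (min m (length (filter ?NF rs)))) = m * (1 - p)"
    proof -
      have "expt (replicate_pmf m ?R) (\<lambda>rs. real (min m (length (filter ?NF rs)))) = expt (replicate_pmf m ?R) (\<lambda>rs. real (length (filter ?NF rs)))"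
      proof (rule expt_cong)
        fix rs assume "rs \<in> set_pmf (replicate_pmf m ?R)"
        then have "length (filter ?NF rs) \<le> m" using length_filter_le[of ?NF rs] by (simp add: set_replicate_pmf)
        then show "real (min m (length (filter ?NF rs))) = real (length (filter ?NF rs))" by simp
      qed
      also have "\<dots> = m * (1 - p)" using expt_replicate_filter[of m ?R ?NF] unfolding pr .
      finally show ?thesis .
    qed
    also have "prob (replicate_pmf m ?R) {rs. \<forall>r\<in>set rs. ?NF r} = (1 - p) ^ m"
      using prob_replicate_all[of m ?R ?NF] unfolding pr .
    also have "expt (replicate_pmf m ?R) (\<lambda>rs. of_bool (?rel rs)) = rel_err n S m"
    proof -
      have "pmf_of_set (positions n (k - 1)) = map_pmf fst ?R" by (simp add: urow_def map_fst_pair_pmf)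
      then show ?thesis by (simp add: rel_err_def replicate_map_pmf)
    qed
    finally show ?thesis .
  qed
  have ip: "integrable (poisson_pmf d) (\<lambda>m. (1 - p) ^ m)" using expt_poisson_power(1)[OF d, of "1 - p"] p by simp
  have ir: "integrable (poisson_pmf d) (\<lambda>m. real m * (1 - p))" using integrable_poisson_real[OF d] by simp
  have "expt (poisson_set d (lastrow n (k - 1) P)) (\<lambda>V. nul (Suc n) (S \<union> V))
    = expt (poisson_pmf d) (\<lambda>m. expt (replicate_pmf m (lastrow n (k - 1) P)) (\<lambda>xs. nul (Suc n) (S \<union> set xs)))"
    by (rule expt_poisson_set) (rule nul_abs_le)
  also have "\<dots> \<le> expt (poisson_pmf d) (\<lambda>m. nul n S - m * (1 - p) + (1 - p) ^ m + (1 + real m) * rel_err n S m)"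
  proof (rule expt_mono)
    show "integrable (poisson_pmf d) (\<lambda>m. expt (replicate_pmf m (lastrow n (k - 1) P)) (\<lambda>xs. nul (Suc n) (S \<union> set xs)))"
      by (rule integrable_pmf_bounded, rule abs_expt_le, rule nul_abs_le)
  qed (use per ip ir integrable_rel_err[OF d, of n S] in auto)
  also have "\<dots> = nul n S - d * (1 - p) + exp (- (d * p)) + expt (poisson_pmf d) (\<lambda>m. (1 + real m) * rel_err n S m)"
    using ip ir integrable_rel_err[OF d, of n S] expt_poisson_real[OF d] expt_poisson_power(2)[OF d, of "1 - p"] p by simp
  finally show ?thesis by simp
qed

text \<open>Rows supported on frozen coordinates are redundant, and they alone already give a
  sufficient bound on the loss of nullity.\<close>

lemma expt_add_rows_ge:
  assumes n: "k \<le> n" and l: "0 < l"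
  shows "expt (poisson_set l (urow n k P)) (\<lambda>V. nul n (S \<union> V))
    \<ge> nul n S - l * (1 - (card (frozen_set n S) choose k) / (n choose k))"
proof -
  let ?R = "urow n k P" and ?NV = "\<lambda>r. \<not> vanish n S r"
  define p where "p = prob ?R {r. ?NV r}"
  have le: "p \<le> 1 - (card (frozen_set n S) choose k) / (n choose k)"
  proof -
    have "p \<le> prob ?R (space ?R - {r. \<forall>i\<in>set (fst r). frozen n S i})"
      unfolding p_def by (intro measure_pmf.finite_measure_mono) (auto intro: frozen_imp_vanish)
    then show ?thesis by (subst (asm) measure_pmf.prob_compl) (simp_all add: prob_frozen_row[OF n])
  qed
  have int: "integrable (replicate_pmf m ?R) (\<lambda>rs. real (length (filter ?NV rs)))" for m
    by (rule measure_pmf.integrable_const_bound[where B = m])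
       (auto simp: AE_measure_pmf_iff set_replicate_pmf intro: order_trans[OF length_filter_le])
  have per: "nul n S - m * p \<le> expt (replicate_pmf m ?R) (\<lambda>xs. nul n (S \<union> set xs))" for m
  proof -
    have "nul n S - m * p = expt (replicate_pmf m ?R) (\<lambda>rs. nul n S - length (filter ?NV rs))"
      using int[of m] expt_replicate_filter[of m ?R ?NV] by (simp add: p_def)
    also have "\<dots> \<le> expt (replicate_pmf m ?R) (\<lambda>xs. nul n (S \<union> set xs))"
      by (intro expt_mono Bochner_Integration.integrable_diff int nul_union_ge integrable_pmf_bounded[where B = n] nul_abs_le)
    finally show ?thesis .
  qed
  have "nul n S - l * (1 - (card (frozen_set n S) choose k) / (n choose k)) \<le> nul n S - l * p"
    using le l by (simp add: mult_left_mono)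
  also have "\<dots> = expt (poisson_pmf l) (\<lambda>m. nul n S - m * p)"
    using integrable_poisson_real[OF l] expt_poisson_real[OF l] by simp
  also have "\<dots> \<le> expt (poisson_pmf l) (\<lambda>m. expt (replicate_pmf m ?R) (\<lambda>xs. nul n (S \<union> set xs)))"
  proof (rule expt_mono)
    show "integrable (poisson_pmf l) (\<lambda>m. expt (replicate_pmf m ?R) (\<lambda>xs. nul n (S \<union> set xs)))"
      by (rule integrable_pmf_bounded, rule abs_expt_le, rule nul_abs_le)
  qed (use integrable_poisson_real[OF l] per in auto)
  also have "\<dots> = expt (poisson_set l (urow n k P)) (\<lambda>V. nul n (S \<union> V))"
    by (rule expt_poisson_set[symmetric]) (rule nul_abs_le)
  finally show ?thesis .
qed

text \<open>The change of the nullity caused by a new column and its \<open>Po(d)\<close> rows, minus the change caused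
  by the \<open>Po(d (k - 1) / k)\<close> extra rows that the smaller system receives in the comparison.\<close>

definition Phi :: "real \<Rightarrow> real \<Rightarrow> real" where
  "Phi d \<alpha> = exp (- (d * \<alpha> ^ (k - 1))) - d / k * (1 - real k * \<alpha> ^ (k - 1) + (real k - 1) * \<alpha> ^ k)"

text \<open>Both estimates concern the same \<open>S\<close>, so a single frozen fraction
  \<open>\<alpha>\<close> enters and their difference is at most \<open>Phi d \<alpha>\<close>.
  Drawing positions without replacement costs \<open>d * k ^ 2 / n\<close>.\<close>

lemma cavity_step:
  assumes n: "k \<le> n" and S: "S \<subseteq> rows_below n" and d: "0 < d"
    and M: "\<And>\<alpha>. 0 \<le> \<alpha> \<Longrightarrow> \<alpha> \<le> 1 \<Longrightarrow> Phi d \<alpha> \<le> M"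
  shows "expt (poisson_set d (lastrow n (k - 1) P)) (\<lambda>V. nul (Suc n) (S \<union> V))
    \<le> expt (poisson_set (d * (real k - 1) / k) (urow n k P)) (\<lambda>V. nul n (S \<union> V)) + M + d * k ^ 2 / n
      + expt (poisson_pmf d) (\<lambda>m. (1 + real m) * rel_err n S m)"
proof -
  let ?f = "card (frozen_set n S)"
  define \<alpha> where "\<alpha> = ?f / n"
  define p p' where "p = real (?f choose (k - 1)) / (n choose (k - 1))" and "p' = real (?f choose k) / (n choose k)"
  define l where "l = d * (real k - 1) / k"
  have n0: "n > 0" using n k_pos by simp
  have f: "?f \<le> n" using card_mono[of "{..<n}" "frozen_set n S"] by auto
  have \<alpha>: "0 \<le> \<alpha>" "\<alpha> \<le> 1" using f n0 by (auto simp: \<alpha>_def)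
  have l: "0 < l" "l \<le> d" using d k_ge_3 by (auto simp: l_def field_simps)
  have p: "0 \<le> p" "p \<le> \<alpha> ^ (k - 1)"
    using binomial_ratio_le[OF f, of "k - 1"] n by (auto simp: p_def \<alpha>_def)
  have p': "\<alpha> ^ k - k ^ 2 / n \<le> p'" using binomial_ratio_ge[OF f n] by (simp add: \<alpha>_def p'_def)
  have "exp (- (d * p)) - d * (1 - p) + l * (1 - p') \<le> exp (- (d * \<alpha> ^ (k - 1))) - d * (1 - \<alpha> ^ (k - 1)) + l * (1 - \<alpha> ^ k + k ^ 2 / n)"
    using cavity_mono[OF d p] p' l mult_left_mono[of "1 - p'" "1 - \<alpha> ^ k + k ^ 2 / n" l] by linarith
  also have "\<dots> \<le> exp (- (d * \<alpha> ^ (k - 1))) - d * (1 - \<alpha> ^ (k - 1)) + l * (1 - \<alpha> ^ k) + d * k ^ 2 / n"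
  proof -
    have "l * (real (k ^ 2) / n) \<le> d * (real (k ^ 2) / n)" using l by (intro mult_right_mono) auto
    then show ?thesis by (simp add: algebra_simps)
  qed
  also have "exp (- (d * \<alpha> ^ (k - 1))) - d * (1 - \<alpha> ^ (k - 1)) + l * (1 - \<alpha> ^ k) = Phi d \<alpha>"
    using k_pos by (simp add: Phi_def l_def field_simps of_nat_diff)
  also have "\<dots> \<le> M" using M \<alpha> by simp
  finally show ?thesis
    using expt_cavity_le[OF n S d] expt_add_rows_ge[OF n l(1), of S]
    unfolding p_def[symmetric] p'_def[symmetric] l_def[symmetric] by simp
qed

section \<open>Growth of the mean nullity with the number of columns\<close>

definition pinned_nul :: "nat \<Rightarrow> real \<Rightarrow> nat \<Rightarrow> real" where
  "pinned_nul T d n = expt (poisson_set (d * n / k) (urow n k P)) (\<lambda>S. expt (pins T n) (\<lambda>Q. nul n (S \<union> Q)))"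

text \<open>An average over the number \<open>m\<close> of new rows: \<open>1 + m\<close> is the
  cost of a relation, the power of \<open>k - 1\<close> passes from positions to independent
  coordinates, and the square is the pinning bound for \<open>m * (k - 1)\<close> coordinates, up to
  the factor 1 / T.\<close>

definition err_const :: "real \<Rightarrow> real" where
  "err_const d = expt (poisson_pmf d) (\<lambda>m. (1 + real m) * ((real (k - 1) ^ (k - 1)) ^ m * (real (m * (k - 1)) ^ 2)))"

lemma integrable_err_const:
  assumes "0 < d"
  shows "integrable (poisson_pmf d) (\<lambda>m. (1 + real m) * ((real (k - 1) ^ (k - 1)) ^ m * (real (m * (k - 1)) ^ 2)))"
proof (rule integrable_poisson[OF assms])
  fix m
  let ?c = "real (k - 1) ^ (k - 1)"
  have m2: "real m ^ 2 \<le> (2 ^ m) ^ 2" using of_nat_le_two_power[of m] by (intro power_mono) auto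
  have "(1 + real m) * (?c ^ m * (real (m * (k - 1)) ^ 2)) = real (k - 1) ^ 2 * ((1 + real m) * (?c ^ m * real m ^ 2))"
    by (simp add: power_mult_distrib)
  also have "\<dots> \<le> real (k - 1) ^ 2 * (2 ^ m * (?c ^ m * (2 ^ m) ^ 2))"
    using of_nat_Suc_le_two_power[of m] m2 by (intro mult_left_mono mult_mono) auto
  also have "(2 :: real) ^ m * (?c ^ m * (2 ^ m) ^ 2) = (8 * ?c) ^ m"
    by (simp add: power_mult_distrib[symmetric] power_mult[symmetric] mult.commute[of m])
       (simp add: power_mult power_mult_distrib[symmetric])
  finally show "\<bar>(1 + real m) * (?c ^ m * (real (m * (k - 1)) ^ 2))\<bar> \<le> real (k - 1) ^ 2 * (8 * ?c) ^ m" by simp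
qed simp

lemma expt_pins_rel_err_le:
  assumes "k \<le> n" "0 < T"
  shows "expt (pins T n) (\<lambda>Q. rel_err n (S \<union> Q) m) \<le> (real (k - 1) ^ (k - 1)) ^ m * (real (m * (k - 1)) ^ 2 / T)"
proof -
  have n: "n > 0" "0 < k - 1" "k - 1 \<le> n" using assms k_ge_3 by auto
  have "expt (pins T n) (\<lambda>Q. rel_err n (S \<union> Q) m)
    \<le> expt (pins T n) (\<lambda>Q. (real (k - 1) ^ (k - 1)) ^ m * expt (replicate_pmf (m * (k - 1)) (ucoord n)) (\<lambda>js. of_bool (related n (S \<union> Q) js)))"
  proof (rule expt_mono)
    show "integrable (pins T n) (\<lambda>Q. rel_err n (S \<union> Q) m)"
      by (rule integrable_pmf_bounded[where B = 1]) (use rel_err_bounds in \<open>auto simp: abs_le_iff intro: order_trans[of _ 0]\<close>)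
    show "integrable (pins T n) (\<lambda>Q. (real (k - 1) ^ (k - 1)) ^ m * expt (replicate_pmf (m * (k - 1)) (ucoord n)) (\<lambda>js. of_bool (related n (S \<union> Q) js)))"
      by (intro integrable_mult_right integrable_pmf_bounded[where B = 1] abs_expt_le) auto
    show "rel_err n (S \<union> Q) m \<le> (real (k - 1) ^ (k - 1)) ^ m * expt (replicate_pmf (m * (k - 1)) (ucoord n)) (\<lambda>js. of_bool (related n (S \<union> Q) js))" for Q
      unfolding rel_err_def by (rule expt_blocks_le[where B = 1]) (use n in auto)
  qed
  also have "\<dots> = (real (k - 1) ^ (k - 1)) ^ m * expt (pins T n) (\<lambda>Q. expt (replicate_pmf (m * (k - 1)) (ucoord n)) (\<lambda>js. of_bool (related n (S \<union> Q) js)))"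
    by simp
  also have "\<dots> \<le> (real (k - 1) ^ (k - 1)) ^ m * (real (m * (k - 1)) ^ 2 / T)"
    by (intro mult_left_mono expt_related_le) (use n assms in auto)
  finally show ?thesis .
qed

lemma expt_pins_err_le:
  assumes "k \<le> n" "0 < T" "0 < d"
  shows "expt (pins T n) (\<lambda>Q. expt (poisson_pmf d) (\<lambda>m. (1 + real m) * rel_err n (S \<union> Q) m)) \<le> err_const d / T"
proof -
  have n: "n > 0" using assms k_pos by simp
  have "expt (pins T n) (\<lambda>Q. expt (poisson_pmf d) (\<lambda>m. (1 + real m) * rel_err n (S \<union> Q) m))
    = expt (poisson_pmf d) (\<lambda>m. expt (pins T n) (\<lambda>Q. (1 + real m) * rel_err n (S \<union> Q) m))"
    by (rule expt_swap_finite) (use finite_set_pins[OF n assms(2)] integrable_rel_err[OF assms(3)] in auto)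
  also have "\<dots> \<le> expt (poisson_pmf d) (\<lambda>m. ((1 + real m) * ((real (k - 1) ^ (k - 1)) ^ m * (real (m * (k - 1)) ^ 2))) / T)"
  proof (rule expt_mono)
    have b: "\<bar>expt (pins T n) (\<lambda>Q. rel_err n (S \<union> Q) m)\<bar> \<le> 1" for m
      by (rule abs_expt_le) (use rel_err_bounds in \<open>auto simp: abs_le_iff intro: order_trans[of _ 0]\<close>)
    show "integrable (poisson_pmf d) (\<lambda>m. expt (pins T n) (\<lambda>Q. (1 + real m) * rel_err n (S \<union> Q) m))"
      by (rule integrable_poisson[where B = 2 and C = 1, OF assms(3)])
         (use mult_mono[OF of_nat_Suc_le_two_power b] in \<open>auto simp: abs_mult\<close>)
    show "integrable (poisson_pmf d) (\<lambda>m. ((1 + real m) * ((real (k - 1) ^ (k - 1)) ^ m * (real (m * (k - 1)) ^ 2))) / T)"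
      using integrable_err_const[OF assms(3)] by simp
    fix m
    show "expt (pins T n) (\<lambda>Q. (1 + real m) * rel_err n (S \<union> Q) m) \<le> ((1 + real m) * ((real (k - 1) ^ (k - 1)) ^ m * (real (m * (k - 1)) ^ 2))) / T"
      using mult_left_mono[OF expt_pins_rel_err_le[OF assms(1,2), of S m], of "1 + real m"] by simp
  qed
  also have "\<dots> = err_const d / T" by (simp add: err_const_def)
  finally show ?thesis .
qed

lemma set_pins_below:
  assumes "0 < n" "0 < T" "Q \<in> set_pmf (pins T n)" shows "Q \<subseteq> rows_below n"
  using assms by (auto simp: pins_def set_replicate_pmf pin_in_rows_below lessThan_empty_iff)

lemma set_poisson_set_below:
  assumes "k \<le> n" "0 < l" "S \<in> set_pmf (poisson_set l (urow n k P))" shows "S \<subseteq> rows_below n"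
  using assms set_urow_below by (auto simp: poisson_set_def set_replicate_pmf)

text \<open>The two systems share their first rows. The larger one is completed by rows through the
  new column, the smaller one by ordinary rows, and \<open>cavity_step\<close> compares the
  completions. Restricting the pins to the old columns costs at most \<open>T / n\<close>.\<close>

lemma pinned_nul_Suc:
  assumes n: "k \<le> n" and T: "0 < T" and d: "0 < d"
    and M: "\<And>\<alpha>. 0 \<le> \<alpha> \<Longrightarrow> \<alpha> \<le> 1 \<Longrightarrow> Phi d \<alpha> \<le> M"
  shows "pinned_nul T d (Suc n) \<le> pinned_nul T d n + M + err_const d / T + (d * k ^ 2 + T) / n"
proof -
  have n0: "n > 0" using n k_pos by simp
  \<comment> \<open>The intensity of the rows avoiding the new column. Adding \<open>d\<close> gives
    the intensity for \<open>n + 1\<close> columns, adding \<open>d * (k - 1) / k\<close> the one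
    for \<open>n\<close>.\<close>
  define l0 where "l0 = d * real (Suc n - k) / k"
  have l0: "0 < l0" using n d k_pos by (simp add: l0_def)
  let ?l = "d * (real k - 1) / k"
  have l: "0 < ?l" using d k_ge_3 by simp
  have e1: "d * real (Suc n) / k = l0 + d" "d * real n / k = l0 + ?l"
    using n k_pos by (auto simp: l0_def field_simps of_nat_diff)
  have e2: "l0 / (l0 + d) = real (n - (k - 1)) / real (Suc n)"
  proof -
    have "n - (k - 1) = Suc n - k" using n k_pos by simp
    moreover have "l0 / (l0 + d) = (d * real (Suc n - k) / k) / (d * real (Suc n) / k)" unfolding e1 by (simp add: l0_def)
    ultimately show ?thesis using d k_pos by simp
  qed
  let ?R = "urow n k P" and ?L = "lastrow n (k - 1) P"
  have mix: "urow (Suc n) k P = bind_pmf (bernoulli_pmf (l0 / (l0 + d))) (\<lambda>b. if b then ?R else ?L)"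
    using urow_Suc[of "k - 1" n P] n k_pos unfolding e2 by (simp only: Suc_diff_1)
  let ?E = "\<lambda>Q. expt (poisson_set d ?L) (\<lambda>V. nul (Suc n) (Q \<union> V))"
  let ?E' = "\<lambda>Q. expt (poisson_set ?l ?R) (\<lambda>V. nul n (Q \<union> V))"
  have bE: "\<bar>?E Q\<bar> \<le> Suc n" for Q by (rule abs_expt_le) (rule nul_abs_le)
  have bE': "\<bar>?E' Q\<bar> \<le> n" for Q by (rule abs_expt_le) (rule nul_abs_le)
  have iE: "integrable (measure_pmf M) (\<lambda>Q. ?E (S \<union> Q))" for M S by (rule integrable_pmf_bounded) (rule bE)
  have iE': "integrable (measure_pmf M) (\<lambda>Q. ?E' (S \<union> Q))" for M S by (rule integrable_pmf_bounded) (rule bE')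
  have iEE: "integrable (measure_pmf M) (\<lambda>S. expt (pins T n) (\<lambda>Q. ?E (S \<union> Q)))" for M
    by (rule integrable_pmf_bounded, rule abs_expt_le) (rule bE)
  have iEE': "integrable (measure_pmf M) (\<lambda>S. expt (pins T n) (\<lambda>Q. ?E' (S \<union> Q)))" for M
    by (rule integrable_pmf_bounded, rule abs_expt_le) (rule bE')
  have bp: "\<bar>expt (pins T m) (\<lambda>Q. nul n' (S \<union> Q))\<bar> \<le> n'" for m n' S by (rule abs_expt_le) (rule nul_abs_le)
  have sw: "expt N (\<lambda>V. expt (pins T n) (\<lambda>Q. nul n' ((S \<union> V) \<union> Q))) = expt (pins T n) (\<lambda>Q. expt N (\<lambda>V. nul n' ((S \<union> Q) \<union> V)))" for N S n'
    by (subst expt_swap[where B = n']) (auto simp: nul_abs_le Un_ac)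
  have "pinned_nul T d (Suc n) \<le> expt (poisson_set (d * Suc n / k) (urow (Suc n) k P)) (\<lambda>S. expt (pins T n) (\<lambda>Q. nul (Suc n) (S \<union> Q)) + T / Suc n)"
    unfolding pinned_nul_def
    by (intro expt_mono expt_pins_Suc_le n0 T Bochner_Integration.integrable_add) (auto intro!: integrable_pmf_bounded bp)
  also have "\<dots> = expt (poisson_set (l0 + d) (urow (Suc n) k P)) (\<lambda>S. expt (pins T n) (\<lambda>Q. nul (Suc n) (S \<union> Q))) + T / Suc n"
    unfolding e1 by (subst Bochner_Integration.integral_add) (auto intro!: integrable_pmf_bounded bp)
  also have "expt (poisson_set (l0 + d) (urow (Suc n) k P)) (\<lambda>S. expt (pins T n) (\<lambda>Q. nul (Suc n) (S \<union> Q)))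
    = expt (poisson_set l0 ?R) (\<lambda>S. expt (poisson_set d ?L) (\<lambda>V. expt (pins T n) (\<lambda>Q. nul (Suc n) (S \<union> V \<union> Q))))"
    unfolding mix poisson_set_mixture[OF l0 d] by (simp add: expt_pair[where B = "Suc n"] bp del: of_nat_Suc)
  also have "\<dots> = expt (poisson_set l0 ?R) (\<lambda>S. expt (pins T n) (\<lambda>Q. ?E (S \<union> Q)))"
    unfolding sw ..
  also have "\<dots> \<le> expt (poisson_set l0 ?R) (\<lambda>S. expt (pins T n) (\<lambda>Q. ?E' (S \<union> Q)) + (M + d * k ^ 2 / n + err_const d / T))"
  proof (rule expt_mono)
    fix S assume S: "S \<in> set_pmf (poisson_set l0 ?R)"
    have ib: "integrable (pins T n) f" for f :: "_ \<Rightarrow> real"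
      by (rule integrable_measure_pmf_finite) (rule finite_set_pins[OF n0 T])
    have "expt (pins T n) (\<lambda>Q. ?E (S \<union> Q)) \<le> expt (pins T n) (\<lambda>Q. ?E' (S \<union> Q) + M + d * k ^ 2 / n
      + expt (poisson_pmf d) (\<lambda>m. (1 + real m) * rel_err n (S \<union> Q) m))"
      using set_pins_below[OF n0 T] set_poisson_set_below[OF n l0 S]
      by (intro expt_mono ib cavity_step[OF n _ d M]) auto
    also have "\<dots> = expt (pins T n) (\<lambda>Q. ?E' (S \<union> Q)) + M + d * k ^ 2 / n
      + expt (pins T n) (\<lambda>Q. expt (poisson_pmf d) (\<lambda>m. (1 + real m) * rel_err n (S \<union> Q) m))"
      by (simp add: ib)
    finally show "expt (pins T n) (\<lambda>Q. ?E (S \<union> Q)) \<le> expt (pins T n) (\<lambda>Q. ?E' (S \<union> Q)) + (M + d * k ^ 2 / n + err_const d / T)"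
      using expt_pins_err_le[OF n T d, of S] by simp
  qed (intro Bochner_Integration.integrable_add iEE iEE' measure_pmf.integrable_const)+
  also have "\<dots> = expt (poisson_set l0 ?R) (\<lambda>S. expt (pins T n) (\<lambda>Q. ?E' (S \<union> Q))) + (M + d * k ^ 2 / n + err_const d / T)"
    using iEE' by simp
  also have "expt (poisson_set l0 ?R) (\<lambda>S. expt (pins T n) (\<lambda>Q. ?E' (S \<union> Q))) = pinned_nul T d n"
  proof -
    have "pinned_nul T d n = expt (poisson_set l0 ?R) (\<lambda>S. expt (poisson_set ?l ?R) (\<lambda>V. expt (pins T n) (\<lambda>Q. nul n (S \<union> V \<union> Q))))"
      unfolding pinned_nul_def e1 poisson_set_add[OF l0 l] by (simp add: expt_pair[where B = n] bp)
    then show ?thesis unfolding sw by simp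
  qed
  finally have "pinned_nul T d (Suc n) \<le> pinned_nul T d n + (M + d * k ^ 2 / n + err_const d / T) + T / Suc n" by simp
  moreover have "real T / Suc n \<le> T / n" using n0 by (intro divide_left_mono) auto
  ultimately show ?thesis by (simp add: add_divide_distrib)
qed

definition mean_nul :: "real \<Rightarrow> nat \<Rightarrow> real" where
  "mean_nul d n = expt (poisson_set (d * n / k) (urow n k P)) (nul n)"

text \<open>There are fewer than \<open>T\<close> pins, and each lowers the nullity by at most
  one.\<close>

lemma mean_nul_le_pinned:
  assumes "0 < T"
  shows "mean_nul d n \<le> pinned_nul T d n + T"
proof -
  have 1: "nul n (S :: 'a srow set) - length ps \<le> nul n (S \<union> pin ` set ps)" for S ps
  proof -
    have "nul n (S \<union> set (map pin ps)) \<ge> nul n S - length (filter (\<lambda>r. \<not> vanish n S r) (map pin ps))"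
      by (rule nul_union_ge)
    moreover have "real (length (filter (\<lambda>r. \<not> vanish n S r) (map pin ps))) \<le> length ps"
      by (metis length_filter_le length_map of_nat_le_iff)
    ultimately show ?thesis by (simp only: set_map)
  qed
  have 2: "nul n (S :: 'a srow set) - T \<le> expt (pins T n) (\<lambda>Q. nul n (S \<union> Q))" for S
  proof -
    have "nul n S - T \<le> nul n (S \<union> Q)" if Q: "Q \<in> set_pmf (pins T n)" for Q
    proof -
      obtain ps where "Q = pin ` set ps" "length ps < T" using Q assms
        by (auto simp: pins_def set_replicate_pmf lessThan_empty_iff)
      then show ?thesis using 1[of S ps] by simp
    qed
    then show ?thesis by (intro expt_ge_const) (auto intro!: integrable_pmf_bounded nul_abs_le)
  qed
  have i: "integrable (measure_pmf M) (nul n :: 'a srow set \<Rightarrow> real)" for M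
    by (rule integrable_pmf_bounded) (rule nul_abs_le)
  have "mean_nul d n - T = expt (poisson_set (d * n / k) (urow n k P)) (\<lambda>S. nul n S - T)"
    using i by (simp add: mean_nul_def)
  also have "\<dots> \<le> pinned_nul T d n"
    unfolding pinned_nul_def
  proof (intro expt_mono 2)
    show "integrable (poisson_set (d * n / k) (urow n k P)) (\<lambda>S. expt (pins T n) (\<lambda>Q. nul n (S \<union> Q)))"
      by (rule integrable_pmf_bounded, rule abs_expt_le, rule nul_abs_le)
  qed (use i in simp)
  finally show ?thesis by simp
qed

lemma mean_nul_le:
  assumes d: "0 < d" and M: "\<And>\<alpha>. 0 \<le> \<alpha> \<Longrightarrow> \<alpha> \<le> 1 \<Longrightarrow> Phi d \<alpha> \<le> M" and e: "0 < e"
  shows "\<forall>\<^sub>F n in sequentially. mean_nul d n \<le> (M + e) * n"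
proof -
  \<comment> \<open>The error \<open>err_const d / T\<close> is incurred at every step and does not
    decay in \<open>n\<close>, so \<open>T\<close> is fixed first; the remaining error per step then
    vanishes as \<open>n\<close> grows.\<close>
  obtain T :: nat where T: "T > 0" "err_const d / T < e / 3"
  proof -
    have "(\<lambda>T. err_const d / real T) \<longlonglongrightarrow> 0" by (rule lim_const_over_n)
    then have "\<forall>\<^sub>F T in sequentially. err_const d / real T < e / 3"
      by (rule order_tendstoD) (use e in simp)
    then have "\<forall>\<^sub>F T in sequentially. T > 0 \<and> err_const d / real T < e / 3"
      using eventually_gt_at_top[of 0] by eventually_elim simp
    then show ?thesis using that by (auto simp: eventually_sequentially)
  qed
  obtain n0 where n0: "n0 \<ge> k" "\<And>n. n \<ge> n0 \<Longrightarrow> (d * k ^ 2 + T) / real n < e / 3"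
  proof -
    have "(\<lambda>n. (d * k ^ 2 + T) / real n) \<longlonglongrightarrow> 0" by (rule lim_const_over_n)
    then have "\<forall>\<^sub>F n in sequentially. (d * k ^ 2 + T) / real n < e / 3"
      by (rule order_tendstoD) (use e in simp)
    then obtain n1 where "\<And>n. n \<ge> n1 \<Longrightarrow> (d * k ^ 2 + T) / real n < e / 3" by (auto simp: eventually_sequentially)
    then show ?thesis using that[of "max n1 k"] by simp
  qed
  have ind: "pinned_nul T d (n0 + j) \<le> pinned_nul T d n0 + j * (M + 2 * (e / 3))" for j
  proof (induction j)
    case (Suc j)
    have "pinned_nul T d (Suc (n0 + j)) \<le> pinned_nul T d (n0 + j) + M + err_const d / T + (d * k ^ 2 + T) / real (n0 + j)"
      using n0(1) by (intro pinned_nul_Suc T d M) auto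
    then have "pinned_nul T d (n0 + Suc j) \<le> pinned_nul T d (n0 + j) + (M + 2 * (e / 3))"
      unfolding add_Suc_right using T(2) n0(2)[of "n0 + j", OF le_add1] by linarith
    also have "\<dots> \<le> pinned_nul T d n0 + Suc j * (M + 2 * (e / 3))"
      using Suc by (simp add: distrib_right)
    finally show ?case .
  qed simp
  define C where "C = pinned_nul T d n0 + T - n0 * (M + 2 * (e / 3))"
  have "(\<lambda>n. C / real n) \<longlonglongrightarrow> 0" by (rule lim_const_over_n)
  then have "\<forall>\<^sub>F n in sequentially. C / real n < e / 3"
    by (rule order_tendstoD) (use e in simp)
  then show ?thesis using eventually_ge_at_top[of n0] eventually_gt_at_top[of 0]
  proof eventually_elim
    case (elim n)
    obtain j where j: "n = n0 + j" using elim by (metis le_add_diff_inverse)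
    define c where "c = M + 2 * (e / 3)"
    have "mean_nul d n \<le> pinned_nul T d n + T" by (rule mean_nul_le_pinned[OF T(1)])
    also have "\<dots> \<le> C + n * (M + 2 * (e / 3))"
      using ind[of j] unfolding j C_def c_def[symmetric] by (simp add: algebra_simps)
    also have "\<dots> \<le> e / 3 * n + n * (M + 2 * (e / 3))" using elim by (simp add: field_simps)
    also have "\<dots> = (M + e) * n" by (simp add: field_simps)
    finally show ?case .
  qed
qed

end

section \<open>The threshold\<close>

text \<open>The derivative is a positive factor times a decreasing linear one, so it cannot be
  negative first and positive later, as an interior value below both ends would require.\<close>

lemma power_times_one_minus_quasiconcave:
  fixes x y z :: real
  assumes "0 < x" "x < y" "y < z" "z < 1" "0 < m"
  shows "y ^ m * (1 - y) \<ge> min (x ^ m * (1 - x)) (z ^ m * (1 - z))"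
proof (rule ccontr)
  let ?u = "\<lambda>x :: real. x ^ m * (1 - x)" and ?u' = "\<lambda>x :: real. x ^ (m - 1) * (m - (m + 1) * x)"
  assume "\<not> ?thesis"
  then have lt: "?u y < ?u x" "?u y < ?u z" by auto
  have der: "DERIV ?u t :> ?u' t" for t
  proof -
    have "t ^ m = t * t ^ (m - 1)" using assms(5) by (simp add: power_eq_if)
    then show ?thesis by (auto intro!: derivative_eq_intros simp: algebra_simps)
  qed
  obtain t1 where t1: "x < t1" "t1 < y" "?u y - ?u x = (y - x) * ?u' t1"
    using MVT2[OF assms(2), of ?u ?u'] der by blast
  obtain t2 where t2: "y < t2" "t2 < z" "?u z - ?u y = (z - y) * ?u' t2"
    using MVT2[OF assms(3), of ?u ?u'] der by blast
  have "(y - x) * ?u' t1 < 0" using lt t1 by linarith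
  then have "?u' t1 < 0" using assms mult_nonneg_nonneg[of "y - x" "?u' t1"] by linarith
  moreover have p1: "0 < t1 ^ (m - 1)" using t1 assms by simp
  ultimately have "m - (m + 1) * t1 < 0" using mult_nonneg_nonneg[of "t1 ^ (m - 1)" "m - (m + 1) * t1"] by linarith
  have "(z - y) * ?u' t2 > 0" using lt t2 by linarith
  then have "?u' t2 > 0" using assms zero_less_mult_pos[of "z - y" "?u' t2"] by linarith
  moreover have p2: "0 < t2 ^ (m - 1)" using t2 assms by simp
  ultimately have "m - (m + 1) * t2 > 0" by (rule zero_less_mult_pos)
  then have "(m + 1) * t2 < (m + 1) * t1" using \<open>m - (m + 1) * t1 < 0\<close> by linarith
  then show False using t1 t2 by simp
qed

context sparse_system begin

lemma Phi_0: "Phi d 0 = 1 - d / k"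
  using k_ge_3 by (simp add: Phi_def zero_power)

text \<open>The last factor shows that the positive critical points of \<open>Phi d\<close> are the
  fixed points among which \<open>rho\<close> selects the largest.\<close>

lemma DERIV_Phi:
  "DERIV (Phi d) x :> d * (real k - 1) * x ^ (k - 2) * (1 - exp (- (d * x ^ (k - 1))) - x)"
proof -
  define j where "j = k - Suc (Suc 0)"
  have j: "k = Suc (Suc j)" using k_ge_3 by (simp add: j_def)
  have pow: "DERIV (\<lambda>x. x ^ Suc m) x :> real (Suc m) * x ^ m" for m
    using DERIV_pow[of "Suc m" x] by simp
  have gen: "DERIV (\<lambda>x. exp (- (d * f x)) - c * (1 - c1 * f x + c2 * g x)) x
      :> - (d * f') * exp (- (d * f x)) - c * (c2 * g' - c1 * f')"
    if "DERIV f x :> f'" "DERIV g x :> g'" for f g f' g' c c1 c2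
    using that by (auto intro!: derivative_eq_intros)
  have "Phi d = (\<lambda>\<alpha>. exp (- (d * \<alpha> ^ Suc j)) - d / k * (1 - real k * \<alpha> ^ Suc j + (real k - 1) * \<alpha> ^ Suc (Suc j)))"
    by (rule ext, subst Phi_def, simp only: j diff_Suc_1)
  moreover have "- (d * (real (Suc j) * x ^ j)) * exp (- (d * x ^ Suc j))
      - d / k * ((real k - 1) * (real (Suc (Suc j)) * x ^ Suc j) - real k * (real (Suc j) * x ^ j))
    = d * (real k - 1) * x ^ (k - 2) * (1 - exp (- (d * x ^ (k - 1))) - x)"
    unfolding j by (simp add: field_simps)
  ultimately show ?thesis using gen[OF pow[of j] pow[of "Suc j"], where c = "d / k" and ?c1.0 = "real k" and ?c2.0 = "real k - 1"] by (simp only:)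
qed

text \<open>Both ends are zeros of \<open>d x^(k - 1) + ln (1 - x)\<close>. A negative value in between would force
  derivatives of sign 0, -, + in this order, against the quasiconcavity of \<open>x^(k - 2) (1 - x)\<close>.\<close>

lemma fixed_point_between:
  fixes a b d x :: real
  assumes d: "0 < d" and a: "0 < a" "a = 1 - exp (- d * a ^ (k - 1))"
    and b: "b = 1 - exp (- d * b ^ (k - 1))" and x: "a \<le> x" "x \<le> b"
  shows "x \<le> 1 - exp (- (d * x ^ (k - 1)))"
proof (rule ccontr)
  assume "\<not> ?thesis"
  then have neg: "1 - x < exp (- (d * x ^ (k - 1)))" by linarith
  have b1: "b < 1" using b by (smt (verit) exp_gt_zero)
  have xa: "a < x" "x < b" using x a b neg by (auto simp: less_le)
  define g where "g y = d * y ^ (k - 1) + ln (1 - y)" for y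
  define g' where "g' y = d * (real k - 1) * y ^ (k - 2) - 1 / (1 - y)" for y
  have der: "DERIV g y :> g' y" if "y < 1" for y
  proof -
    define j where "j = k - Suc (Suc (Suc 0))"
    have j: "k = Suc (Suc (Suc j))" using k_ge_3 by (simp add: j_def)
    have "DERIV (\<lambda>x. x ^ Suc m) y :> real (Suc m) * y ^ m" for m
      using DERIV_pow[of "Suc m" y] by simp
    moreover have "DERIV (\<lambda>y. d * f y + ln (1 - y)) y :> d * f' - 1 / (1 - y)" if "DERIV f y :> f'" for f f'
      using that \<open>y < 1\<close> by (auto intro!: derivative_eq_intros)
    ultimately have "DERIV (\<lambda>y. d * y ^ Suc (Suc j) + ln (1 - y)) y :> d * (real (Suc (Suc j)) * y ^ Suc j) - 1 / (1 - y)"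
      by blast
    moreover have "g = (\<lambda>y. d * y ^ Suc (Suc j) + ln (1 - y))" by (rule ext) (simp add: g_def j)
    moreover have "g' y = d * (real (Suc (Suc j)) * y ^ Suc j) - 1 / (1 - y)" by (simp add: g'_def j)
    ultimately show ?thesis by simp
  qed
  have g0: "g y = 0" if "y = 1 - exp (- d * y ^ (k - 1))" for y
  proof -
    have "1 - y = exp (- d * y ^ (k - 1))" using that by simp
    then have "ln (1 - y) = - d * y ^ (k - 1)" by (simp only: ln_exp)
    then show ?thesis by (simp add: g_def)
  qed
  have gx: "g x < 0"
  proof -
    have "ln (1 - x) < - (d * x ^ (k - 1))" using neg x b1 by (simp add: ln_less_cancel_iff[symmetric, of "1 - x"])
    then show ?thesis by (simp add: g_def)
  qed
  obtain y0 where y0: "0 < y0" "y0 < a" "g a - g 0 = (a - 0) * g' y0"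
    using MVT2[of 0 a g g'] der a xa b1 by force
  obtain y1 where y1: "a < y1" "y1 < x" "g x - g a = (x - a) * g' y1"
    using MVT2[of a x g g'] der xa b1 by force
  obtain y2 where y2: "x < y2" "y2 < b" "g b - g x = (b - x) * g' y2"
    using MVT2[of x b g g'] der xa b1 by force
  have "g 0 = 0" using k_ge_3 by (simp add: g_def)
  then have "g' y0 = 0" using y0 g0[OF a(2)] a by simp
  moreover have "(x - a) * g' y1 < 0" using y1 gx g0[OF a(2)] by simp
  then have "g' y1 < 0" using xa by (simp add: mult_less_0_iff)
  moreover have "(b - x) * g' y2 > 0" using y2 gx g0[OF b] by simp
  then have "g' y2 > 0" using xa by (simp add: zero_less_mult_iff)
  ultimately have g'v: "g' y0 = 0" "g' y1 < 0" "g' y2 > 0" by auto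
  \<comment> \<open>Multiplied by \<open>1 - y\<close>, the derivative \<open>g' y\<close> becomes
    \<open>c * (y ^ (k - 2) * (1 - y)) - 1\<close>, so its three signs compare values of a
    quasiconcave function with one level.\<close>
  define c where "c = d * (real k - 1)"
  have c: "c > 0" using d k_ge_3 by (simp add: c_def)
  have "c * (y0 ^ (k - 2) * (1 - y0)) = 1" using g'v(1) y0 y1 y2 b1 by (simp add: g'_def c_def[symmetric] field_simps)
  moreover have "c * (y1 ^ (k - 2) * (1 - y1)) < 1" using g'v(2) y0 y1 y2 b1 by (simp add: g'_def c_def[symmetric] field_simps)
  moreover have "c * (y2 ^ (k - 2) * (1 - y2)) > 1" using g'v(3) y0 y1 y2 b1 by (simp add: g'_def c_def[symmetric] field_simps)
  moreover have "y1 ^ (k - 2) * (1 - y1) \<ge> min (y0 ^ (k - 2) * (1 - y0)) (y2 ^ (k - 2) * (1 - y2))"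
    by (rule power_times_one_minus_quasiconcave) (use y0 y1 y2 b1 k_ge_3 in auto)
  ultimately show False using c
    by (smt (verit) mult_le_cancel_left_pos)
qed

text \<open>A maximiser with a value above that at 0 is a positive fixed point. From there up to
  \<open>rho k d\<close> the derivative is nonnegative, so \<open>rho k d\<close> does at least as
  well. But the value at \<open>rho k d\<close> is \<open>1 - d / k\<close> minus exactly the
  expression whose sign defines \<open>d_crit\<close>.\<close>

lemma Phi_le:
  assumes d: "0 < d" and nc: "\<not> rho k d - d * rho k d ^ (k - 1) + (1 - 1 / real k) * d * rho k d ^ k < 0"
    and \<alpha>: "0 \<le> \<alpha>" "\<alpha> \<le> 1"
  shows "Phi d \<alpha> \<le> 1 - d / k"
proof (rule ccontr)
  assume gt0: "\<not> ?thesis"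
  have cont: "continuous_on S (Phi d)" for S
    by (rule DERIV_continuous_on) (use DERIV_Phi in \<open>blast intro: has_field_derivative_at_within\<close>)
  obtain a where a: "0 \<le> a" "a \<le> 1" and max: "\<And>x. 0 \<le> x \<Longrightarrow> x \<le> 1 \<Longrightarrow> Phi d x \<le> Phi d a"
    using continuous_attains_sup[of "{0..1 :: real}" "Phi d"] cont by auto
  have gt: "Phi d a > 1 - d / k" using gt0 max[OF \<alpha>] by simp
  then have a0: "0 < a" using a Phi_0[of d] by (cases "a = 0") auto
  let ?h = "\<lambda>x. 1 - exp (- (d * x ^ (k - 1))) - x"
  have dk: "d * (real k - 1) > 0" using d k_ge_3 by simp
  have ha: "?h a = 0"
  proof (cases "a = 1")
    case True
    \<comment> \<open>At the right end the derivative is negative, so slightly smaller arguments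
      give larger values and 1 is no maximiser.\<close>
    have "d * (real k - 1) * a ^ (k - 2) * ?h a < 0" using dk True by (simp add: mult_less_0_iff)
    then obtain e where e: "0 < e" "\<And>h. 0 < h \<Longrightarrow> h < e \<Longrightarrow> Phi d a < Phi d (a - h)"
      using DERIV_neg_dec_left[OF DERIV_Phi[of d a]] by auto
    have "Phi d a < Phi d (a - min (e / 2) 1)" using e by (intro e(2)) auto
    moreover have "Phi d (a - min (e / 2) 1) \<le> Phi d a" using True e by (intro max) auto
    ultimately show ?thesis by simp
  next
    case False
    have "d * (real k - 1) * a ^ (k - 2) * ?h a = 0"
    proof (rule DERIV_local_max[OF DERIV_Phi])
      show "0 < min a (1 - a)" using a a0 False by simp
      show "\<forall>y. \<bar>a - y\<bar> < min a (1 - a) \<longrightarrow> Phi d y \<le> Phi d a" by (auto intro!: max)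
    qed
    then show ?thesis using d k_ge_3 a0 by simp
  qed
  define F where "F = {x \<in> {0..1}. x = 1 - exp (- d * x ^ (k - 1))}"
  have aF: "a \<in> F" using ha a by (simp add: F_def)
  have "closed F"
  proof -
    have "F = {0..1} \<inter> {x. x = 1 - exp (- d * x ^ (k - 1))}" by (auto simp: F_def)
    then show ?thesis by (simp add: closed_Int closed_Collect_eq continuous_intros)
  qed
  then have rF: "rho k d \<in> F"
    unfolding rho_def F_def[symmetric] using aF by (intro closed_contains_Sup) (auto simp: F_def intro: bdd_aboveI[of _ 1])
  have ar: "a \<le> rho k d"
    unfolding rho_def F_def[symmetric] using aF by (intro cSup_upper) (auto simp: F_def intro: bdd_aboveI[of _ 1])
  have "Phi d a \<le> Phi d (rho k d)"
  proof (rule DERIV_nonneg_imp_nondecreasing[OF ar])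
    fix x assume x: "a \<le> x" "x \<le> rho k d"
    have "?h x \<ge> 0" using fixed_point_between[OF d a0 _ _ x] aF rF by (simp add: F_def)
    then have "d * (real k - 1) * x ^ (k - 2) * ?h x \<ge> 0" using d k_ge_3 a0 x by (intro mult_nonneg_nonneg) auto
    then show "\<exists>y. DERIV (Phi d) x :> y \<and> 0 \<le> y" using DERIV_Phi by blast
  qed
  moreover have "Phi d (rho k d) \<le> 1 - d / k"
  proof -
    have "exp (- (d * rho k d ^ (k - 1))) = 1 - rho k d" using rF by (simp add: F_def)
    then have "Phi d (rho k d) = 1 - d / k - (rho k d - d * rho k d ^ (k - 1) + (1 - 1 / real k) * d * rho k d ^ k)"
      unfolding Phi_def \<open>exp _ = _\<close> using k_pos by (simp add: field_simps)
    then show ?thesis using nc by simp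
  qed
  ultimately show False using gt by simp
qed

text \<open>The set whose infimum is the threshold need not be known to be nonempty: if it is empty, every
  \<open>d\<close> is subcritical and the unspecified value of the infimum is irrelevant.\<close>

lemma ex_subcritical:
  assumes "0 < d" "d < d_crit k"
  obtains d' where "d < d'" "\<And>\<alpha>. 0 \<le> \<alpha> \<Longrightarrow> \<alpha> \<le> 1 \<Longrightarrow> Phi d' \<alpha> \<le> 1 - d' / k"
proof -
  define X where "X = {d. d > 0 \<and> rho k d - d * rho k d ^ (k - 1) + (1 - 1 / real k) * d * rho k d ^ k < 0}"
  have "\<exists>d'>d. d' \<notin> X"
  proof (cases "X = {}")
    case True
    then show ?thesis by (auto intro: exI[of _ "d + 1"])
  next
    case False
    have "Inf X \<le> y" if "y \<in> X" for y using that by (intro cInf_lower) (auto simp: X_def intro: bdd_belowI[of _ 0])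
    moreover have "d < Inf X" using assms by (simp add: d_crit_def X_def)
    ultimately have "(d + Inf X) / 2 > d" "(d + Inf X) / 2 \<notin> X" by fastforce+
    then show ?thesis by blast
  qed
  then obtain d' where d': "d < d'" "d' \<notin> X" by blast
  then show ?thesis using that[of d'] Phi_le[of d'] assms by (auto simp: X_def)
qed

section \<open>New rows are linearly independent of the old ones\<close>

definition vprob :: "nat \<Rightarrow> nat \<Rightarrow> real" where
  "vprob n m = expt (urows n m) (\<lambda>rs. prob (urow n k P) {r. vanish n (set rs) r})"

lemma vprob_bounds: "0 \<le> vprob n m" "vprob n m \<le> 1"
  unfolding vprob_def by (auto intro!: expt_ge_const expt_le_const integrable_pmf_bounded[where B = 1])

lemma vprob_Suc:
  "vprob n (Suc m) = expt (urows n m) (\<lambda>rs. expt (urow n k P) (\<lambda>r1.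
     prob (urow n k P) {r. vanish n (insert r1 (set rs)) r}))"
  unfolding vprob_def by (subst expt_replicate_snoc[where B = 1]) auto

text \<open>The row span can only grow when a further independent row is inserted.\<close>

lemma vprob_mono: "vprob n m \<le> vprob n (Suc m)"
proof -
  let ?R = "urow n k P"
  have "prob ?R {r. vanish n (set rs) r} \<le> expt ?R (\<lambda>r1. prob ?R {r. vanish n (insert r1 (set rs)) r})" for rs
    by (intro expt_ge_const integrable_pmf_bounded[where B = 1] measure_pmf.finite_measure_mono)
       (auto intro: vanish_mono)
  then show ?thesis unfolding vprob_Suc unfolding vprob_def
    by (intro expt_mono integrable_pmf_bounded[where B = 1] abs_expt_le) auto
qed

text \<open>Each row lowers the nullity by one unless it is redundant, so the redundancy
  probabilities add up to the excess over \<open>n - m\<close>.\<close>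

lemma expt_nul_rows:
  "expt (urows n m) (\<lambda>rs. nul n (set rs)) = real n - m + (\<Sum>j<m. vprob n j)"
proof (induction m)
  case (Suc m)
  let ?R = "urow n k P"
  have i: "integrable (measure_pmf M) (\<lambda>rs. nul n (set rs))" for M :: "'a srow list pmf"
    by (rule integrable_pmf_bounded) (rule nul_abs_le)
  have "expt (replicate_pmf (Suc m) ?R) (\<lambda>rs. nul n (set rs)) = expt (replicate_pmf m ?R) (\<lambda>rs. expt ?R (\<lambda>r. nul n (insert r (set rs))))"
    by (subst expt_replicate_snoc[where B = n]) (auto simp: nul_abs_le)
  also have "\<dots> = expt (replicate_pmf m ?R) (\<lambda>rs. nul n (set rs) - 1 + prob ?R {r. vanish n (set rs) r})"
  proof (rule expt_cong)
    fix rs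
    have "expt ?R (\<lambda>r. nul n (insert r (set rs))) = expt ?R (\<lambda>r. nul n (set rs) - 1 + indicator {r. vanish n (set rs) r} r)"
      by (intro expt_cong) (auto simp: nul_insert indicator_def)
    also have "\<dots> = nul n (set rs) - 1 + prob ?R {r. vanish n (set rs) r}"
      by (subst Bochner_Integration.integral_add) (auto intro: integrable_pmf_bounded[where B = 1])
    finally show "expt ?R (\<lambda>r. nul n (insert r (set rs))) = nul n (set rs) - 1 + prob ?R {r. vanish n (set rs) r}" .
  qed
  also have "\<dots> = expt (replicate_pmf m ?R) (\<lambda>rs. nul n (set rs)) - 1 + vprob n m"
    unfolding vprob_def using i
    by (subst Bochner_Integration.integral_add) (auto intro: integrable_pmf_bounded[where B = 1])
  finally show ?case using Suc by simp
qed simp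

text \<open>The supporting line at \<open>m0\<close> of a convex function of the number of rows.\<close>

lemma sum_vprob_ge: "vprob n m0 * (real m - real m0) \<le> (\<Sum>j<m. vprob n j)"
proof (cases "m0 \<le> m")
  case True
  have mono: "vprob n m0 \<le> vprob n j" if "m0 \<le> j" for j
    using lift_Suc_mono_le[of "vprob n", OF vprob_mono that] .
  have "vprob n m0 * (real m - real m0) = (\<Sum>j=m0..<m. vprob n m0)" using True by (simp add: of_nat_diff)
  also have "\<dots> \<le> (\<Sum>j=m0..<m. vprob n j)" by (intro sum_mono mono) auto
  also have "\<dots> \<le> (\<Sum>j<m. vprob n j)" by (intro sum_mono2) (auto simp: vprob_bounds)
  finally show ?thesis .
next
  case False
  then have "vprob n m0 * (real m - real m0) \<le> 0" using vprob_bounds[of n m0] by (intro mult_nonneg_nonpos) auto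
  also have "0 \<le> (\<Sum>j<m. vprob n j)" by (intro sum_nonneg) (auto simp: vprob_bounds)
  finally show ?thesis .
qed

text \<open>The supporting line is affine in the number of rows, so its Poisson average involves
  only the mean \<open>d * n / k\<close>.\<close>

lemma vprob_le_mean_nul:
  assumes "0 < d" "0 < n"
  shows "vprob n m0 * (d * n / k - m0) \<le> mean_nul d n - n + d * n / k"
proof -
  let ?l = "d * n / k"
  have l: "0 < ?l" using assms k_pos by simp
  note ii = integrable_poisson_real[OF l]
  have "real n - ?l + vprob n m0 * (?l - m0) = expt (poisson_pmf ?l) (\<lambda>m. real n - real m + vprob n m0 * (real m - real m0))"
    using ii expt_poisson_real[OF l] by simp
  also have "\<dots> \<le> expt (poisson_pmf ?l) (\<lambda>m. expt (urows n m) (\<lambda>rs. nul n (set rs)))"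
  proof (rule expt_mono)
    show "integrable (poisson_pmf ?l) (\<lambda>m. expt (urows n m) (\<lambda>rs. nul n (set rs)))"
      by (rule integrable_pmf_bounded, rule abs_expt_le, rule nul_abs_le)
  qed (use ii expt_nul_rows sum_vprob_ge in auto)
  also have "\<dots> = mean_nul d n" unfolding mean_nul_def
    by (rule expt_poisson_set[symmetric]) (rule nul_abs_le)
  finally show ?thesis by simp
qed

text \<open>At density \<open>d'\<close> about \<open>(d' - d) * n / k\<close> further rows follow.
  If row \<open>m\<close> were redundant with probability above \<open>e\<close>, so would be all of
  these, and the mean nullity would exceed \<open>n - d' * n / k\<close> by a linear amount.\<close>

lemma vprob_small:
  fixes d d' e :: real
  assumes d: "0 < d" "d < d'" and M: "\<And>\<alpha>. 0 \<le> \<alpha> \<Longrightarrow> \<alpha> \<le> 1 \<Longrightarrow> Phi d' \<alpha> \<le> 1 - d' / k" and e: "0 < e"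
  shows "\<forall>\<^sub>F n in sequentially. \<forall>m. real m \<le> d * n / k \<longrightarrow> vprob n m \<le> e"
proof -
  let ?e = "e * (d' - d) / k"
  have e': "0 < ?e" using d e k_pos by simp
  have "\<forall>\<^sub>F n in sequentially. mean_nul d' n \<le> (1 - d' / k + ?e) * n"
    using d by (intro mean_nul_le M e') auto
  then show ?thesis using eventually_gt_at_top[of 0]
  proof eventually_elim
    case (elim n)
    show ?case
    proof (intro allI impI)
      fix m assume m: "real m \<le> d * n / k"
      have "vprob n m * ((d' - d) * n / k) \<le> vprob n m * (d' * n / k - m)"
        using m vprob_bounds by (intro mult_left_mono) (auto simp: algebra_simps diff_divide_distrib)
      also have "\<dots> \<le> mean_nul d' n - n + d' * n / k"
        using d elim by (intro vprob_le_mean_nul) auto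
      also have "\<dots> \<le> e * ((d' - d) * n / k)" using elim by (simp add: algebra_simps)
      finally show "vprob n m \<le> e" using d elim k_pos by (subst (asm) mult_le_cancel_right) auto
    qed
  qed
qed

end

section \<open>Asymptotic pairwise independence\<close>

text \<open>Linear independence of the coordinates \<open>i\<close> and \<open>j\<close> as
  functionals on the kernel, in the form in which \<open>card_ker_insert\<close> applies
  twice.\<close>

definition indep :: "nat \<Rightarrow> 'a :: {finite, field} srow set \<Rightarrow> nat \<Rightarrow> nat \<Rightarrow> bool" where
  "indep n S i j \<longleftrightarrow> \<not> frozen n S i \<and> \<not> frozen n (insert (pin i) S) j"

text \<open>Diagonal pairs count as dependent; hence the second moment bounds below have no separate
  variance term.\<close>

definition dep :: "nat \<Rightarrow> 'a :: {finite, field} srow set \<Rightarrow> real" where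
  "dep n S = card {(i, j). i < n \<and> j < n \<and> \<not> indep n S i j} / n ^ 2"

lemma card_dep_le:
  "{(i, j). i < n \<and> j < n \<and> \<not> indep n S i j} \<subseteq> {..<n} \<times> {..<n}" by auto

lemma finite_dep [simp]: "finite {(i, j). i < n \<and> j < n \<and> \<not> indep n S i j}"
  by (rule finite_subset[OF card_dep_le]) simp

lemma dep_bounds: "0 \<le> dep n S" "dep n S \<le> 1"
proof -
  have "card {(i, j). i < n \<and> j < n \<and> \<not> indep n S i j} \<le> card ({..<n} \<times> {..<n})"
    by (intro card_mono card_dep_le) auto
  then have "real (card {(i, j). i < n \<and> j < n \<and> \<not> indep n S i j}) \<le> real n ^ 2"
    by (simp add: card_cartesian_product power2_eq_square flip: of_nat_mult)
  then show "dep n S \<le> 1" by (auto simp: dep_def divide_le_eq_1)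
qed (simp add: dep_def)

text \<open>Dependent pairs have a frozen first coordinate or a second one frozen by pinning the
  first. If all classes were small, so would be the set of frozen coordinates, which lies in each of
  them; each source then contributes less than half.\<close>

lemma dep_imp_large_class:
  assumes "n > 0" "dep n S \<ge> e" "e > 0"
  obtains i where "i < n" "card (frozen_set n (insert (pin i) S)) \<ge> e / 2 * n"
proof (rule ccontr)
  note ex = that
  assume "\<not> thesis"
  then have less: "card (frozen_set n (insert (pin i) S)) < e / 2 * n" if "i < n" for i
    using \<open>\<not> thesis\<close> ex[OF that] by linarith
  have sub: "{(i, j). i < n \<and> j < n \<and> \<not> indep n S i j}
    \<subseteq> (frozen_set n S \<times> {..<n}) \<union> (SIGMA i:{..<n}. frozen_set n (insert (pin i) S))"
    by (auto simp: indep_def)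
  have f0: "frozen_set n S \<subseteq> frozen_set n (insert (pin 0) S)"
    by (auto intro: vanish_mono)
  have fin: "finite (frozen_set n S')" for S' by simp
  have "real (card (frozen_set n S)) < e / 2 * n" using card_mono[OF fin f0] less[of 0] assms by simp
  then have 1: "real (card (frozen_set n S \<times> {..<n})) < e / 2 * n * n"
    using assms by (simp add: card_cartesian_product)
  have 2: "real (card (SIGMA i:{..<n}. frozen_set n (insert (pin i) S))) \<le> e / 2 * n * n"
  proof -
    have "real (card (SIGMA i:{..<n}. frozen_set n (insert (pin i) S))) = (\<Sum>i<n. real (card (frozen_set n (insert (pin i) S))))"
      by (subst card_SigmaI) auto
    also have "\<dots> \<le> (\<Sum>i<n. e / 2 * n)" using less by (intro sum_mono) (auto simp: less_imp_le)
    finally show ?thesis by (simp add: algebra_simps)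
  qed
  have "card {(i, j). i < n \<and> j < n \<and> \<not> indep n S i j}
    \<le> card ((frozen_set n S \<times> {..<n}) \<union> (SIGMA i:{..<n}. frozen_set n (insert (pin i) S)))"
    by (intro card_mono sub) auto
  also have "\<dots> \<le> card (frozen_set n S \<times> {..<n}) + card (SIGMA i:{..<n}. frozen_set n (insert (pin i) S))"
    by (rule card_Un_le)
  finally have "real (card {(i, j). i < n \<and> j < n \<and> \<not> indep n S i j})
    \<le> real (card (frozen_set n S \<times> {..<n})) + real (card (SIGMA i:{..<n}. frozen_set n (insert (pin i) S)))"
    by (simp only: of_nat_add[symmetric] of_nat_le_iff)
  also have "\<dots> < e / 2 * n * n + e / 2 * n * n" using 1 2 by linarith
  also have "\<dots> = e * n ^ 2" by (simp add: power2_eq_square)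
  finally have "real (card {(i, j). i < n \<and> j < n \<and> \<not> indep n S i j}) < e * n ^ 2" .
  then show False using assms by (simp add: dep_def field_simps)
qed

text \<open>On the kernel, all coordinates frozen by pinning \<open>i\<close> are multiples of the \<open>i\<close>-th one, so two
  rows supported there are proportional.\<close>

lemma two_rows_in_class:
  assumes "\<And>j. j \<in> set (fst r1) \<union> set (fst r2) \<Longrightarrow> frozen n (insert (pin i) S) j"
  shows "vanish n S r1 \<or> vanish n (insert r1 S) r2"
proof (cases "vanish n S r1")
  case nv: False
  have v: "vanish n (insert (pin i) S) r1" "vanish n (insert (pin i) S) r2"
    using assms by (auto intro: frozen_imp_vanish)
  have "\<not> frozen n S i"
    using nv v(1) ker_insert_vanish[of n S "pin i"] by (auto simp: vanish_def)
  then have "card (ker n (insert (pin i) S)) = card (ker n (insert r1 S))"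
    using card_ker_insert[OF nv] card_ker_insert[of n S "pin i"] by simp
  moreover have "ker n (insert (pin i) S) \<subseteq> ker n (insert r1 S)"
    using v(1) by (auto simp: vanish_def ker_insert)
  ultimately have "ker n (insert (pin i) S) = ker n (insert r1 S)" by (intro card_subset_eq) auto
  then show ?thesis using v(2) by (simp add: vanish_def)
qed simp

lemma dep_abs: "\<bar>dep n S\<bar> \<le> 1"
  using dep_bounds[of n S] by simp

context sparse_system begin

text \<open>Two independent rows both fall into the large class with at least the squared
  probability, and then one of them is redundant. The class contributes \<open>(e / 2) ^ k\<close>
  per row; the further factor 1/2 absorbs the error of drawing without replacement.\<close>

lemma dep_imp_vanish:
  assumes n: "k \<le> n" and dep: "dep n S \<ge> e" and e: "e > 0" and large: "real (k ^ 2) / n \<le> (e / 2) ^ k / 2"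
  shows "((e / 2) ^ k / 2) ^ 2 \<le> prob (urow n k P) {r. vanish n S r}
    + expt (urow n k P) (\<lambda>r1. prob (urow n k P) {r. vanish n (insert r1 S) r})"
proof -
  let ?R = "urow n k P"
  let ?t = "(e / 2) ^ k / 2"
  have n0: "n > 0" using n k_pos by simp
  obtain i where i: "i < n" "card (frozen_set n (insert (pin i) S)) \<ge> e / 2 * n"
    using dep_imp_large_class[OF n0 dep e] .
  define C where "C = frozen_set n (insert (pin i) S)"
  define p where "p = prob ?R {r. set (fst r) \<subseteq> C}"
  have "(card C / n) ^ k - real (k ^ 2) / n \<le> p"
  proof -
    have "card C \<le> n" using card_mono[of "{..<n}" C] by (auto simp: C_def)
    moreover have "C \<subseteq> {..<n}" by (auto simp: C_def)
    ultimately show ?thesis unfolding p_def using binomial_ratio_ge[OF _ n] by (simp only: prob_urow_subset n)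
  qed
  moreover have "(e / 2) ^ k \<le> (card C / n) ^ k"
    using i(2) n0 e by (intro power_mono) (auto simp: C_def field_simps)
  ultimately have p: "?t \<le> p" using large by simp
  have p1: "p \<le> 1" by (simp add: p_def)
  have t0: "0 \<le> ?t" using e by simp
  have "?t ^ 2 \<le> ?t * p" using mult_left_mono[OF p t0] by (simp only: power2_eq_square)
  also have "\<dots> = expt ?R (\<lambda>r1. ?t * indicator {r. set (fst r) \<subseteq> C} r1)" by (simp add: p_def)
  also have "\<dots> \<le> expt ?R (\<lambda>r1. indicator {r. vanish n S r} r1 + prob ?R {r. vanish n (insert r1 S) r})"
  proof (rule expt_mono)
    fix r1
    show "?t * indicator {r. set (fst r) \<subseteq> C} r1 \<le> indicator {r. vanish n S r} r1 + prob ?R {r. vanish n (insert r1 S) r}"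
    proof (cases "set (fst r1) \<subseteq> C \<and> \<not> vanish n S r1")
      case True
      have "{r. set (fst r) \<subseteq> C} \<subseteq> {r. vanish n (insert r1 S) r}"
        using True two_rows_in_class[of r1 _ n i S] by (auto simp: C_def) 
      then have "p \<le> prob ?R {r. vanish n (insert r1 S) r}"
        unfolding p_def by (intro measure_pmf.finite_measure_mono) auto
      then show ?thesis using True p by (simp add: indicator_def)
    next
      case False
      then show ?thesis using p p1 by (auto simp: indicator_def add_increasing2)
    qed
  next
    show "integrable ?R (\<lambda>r1. ?t * indicator {r. set (fst r) \<subseteq> C} r1)"
      by (intro integrable_mult_right integrable_pmf_bounded[where B = 1]) (auto simp: indicator_def)
    show "integrable ?R (\<lambda>r1. indicator {r. vanish n S r} r1 + prob ?R {r. vanish n (insert r1 S) r})"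
      by (intro Bochner_Integration.integrable_add integrable_pmf_bounded[where B = 1]) (auto simp: indicator_def)
  qed
  also have "\<dots> = prob ?R {r. vanish n S r} + expt ?R (\<lambda>r1. prob ?R {r. vanish n (insert r1 S) r})"
    by (subst Bochner_Integration.integral_add) (auto intro: integrable_pmf_bounded[where B = 1])
  finally show ?thesis .
qed

text \<open>Where \<open>dep\<close> exceeds e / 2, the redundancy probabilities after
  \<open>m\<close> and \<open>m + 1\<close> rows have a sum bounded below, while their means are
  small; elsewhere \<open>dep\<close> contributes at most e / 2.\<close>

lemma expt_dep_small:
  fixes d d' e :: real
  assumes d: "0 < d" "d < d'" and M: "\<And>\<alpha>. 0 \<le> \<alpha> \<Longrightarrow> \<alpha> \<le> 1 \<Longrightarrow> Phi d' \<alpha> \<le> 1 - d' / k" and e: "0 < e"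
  shows "\<forall>\<^sub>F n in sequentially. \<forall>m. real m \<le> d * n / k \<longrightarrow> expt (urows n m) (\<lambda>rs. dep n (set rs)) \<le> e"
proof -
  \<comment> \<open>An intermediate density leaves room for the additional row: \<open>m + 1\<close>
    rows are still within \<open>d1 * n / k\<close> for large \<open>n\<close>.\<close>
  define d1 where "d1 = (d + d') / 2"
  have d1: "d < d1" "d1 < d'" using d by (auto simp: d1_def)
  define t where "t = (e / 2 / 2) ^ k / 2"
  have t: "0 < t" using e by (simp add: t_def)
  have "(\<lambda>n. real (k ^ 2) / real n) \<longlonglongrightarrow> 0" by (rule lim_const_over_n)
  then have A1: "\<forall>\<^sub>F n in sequentially. real (k ^ 2) / real n < t"
    by (rule order_tendstoD) (use t in simp)
  have A2: "\<forall>\<^sub>F n in sequentially. \<forall>m. real m \<le> d1 * n / k \<longrightarrow> vprob n m \<le> e * t ^ 2 / 4"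
    using d d1 t e by (intro vprob_small[OF _ d1(2) M]) auto
  have "(\<lambda>n. k / (d1 - d) / real n) \<longlonglongrightarrow> 0" by (rule lim_const_over_n)
  then have A3: "\<forall>\<^sub>F n in sequentially. k / (d1 - d) / real n < 1"
    by (rule order_tendstoD) simp
  show ?thesis using A1 A2 A3 eventually_ge_at_top[of k]
  proof eventually_elim
    case (elim n)
    have n0: "0 < n" using elim k_pos by simp
    show ?case
    proof (intro allI impI)
      fix m assume m: "real m \<le> d * n / k"
      let ?R = "urow n k P"
      have "1 \<le> (d1 - d) * n / k" using elim(3) n0 d1 k_pos by (simp add: field_simps)
      then have m1: "real m \<le> d1 * n / k" "real (Suc m) \<le> d1 * n / k"
        using m by (simp_all add: algebra_simps diff_divide_distrib)
      let ?v = "\<lambda>rs. prob ?R {r. vanish n (set rs) r} + expt ?R (\<lambda>r1. prob ?R {r. vanish n (insert r1 (set rs)) r})"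
      have bv: "\<bar>expt ?R (\<lambda>r1. prob ?R {r. vanish n (insert r1 S) r})\<bar> \<le> 1" for S
        by (rule abs_expt_le) auto
      have iv: "integrable (replicate_pmf m ?R) (\<lambda>rs. expt ?R (\<lambda>r1. prob ?R {r. vanish n (insert r1 (set rs)) r}))"
        "integrable (replicate_pmf m ?R) (\<lambda>rs. prob ?R {r. vanish n (set rs) r})"
        by (rule integrable_pmf_bounded, rule bv) (auto intro: integrable_pmf_bounded[where B = 1])
      have "expt (replicate_pmf m ?R) (\<lambda>rs. dep n (set rs)) \<le> expt (replicate_pmf m ?R) (\<lambda>rs. e / 2 + ?v rs / t ^ 2)"
      proof (rule expt_mono)
        show "integrable (replicate_pmf m ?R) (\<lambda>rs. dep n (set rs))"
          by (rule integrable_pmf_bounded) (rule dep_abs)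
        show "integrable (replicate_pmf m ?R) (\<lambda>rs. e / 2 + ?v rs / t ^ 2)" using iv by simp
        fix rs
        have v0: "0 \<le> ?v rs" by (intro add_nonneg_nonneg expt_ge_const integrable_pmf_bounded[where B = 1]) auto
        show "dep n (set rs) \<le> e / 2 + ?v rs / t ^ 2"
        proof (cases "dep n (set rs) \<ge> e / 2")
          case True
          have "t ^ 2 \<le> ?v rs" unfolding t_def
            using elim e by (intro dep_imp_vanish True) (auto simp: t_def less_imp_le)
          then have "1 \<le> ?v rs / t ^ 2" using t by simp
          then show ?thesis using dep_bounds(2)[of n "set rs"] e by linarith
        next
          case False
          moreover have "0 \<le> ?v rs / t ^ 2" using v0 t by simp
          ultimately show ?thesis by linarith
        qed
      qed
      also have "\<dots> = e / 2 + (vprob n m + vprob n (Suc m)) / t ^ 2"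
        unfolding vprob_Suc unfolding vprob_def using iv by simp
      also have "\<dots> \<le> e / 2 + (e * t ^ 2 / 4 + e * t ^ 2 / 4) / t ^ 2"
        using elim(2) m1 by (intro add_left_mono divide_right_mono add_mono) auto
      also have "\<dots> = e" using t by (simp add: field_simps)
      finally show "expt (replicate_pmf m ?R) (\<lambda>rs. dep n (set rs)) \<le> e" .
    qed
  qed
qed

end

section \<open>Variance bounds\<close>

text \<open>After expanding the square only correlated pairs survive. The index set \<open>W\<close>
  will be a kernel, or all pairs of a vector and a kernel vector.\<close>

lemma sum_square_le_bad_pairs:
  fixes X :: "nat \<Rightarrow> 'b \<Rightarrow> real"
  assumes fin: "finite W" and bd: "\<And>i w. \<bar>X i w\<bar> \<le> 1"
    and good: "\<And>i j. i < n \<Longrightarrow> j < n \<Longrightarrow> (i, j) \<notin> Bad \<Longrightarrow> (\<Sum>w\<in>W. X i w * X j w) = 0"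
    and Bad: "Bad \<subseteq> {..<n} \<times> {..<n}"
  shows "(\<Sum>w\<in>W. (\<Sum>i<n. X i w) ^ 2) \<le> real (card Bad) * real (card W)"
proof -
  have fB: "finite Bad" using Bad finite_subset by blast
  have "(\<Sum>w\<in>W. (\<Sum>i<n. X i w) ^ 2) = (\<Sum>w\<in>W. \<Sum>i<n. \<Sum>j<n. X i w * X j w)"
    by (simp add: power2_eq_square sum_product)
  also have "\<dots> = (\<Sum>i<n. \<Sum>j<n. \<Sum>w\<in>W. X i w * X j w)"
    by (subst sum.swap, rule sum.cong[OF refl], rule sum.swap)
  also have "\<dots> = (\<Sum>(i, j)\<in>{..<n} \<times> {..<n}. \<Sum>w\<in>W. X i w * X j w)"
    by (rule sum.cartesian_product)
  also have "\<dots> = (\<Sum>(i, j)\<in>Bad. \<Sum>w\<in>W. X i w * X j w)"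
    using good Bad by (intro sum.mono_neutral_right) auto
  also have "\<dots> \<le> (\<Sum>(i, j)\<in>Bad. real (card W))"
  proof (intro sum_mono, clarify)
    fix i j
    have "X i w * X j w \<le> 1" for w
      using mult_mono[OF bd[of i w] bd[of j w]] by (simp add: abs_mult[symmetric])
    then have "(\<Sum>w\<in>W. X i w * X j w) \<le> (\<Sum>w\<in>W. 1)" by (intro sum_mono)
    then show "(\<Sum>w\<in>W. X i w * X j w) \<le> card W" by simp
  qed
  finally show ?thesis by (simp add: case_prod_unfold)
qed

lemma sum_fibre_pair:
  fixes S :: "'a :: {finite, field} srow set" and g :: "'a \<Rightarrow> 'a \<Rightarrow> real"
  assumes "\<not> frozen n S i" "\<not> frozen n (insert (pin i) S) j"
  shows "(\<Sum>z\<in>ker n S. g (z i) (z j)) = card (ker n S) / CARD('a) ^ 2 * (\<Sum>a\<in>UNIV. \<Sum>b\<in>UNIV. g a b)"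
proof -
  have q: "real CARD('a) > 0" using card_field_gt_1[where 'a = 'a] by simp
  have "(\<Sum>z\<in>ker n S. g (z i) (z j)) = (\<Sum>y\<in>UNIV. \<Sum>z\<in>{z \<in> ker n S. (z i, z j) = y}. g (z i) (z j))"
    by (rule sum.group[symmetric]) auto
  also have "\<dots> = (\<Sum>y\<in>UNIV. card (ker n S) / CARD('a) ^ 2 * g (fst y) (snd y))"
  proof (rule sum.cong[OF refl])
    fix y :: "'a \<times> 'a"
    obtain a b where y: "y = (a, b)" by (cases y)
    have "(\<Sum>z\<in>{z \<in> ker n S. (z i, z j) = y}. g (z i) (z j)) = card {z \<in> ker n S. z i = a \<and> z j = b} * g a b"
      by (simp add: y)
    moreover have "real (card {z \<in> ker n S. z i = a \<and> z j = b}) = card (ker n S) / CARD('a) ^ 2"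
      using card_fibre_pair[OF assms, of a b] q by (simp add: field_simps flip: of_nat_mult of_nat_power)
    ultimately show "(\<Sum>z\<in>{z \<in> ker n S. (z i, z j) = y}. g (z i) (z j)) = card (ker n S) / CARD('a) ^ 2 * g (fst y) (snd y)"
      by (simp add: y)
  qed
  also have "\<dots> = card (ker n S) / CARD('a) ^ 2 * (\<Sum>y\<in>UNIV \<times> UNIV. g (fst y) (snd y))"
    by (simp add: sum_distrib_left)
  also have "(\<Sum>y\<in>UNIV \<times> UNIV. g (fst y) (snd y)) = (\<Sum>a\<in>UNIV. \<Sum>b\<in>UNIV. g a b)"
    by (simp add: sum.cartesian_product case_prod_unfold)
  finally show ?thesis .
qed

definition cnt :: "nat \<Rightarrow> (nat \<Rightarrow> 'a) \<Rightarrow> 'a \<Rightarrow> nat" where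
  "cnt n z c = card {i \<in> {..<n}. z i = c}"

text \<open>Twice the total variation distance of the composition of \<open>z\<close> from uniform.
  It is this sum norm that is multiplicative under convolution.\<close>

definition dev :: "nat \<Rightarrow> (nat \<Rightarrow> 'a :: {finite, field}) \<Rightarrow> real" where
  "dev n z = (\<Sum>c\<in>UNIV. \<bar>cnt n z c / n - 1 / CARD('a)\<bar>)"

lemma cnt_eq_sum: "real (cnt n z c) = (\<Sum>i<n. of_bool (z i = c))"
proof -
  have "{i \<in> {..<n}. z i = c} = {..<n} \<inter> {i. z i = c}" by auto
  then show ?thesis by (simp add: cnt_def sum_of_bool_eq)
qed

lemma dev_nonneg: "0 \<le> dev n z"
  unfolding dev_def by (intro sum_nonneg) auto

lemma sum_of_bool_minus: "(\<Sum>a\<in>(UNIV :: 'a :: {finite, field} set). of_bool (a = c) - 1 / real CARD('a)) = 0"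
  using card_field_gt_1[where 'a = 'a] by (simp add: sum_subtractf)

lemma sum_cnt_dev_le:
  fixes S :: "'a :: {finite, field} srow set"
  assumes "0 < n"
  shows "(\<Sum>z\<in>ker n S. (cnt n z c / n - 1 / CARD('a)) ^ 2) \<le> dep n S * card (ker n S)"
proof -
  let ?q = "1 / real CARD('a)"
  let ?X = "\<lambda>i z. of_bool (z i = c) - ?q"
  let ?Bad = "{(i, j). i < n \<and> j < n \<and> \<not> indep n S i j}"
  have "(\<Sum>z\<in>ker n S. (\<Sum>i<n. ?X i z) ^ 2) \<le> real (card ?Bad) * real (card (ker n S))"
  proof (rule sum_square_le_bad_pairs)
    show "\<bar>?X i z\<bar> \<le> 1" for i z using card_field_gt_1[where 'a = 'a] by (auto simp: of_bool_def)
    fix i j assume "i < n" "j < n" "(i, j) \<notin> ?Bad"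
    then have "\<not> frozen n S i" "\<not> frozen n (insert (pin i) S) j" by (auto simp: indep_def)
    from sum_fibre_pair[OF this, of "\<lambda>a b. (of_bool (a = c) - ?q) * (of_bool (b = c) - ?q)"]
    show "(\<Sum>z\<in>ker n S. ?X i z * ?X j z) = 0"
      by (simp only: sum_distrib_left[symmetric] sum_of_bool_minus mult_zero_right sum.neutral_const)
  qed auto
  moreover have "(cnt n z c / n - ?q) ^ 2 = (\<Sum>i<n. ?X i z) ^ 2 / n ^ 2" for z
    using assms by (simp add: cnt_eq_sum sum_subtractf power_divide[symmetric] diff_divide_distrib)
  ultimately have "(\<Sum>z\<in>ker n S. (cnt n z c / n - ?q) ^ 2) \<le> real (card ?Bad) * real (card (ker n S)) / n ^ 2"
    by (simp add: sum_divide_distrib[symmetric] divide_right_mono)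
  then show ?thesis by (simp add: dep_def)
qed

text \<open>Chebyshev's inequality. One factor \<open>CARD('a)\<close> comes from Cauchy-Schwarz
  over the field elements, the other from adding up their variances.\<close>

lemma card_unbalanced_le:
  fixes S :: "'a :: {finite, field} srow set"
  assumes "0 < n" "0 < h"
  shows "card {z \<in> ker n S. dev n z > h} \<le> CARD('a) ^ 2 * dep n S / h ^ 2 * card (ker n S)"
proof -
  have dev2: "dev n z ^ 2 \<le> CARD('a) * (\<Sum>c\<in>UNIV. (cnt n z c / n - 1 / CARD('a)) ^ 2)" for z :: "nat \<Rightarrow> 'a"
    unfolding dev_def using Cauchy_Schwarz_ineq_sum[of "\<lambda>_. 1" "\<lambda>c. \<bar>cnt n z c / n - 1 / CARD('a)\<bar>" "UNIV :: 'a set"] by simp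
  have "h ^ 2 * card {z \<in> ker n S. dev n z > h} = (\<Sum>z\<in>{z \<in> ker n S. dev n z > h}. h ^ 2)" by simp
  also have "\<dots> \<le> (\<Sum>z\<in>{z \<in> ker n S. dev n z > h}. dev n z ^ 2)"
    using assms by (intro sum_mono power_mono) auto
  also have "\<dots> \<le> (\<Sum>z\<in>ker n S. dev n z ^ 2)" by (intro sum_mono2) auto
  also have "\<dots> \<le> (\<Sum>z\<in>ker n S. CARD('a) * (\<Sum>c\<in>UNIV. (cnt n z c / n - 1 / CARD('a)) ^ 2))"
    by (intro sum_mono dev2)
  also have "\<dots> = CARD('a) * (\<Sum>c\<in>UNIV. \<Sum>z\<in>ker n S. (cnt n z c / n - 1 / CARD('a)) ^ 2)"
    by (subst sum.swap) (simp add: sum_distrib_left)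
  also have "\<dots> \<le> CARD('a) * (\<Sum>c\<in>(UNIV :: 'a set). dep n S * card (ker n S))"
    by (intro mult_left_mono sum_mono sum_cnt_dev_le assms) auto
  also have "\<dots> = CARD('a) ^ 2 * dep n S * card (ker n S)" by (simp add: power2_eq_square)
  finally show ?thesis using assms by (simp add: field_simps)
qed

definition ov :: "nat \<Rightarrow> (nat \<Rightarrow> 'a) \<Rightarrow> (nat \<Rightarrow> 'a) \<Rightarrow> 'a \<Rightarrow> 'a \<Rightarrow> real" where
  "ov n x x' s t = card {i \<in> {..<n}. x i = s \<and> x' i = t} / n"

text \<open>A pair of solutions is \<open>x\<close> and \<open>x + z\<close>, with \<open>x\<close>
  ranging over the whole space and \<open>z\<close> over the kernel. For an independent pair, which
  is off the diagonal, both parts decouple: \<open>x\<close> always and \<open>z\<close> by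
  \<open>indep\<close>.\<close>

lemma sum_ov_le:
  fixes S :: "'a :: {finite, field} srow set"
  assumes "0 < n"
  shows "(\<Sum>x\<in>space_n n. \<Sum>z\<in>ker n S. (ov n x (\<lambda>i. x i + z i) s t - 1 / CARD('a) ^ 2) ^ 2)
    \<le> dep n S * (CARD('a) ^ n * card (ker n S))"
proof -
  let ?q = "1 / real CARD('a) ^ 2"
  let ?W = "(space_n n :: (nat \<Rightarrow> 'a) set) \<times> ker n S"
  let ?f = "\<lambda>a b. of_bool (a = s \<and> a + b = t) - ?q"
  let ?X = "\<lambda>i (x, z). ?f (x i) (z i)"
  let ?Bad = "{(i, j). i < n \<and> j < n \<and> \<not> indep n S i j}"
  have q1: "?q \<le> 1" using card_field_gt_1[where 'a = 'a] by simp
  have f0: "(\<Sum>a\<in>UNIV. \<Sum>b\<in>UNIV. ?f a b) = 0"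
  proof -
    have "(\<Sum>b\<in>UNIV. of_bool (a = s \<and> a + b = t) :: real) = of_bool (a = s)" for a
    proof -
      have "(\<Sum>b\<in>UNIV. of_bool (a = s \<and> a + b = t) :: real) = (\<Sum>b\<in>UNIV. if b = t - a then of_bool (a = s) else 0)"
        by (intro sum.cong) (auto simp: algebra_simps)
      then show ?thesis by (simp only: sum.delta finite if_True UNIV_I)
    qed
    then show ?thesis using card_field_gt_1[where 'a = 'a] by (simp add: sum_subtractf power2_eq_square)
  qed
  have "(\<Sum>w\<in>?W. (\<Sum>i<n. ?X i w) ^ 2) \<le> real (card ?Bad) * real (card ?W)"
  proof (rule sum_square_le_bad_pairs[where X = ?X])
    show "\<bar>?X i w\<bar> \<le> 1" for i w using q1 by (cases w) (auto simp: of_bool_def)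
    fix i j assume ij: "i < n" "j < n" "(i, j) \<notin> ?Bad"
    then have S: "\<not> frozen n S i" "\<not> frozen n (insert (pin i) S) j" by (auto simp: indep_def)
    then have "i \<noteq> j" by (auto simp: frozen_iff ker_insert)
    have E: "\<not> frozen n {} i" "\<not> frozen n (insert (pin i) {}) j"
    proof -
      have "(\<lambda>_. 0)(i := 1) \<in> ker n {}" using ij by (simp add: space_n_def)
      then show "\<not> frozen n {} i" by (auto simp: frozen_iff intro!: bexI)
      have "(\<lambda>_. 0)(j := 1) \<in> ker n (insert (pin i) {})" using ij \<open>i \<noteq> j\<close> by (simp add: ker_insert space_n_def)
      then show "\<not> frozen n (insert (pin i) {}) j" by (auto simp: frozen_iff intro!: bexI)
    qed
    have "(\<Sum>w\<in>?W. ?X i w * ?X j w) = (\<Sum>x\<in>space_n n. \<Sum>z\<in>ker n S. ?f (x i) (z i) * ?f (x j) (z j))"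
      by (simp add: sum.cartesian_product case_prod_unfold)
    also have "\<dots> = (\<Sum>x\<in>ker n {}. card (ker n S) / CARD('a) ^ 2 * ((\<Sum>b\<in>UNIV. ?f (x i) b) * (\<Sum>b\<in>UNIV. ?f (x j) b)))"
      unfolding ker_empty by (intro sum.cong refl) (subst sum_fibre_pair[OF S, where g = "\<lambda>a b. ?f _ a * ?f _ b"], simp only: sum_product)
    also have "\<dots> = card (ker n S) / CARD('a) ^ 2 * (\<Sum>x\<in>ker n {}. (\<Sum>b\<in>UNIV. ?f (x i) b) * (\<Sum>b\<in>UNIV. ?f (x j) b))"
      by (simp only: sum_distrib_left)
    also have "(\<Sum>x\<in>ker n {}. (\<Sum>b\<in>UNIV. ?f (x i) b) * (\<Sum>b\<in>UNIV. ?f (x j) b)) = 0"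
      by (subst sum_fibre_pair[OF E, where g = "\<lambda>a a'. (\<Sum>b\<in>UNIV. ?f a b) * (\<Sum>b\<in>UNIV. ?f a' b)"])
         (simp only: sum_distrib_left[symmetric] f0 mult_zero_right sum.neutral_const)
    finally show "(\<Sum>w\<in>?W. ?X i w * ?X j w) = 0" by simp
  qed auto
  moreover have "(ov n x (\<lambda>i. x i + z i) s t - ?q) ^ 2 = (\<Sum>i<n. ?X i (x, z)) ^ 2 / n ^ 2" for x z
  proof -
    have "{i \<in> {..<n}. x i = s \<and> x i + z i = t} = {..<n} \<inter> {i. x i = s \<and> x i + z i = t}" by auto
    then have "ov n x (\<lambda>i. x i + z i) s t = (\<Sum>i<n. of_bool (x i = s \<and> x i + z i = t)) / n"
      by (simp add: ov_def sum_of_bool_eq)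
    then show ?thesis using assms by (simp add: sum_subtractf power_divide[symmetric] diff_divide_distrib)
  qed
  ultimately have "(\<Sum>x\<in>space_n n. \<Sum>z\<in>ker n S. (ov n x (\<lambda>i. x i + z i) s t - ?q) ^ 2) \<le> real (card ?Bad) * real (card ?W) / n ^ 2"
    by (simp add: sum.cartesian_product case_prod_unfold sum_divide_distrib[symmetric] divide_right_mono)
  then show ?thesis by (simp add: dep_def card_cartesian_product card_space_n)
qed

section \<open>First moment of balanced kernel vectors\<close>

lemma expt_ucoord:
  fixes z :: "nat \<Rightarrow> 'a :: finite"
  assumes "0 < n"
  shows "expt (ucoord n) (\<lambda>j. g (z j)) = (\<Sum>c\<in>(UNIV :: 'a set). cnt n z c / n * g c)"
proof -
  have "expt (ucoord n) (\<lambda>j. g (z j)) = (\<Sum>j<n. g (z j)) / n"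
    using assms by (subst integral_pmf_of_set) (auto simp: lessThan_empty_iff)
  also have "(\<Sum>j<n. g (z j)) = (\<Sum>c\<in>UNIV. \<Sum>j\<in>{j \<in> {..<n}. z j = c}. g (z j))"
    by (rule sum.group[symmetric]) auto
  also have "\<dots> = (\<Sum>c\<in>UNIV. cnt n z c * g c)" by (simp add: cnt_def)
  finally show ?thesis by (simp add: sum_divide_distrib)
qed

lemma expt_of_bool_sum:
  fixes X :: "'b \<Rightarrow> 'a :: finite"
  shows "(\<Sum>s\<in>UNIV. expt M (\<lambda>w. of_bool (X w = s))) = 1"
proof -
  have "(\<Sum>s\<in>UNIV. expt M (\<lambda>w. of_bool (X w = s))) = expt M (\<lambda>w. \<Sum>s\<in>UNIV. of_bool (X w = s))"
    by (intro Bochner_Integration.integral_sum[symmetric] integrable_pmf_bounded[where B = 1]) auto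
  also have "(\<lambda>w. \<Sum>s\<in>UNIV. of_bool (X w = s) :: real) = (\<lambda>_. 1)" by (simp add: of_bool_def)
  finally show ?thesis by simp
qed

text \<open>Convolving with the uniform distribution gives the uniform distribution, so only the
  deviations from uniformity multiply up.\<close>

lemma iid_row_near_uniform:
  fixes a :: "'a :: {finite, field} list"
  assumes n: "0 < n" and "0 \<notin> set a"
  shows "\<bar>expt (replicate_pmf (length a) (ucoord n)) (\<lambda>\<beta>. of_bool (lin (\<beta>, a) z = s)) - 1 / CARD('a)\<bar> \<le> dev n z ^ length a"
  using assms(2)
proof (induction a arbitrary: s)
  case Nil
  show ?case using card_field_gt_1[where 'a = 'a] by (auto simp: of_bool_def lin_def)
next
  case (Cons b a)
  let ?q = "1 / real CARD('a)"
  let ?G = "\<lambda>s. expt (replicate_pmf (length a) (ucoord n)) (\<lambda>\<beta>. of_bool (lin (\<beta>, a) z = s))"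
  have b: "b \<noteq> 0" "0 \<notin> set a" using Cons.prems by auto
  have lin: "lin (j # \<beta>, b # a) z = b * z j + lin (\<beta>, a) z" for j \<beta>
    by (simp add: lin_def sum.lessThan_Suc_shift del: sum.lessThan_Suc)
  have G1: "(\<Sum>c\<in>UNIV. ?G (s - b * c) - ?q) = 0"
  proof -
    have "bij (\<lambda>c. s - b * c)" using b by (intro bij_betwI[where g = "\<lambda>t. (s - t) / b"]) auto
    then have "(\<Sum>c\<in>UNIV. ?G (s - b * c)) = (\<Sum>t\<in>UNIV. ?G t)"
      by (rule sum.reindex_bij_betw)
    then show ?thesis using expt_of_bool_sum[of "replicate_pmf (length a) (ucoord n)" "\<lambda>\<beta>. lin (\<beta>, a) z"]
        card_field_gt_1[where 'a = 'a] by (simp add: sum_subtractf)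
  qed
  have c1: "(\<Sum>c\<in>UNIV. real (cnt n z c) / n) = 1"
    using expt_ucoord[OF n, of "\<lambda>_. 1" z] by simp
  have "expt (replicate_pmf (length (b # a)) (ucoord n)) (\<lambda>\<beta>. of_bool (lin (\<beta>, b # a) z = s))
    = expt (ucoord n) (\<lambda>j. ?G (s - b * z j))"
    by (simp add: expt_replicate_Suc[where B = 1] lin eq_diff_eq' del: replicate_pmf.simps)
       (simp add: algebra_simps eq_diff_eq del: replicate_pmf.simps)
  also have "\<dots> = (\<Sum>c\<in>UNIV. cnt n z c / n * ?G (s - b * c))" by (rule expt_ucoord[OF n])
  also have "\<dots> - ?q = (\<Sum>c\<in>UNIV. cnt n z c / n * (?G (s - b * c) - ?q))"
    using c1 by (simp add: right_diff_distrib sum_subtractf flip: sum_divide_distrib)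
  also have "\<dots> = (\<Sum>c\<in>UNIV. (cnt n z c / n - ?q) * (?G (s - b * c) - ?q)) + ?q * (\<Sum>c\<in>UNIV. ?G (s - b * c) - ?q)"
    unfolding sum_distrib_left sum.distrib[symmetric] by (intro sum.cong refl) (simp add: algebra_simps)
  also have "\<dots> = (\<Sum>c\<in>UNIV. (cnt n z c / n - ?q) * (?G (s - b * c) - ?q))" unfolding G1 by simp
  also have "\<bar>\<dots>\<bar> \<le> (\<Sum>c\<in>UNIV. \<bar>cnt n z c / n - ?q\<bar> * dev n z ^ length a)"
    using Cons.IH[OF b(2)] by (intro order_trans[OF sum_abs] sum_mono) (auto simp: abs_mult intro!: mult_left_mono)
  also have "\<dots> = dev n z ^ length (b # a)"
    by (simp add: dev_def[symmetric] sum_distrib_right[symmetric])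
  finally show ?case .
qed

lemma falling_fact_ge:
  assumes "k \<le> n" "j \<le> k"
  shows "real (n - k) ^ j \<le> fact j * real (n choose j)"
  using assms(2)
proof (induction j)
  case (Suc j)
  have "real (n - k) ^ Suc j \<le> real (n - j) * (fact j * real (n choose j))"
    unfolding power_Suc using Suc by (intro mult_mono) auto
  also have "\<dots> = fact j * (real (n - j) * real (n choose j))" by simp
  also have "\<dots> = fact (Suc j) * real (n choose Suc j)"
    unfolding Suc_times_binomial_Suc[symmetric] by (simp add: algebra_simps)
  finally show ?case .
qed simp

text \<open>The left side is the inverse probability that \<open>k\<close> independent coordinates
  are distinct. It is so close to 1 that even its power of order \<open>n\<close> stays
  bounded.\<close>

lemma injective_ratio_le:
  assumes "0 < k" "2 * k \<le> n"
  shows "real n ^ k / (fact k * (n choose k)) \<le> exp (2 * real k ^ 2 / n)"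
proof -
  have n: "0 < n" "k < n" using assms by auto
  have nk: "0 < real (n - k)" using n by simp
  have "real n ^ k / (fact k * (n choose k)) \<le> real n ^ k / real (n - k) ^ k"
    using falling_fact_ge[of k n k] n nk by (intro divide_left_mono) auto
  also have "\<dots> = (real n / real (n - k)) ^ k" by (simp add: power_divide)
  also have "\<dots> \<le> exp (2 * k / n) ^ k"
  proof (rule power_mono)
    have "real n * real n \<le> (real n + 2 * real k) * (real n - real k)"
    proof -
      have "2 * (real k * real k) \<le> real k * real n" using assms(2) mult_left_mono[of "real (2 * k)" "real n" "real k"] by simp
      then show ?thesis by (simp add: algebra_simps)
    qed
    then have "real n / real (n - k) \<le> 1 + 2 * k / n" using n by (simp add: field_simps of_nat_diff)
    also have "\<dots> \<le> exp (2 * k / n)" by (rule exp_ge_add_one_self)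
    finally show "real n / real (n - k) \<le> exp (2 * k / n)" .
  qed simp
  also have "\<dots> = exp (2 * real k ^ 2 / n)" by (simp add: exp_of_nat_mult[symmetric] power2_eq_square)
  finally show ?thesis .
qed

lemma exp_le_quadratic:
  fixes y :: real
  assumes "\<bar>y\<bar> \<le> 1"
  shows "exp y \<le> 1 + y + y ^ 2"
proof (cases "0 \<le> y")
  case True
  then show ?thesis using exp_bound[of y] assms by simp
next
  case False
  define u where "u = - y"
  have u: "0 \<le> u" "u \<le> 1" using False assms by (auto simp: u_def)
  have "1 + u \<le> exp u" by (rule exp_ge_add_one_self)
  then have "exp (- u) \<le> 1 / (1 + u)" using u by (simp add: exp_minus field_simps)
  also have "\<dots> \<le> 1 - u + u ^ 2"
  proof -
    have "(1 - u + u ^ 2) * (1 + u) = 1 + u ^ 3" by (simp add: algebra_simps power2_eq_square power3_eq_cube)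
    then show ?thesis using u by (simp add: divide_le_eq)
  qed
  finally show ?thesis by (simp add: u_def)
qed

text \<open>The square is linearised by averaging exponential moments over a Gaussian parameter.\<close>

lemma sum_exp_square_le:
  fixes y :: "'a :: {finite, field} \<Rightarrow> real"
  assumes n: "0 < n" and y: "\<And>a. \<bar>y a\<bar> \<le> 1" "(\<Sum>a\<in>UNIV. y a) = 0"
  shows "(\<Sum>z\<in>space_n n. exp ((\<Sum>i<n. y (z i)) ^ 2 / (8 * n))) \<le> sqrt 2 * real CARD('a) ^ n"
proof -
  have q: "real CARD('a) > 1" by (rule card_field_gt_1)
  \<comment> \<open>The sub-Gaussian bound for one centred bounded coordinate: quadratic expansion
    for small \<open>t\<close>, and \<open>t * y a \<le> t ^ 2\<close> once \<open>t\<close> exceeds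
    1 in absolute value.\<close>
  have one: "(\<Sum>a\<in>UNIV. exp (t * y a)) \<le> CARD('a) * exp (t ^ 2)" for t :: real
  proof (cases "\<bar>t\<bar> \<le> 1")
    case True
    have y2: "(t * y a) ^ 2 \<le> t ^ 2" for a
      using y(1)[of a] by (simp add: power_mult_distrib mult_left_le abs_square_le_1)
    have "(\<Sum>a\<in>UNIV. exp (t * y a)) \<le> (\<Sum>a\<in>UNIV. (1 + t ^ 2) + t * y a)"
    proof (rule sum_mono)
      fix a
      have "\<bar>t * y a\<bar> \<le> 1" using mult_mono[OF True y(1)[of a]] by (simp add: abs_mult)
      then show "exp (t * y a) \<le> (1 + t ^ 2) + t * y a" using exp_le_quadratic[of "t * y a"] y2[of a] by simp
    qed
    also have "\<dots> = CARD('a) * (1 + t ^ 2)" using y(2) by (simp add: sum.distrib sum_distrib_left[symmetric])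
    also have "\<dots> \<le> CARD('a) * exp (t ^ 2)" by (intro mult_left_mono exp_ge_add_one_self) auto
    finally show ?thesis .
  next
    case False
    have "exp (t * y a) \<le> exp (t ^ 2)" for a
    proof -
      have "t * y a \<le> \<bar>t\<bar> * \<bar>y a\<bar>" by (metis abs_ge_self abs_mult)
      also have "\<dots> \<le> \<bar>t\<bar> * \<bar>t\<bar>" using y(1)[of a] False by (intro mult_left_mono) auto
      finally show ?thesis by (simp add: power2_eq_square)
    qed
    then have "(\<Sum>a\<in>UNIV. exp (t * y a)) \<le> (\<Sum>a\<in>(UNIV :: 'a set). exp (t ^ 2))" by (intro sum_mono)
    then show ?thesis by simp
  qed
  have mgf: "(\<Sum>z\<in>space_n n. exp (t * (\<Sum>i<n. y (z i)))) \<le> real CARD('a) ^ n * exp (n * t ^ 2)" for t :: real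
  proof -
    have "(\<Sum>z\<in>space_n n. exp (t * (\<Sum>i<n. y (z i)))) = (\<Sum>z\<in>{..<n} \<rightarrow>\<^sub>E UNIV. exp (t * (\<Sum>i<n. y (if i < n then z i else 0))))"
      by (rule sum.reindex_bij_betw[OF bij_space_n, symmetric])
    also have "\<dots> = (\<Sum>z\<in>{..<n} \<rightarrow>\<^sub>E UNIV. \<Prod>i<n. exp (t * y (z i)))"
      by (intro sum.cong refl) (simp add: sum_distrib_left exp_sum)
    also have "\<dots> = (\<Prod>i<n. \<Sum>a\<in>UNIV. exp (t * y a))"
      by (rule prod_sum_PiE[symmetric]) auto
    also have "\<dots> = (\<Sum>a\<in>UNIV. exp (t * y a)) ^ n" by simp
    also have "\<dots> \<le> (CARD('a) * exp (t ^ 2)) ^ n" by (intro power_mono one sum_nonneg) auto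
    also have "\<dots> = real CARD('a) ^ n * exp (n * t ^ 2)" by (simp add: power_mult_distrib exp_of_nat_mult)
    finally show ?thesis .
  qed
  have g: "std_normal_density x * exp (b * x) = exp (b ^ 2 / 2) * normal_density b 1 x" for b x
  proof -
    have "- (x\<^sup>2 / 2) + b * x = b ^ 2 / 2 + - ((x - b) ^ 2 / 2)" by (simp add: power2_eq_square field_simps)
    then have "exp (- (x\<^sup>2 / 2)) * exp (b * x) = exp (b ^ 2 / 2) * exp (- ((x - b) ^ 2 / 2))"
      by (simp only: exp_add[symmetric])
    then show ?thesis by (simp add: normal_density_def)
  qed
  have int: "integrable lborel (\<lambda>x. std_normal_density x * exp (b * x))" for b unfolding g by simp
  have gi: "(\<integral>x. std_normal_density x * exp (b * x) \<partial>lborel) = exp (b ^ 2 / 2)" for b unfolding g by simp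
  \<comment> \<open>With this scaling the Gaussian average produces the wanted exponent, while the
    moment bound at x / (2 sqrt n) contributes exp (x^2 / 4). This uses up half of the Gaussian
    decay, and the remaining integral is sqrt 2.\<close>
  define b where "b z = (\<Sum>i<n. y (z i)) / (2 * sqrt n)" for z
  have b2: "b z ^ 2 / 2 = (\<Sum>i<n. y (z i)) ^ 2 / (8 * n)" for z
    using n by (simp add: b_def power_divide power_mult_distrib)
  have d: "std_normal_density x * exp (x ^ 2 / 4) = sqrt 2 * normal_density 0 (sqrt 2) x" for x
  proof -
    have "exp (- (x\<^sup>2 / 2)) * exp (x ^ 2 / 4) = exp (- (x ^ 2 / 4))" by (simp add: exp_add[symmetric])
    moreover have "sqrt (2 * pi * (sqrt 2) ^ 2) = sqrt 2 * sqrt (2 * pi)" by (simp add: real_sqrt_mult)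
    ultimately show ?thesis by (simp add: normal_density_def field_simps)
  qed
  have "(\<Sum>z\<in>space_n n. exp ((\<Sum>i<n. y (z i)) ^ 2 / (8 * n))) = (\<Sum>z\<in>space_n n. \<integral>x. std_normal_density x * exp (b z * x) \<partial>lborel)"
    unfolding gi b2 ..
  also have "\<dots> = (\<integral>x. (\<Sum>z\<in>space_n n. std_normal_density x * exp (b z * x)) \<partial>lborel)"
    by (rule Bochner_Integration.integral_sum[symmetric]) (rule int)
  also have "\<dots> \<le> (\<integral>x. real CARD('a) ^ n * (sqrt 2 * normal_density 0 (sqrt 2) x) \<partial>lborel)"
  proof (rule integral_mono)
    show "integrable lborel (\<lambda>x. \<Sum>z\<in>space_n n. std_normal_density x * exp (b z * x))"
      by (intro Bochner_Integration.integrable_sum int)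
    show "integrable lborel (\<lambda>x. real CARD('a) ^ n * (sqrt 2 * normal_density 0 (sqrt 2) x))" by simp
    fix x :: real
    have "(\<Sum>z\<in>space_n n. std_normal_density x * exp (b z * x)) = std_normal_density x * (\<Sum>z\<in>space_n n. exp (x / (2 * sqrt n) * (\<Sum>i<n. y (z i))))"
      by (simp add: sum_distrib_left b_def mult.commute)
    also have "\<dots> \<le> std_normal_density x * (real CARD('a) ^ n * exp (n * (x / (2 * sqrt n)) ^ 2))"
      by (intro mult_left_mono mgf) auto
    also have "n * (x / (2 * sqrt n)) ^ 2 = x ^ 2 / 4" using n by (simp add: power_divide power_mult_distrib)
    also have "std_normal_density x * (real CARD('a) ^ n * exp (x ^ 2 / 4)) = real CARD('a) ^ n * (std_normal_density x * exp (x ^ 2 / 4))" by simp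
    finally show "(\<Sum>z\<in>space_n n. std_normal_density x * exp (b z * x)) \<le> real CARD('a) ^ n * (sqrt 2 * normal_density 0 (sqrt 2) x)"
      unfolding d .
  qed
  finally show ?thesis by (simp add: mult.commute)
qed

text \<open>The deviation is at most \<open>CARD('a)\<close> times the largest deviation of a single
  count, and the exponential of a maximum is at most the sum over the field elements. The bound on
  \<open>K\<close> matches the constant 1/8 of \<open>sum_exp_square_le\<close>.\<close>

lemma sum_exp_dev_le:
  fixes K :: real
  assumes n: "0 < n" and K: "0 \<le> K" "K * real CARD('a) ^ 2 \<le> 1 / 8"
  shows "(\<Sum>z\<in>(space_n n :: (nat \<Rightarrow> 'a :: {finite, field}) set). exp (K * n * dev n z ^ 2)) \<le> sqrt 2 * CARD('a) * real CARD('a) ^ n"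
proof -
  let ?q = "1 / real CARD('a)"
  have q: "real CARD('a) > 1" by (rule card_field_gt_1)
  let ?Y = "\<lambda>z c. \<Sum>i<n. of_bool (z i = c) - ?q"
  have Y: "cnt n z c / n - ?q = ?Y z c / n" for z and c :: 'a
    using n by (simp add: cnt_eq_sum sum_subtractf diff_divide_distrib)
  have one: "exp (K * n * dev n z ^ 2) \<le> (\<Sum>c\<in>UNIV. exp (?Y z c ^ 2 / (8 * n)))" for z :: "nat \<Rightarrow> 'a"
  proof -
    have "Max (range (\<lambda>c. \<bar>?Y z c\<bar>)) \<in> range (\<lambda>c. \<bar>?Y z c\<bar>)" by (rule Max_in) auto
    then obtain c where Mx: "Max (range (\<lambda>c. \<bar>?Y z c\<bar>)) = \<bar>?Y z c\<bar>" by (rule rangeE)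
    have c: "\<bar>?Y z c'\<bar> \<le> \<bar>?Y z c\<bar>" for c' unfolding Mx[symmetric] by (rule Max_ge) (rule finite_imageI, rule finite, rule rangeI)
    have "dev n z \<le> (\<Sum>c'\<in>(UNIV :: 'a set). \<bar>?Y z c\<bar> / n)"
      unfolding dev_def Y abs_divide abs_of_nat using c by (intro sum_mono divide_right_mono) auto
    then have "dev n z ^ 2 \<le> (CARD('a) * (\<bar>?Y z c\<bar> / n)) ^ 2"
      using dev_nonneg by (intro power_mono) auto
    then have "K * n * dev n z ^ 2 \<le> K * n * (CARD('a) * (\<bar>?Y z c\<bar> / n)) ^ 2"
      using K by (intro mult_left_mono) auto
    also have "\<dots> = K * real CARD('a) ^ 2 * (?Y z c ^ 2 / n)"
      using n by (simp add: power_mult_distrib power_divide power2_eq_square)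
    also have "\<dots> \<le> 1 / 8 * (?Y z c ^ 2 / n)" using K by (intro mult_right_mono) auto
    finally have "exp (K * n * dev n z ^ 2) \<le> exp (?Y z c ^ 2 / (8 * n))" by simp
    also have "\<dots> \<le> (\<Sum>c\<in>UNIV. exp (?Y z c ^ 2 / (8 * n)))" by (rule member_le_sum) auto
    finally show ?thesis .
  qed
  have "(\<Sum>z\<in>(space_n n :: (nat \<Rightarrow> 'a) set). exp (K * n * dev n z ^ 2)) \<le> (\<Sum>z\<in>(space_n n :: (nat \<Rightarrow> 'a) set). \<Sum>c\<in>UNIV. exp (?Y z c ^ 2 / (8 * n)))"
    by (intro sum_mono one)
  also have "\<dots> = (\<Sum>c\<in>UNIV. \<Sum>z\<in>(space_n n :: (nat \<Rightarrow> 'a) set). exp (?Y z c ^ 2 / (8 * n)))" by (rule sum.swap)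
  also have "\<dots> \<le> (\<Sum>c\<in>(UNIV :: 'a set). sqrt 2 * real CARD('a) ^ n)"
  proof (rule sum_mono)
    fix c :: 'a
    have "\<bar>of_bool (a = c) - ?q\<bar> \<le> 1" for a using q by (auto simp: of_bool_def)
    then show "(\<Sum>z\<in>space_n n. exp (?Y z c ^ 2 / (8 * n))) \<le> sqrt 2 * real CARD('a) ^ n"
      using sum_exp_square_le[OF n, of "\<lambda>a. of_bool (a = c) - ?q", OF _ sum_of_bool_minus]
      by (simp only: of_nat_mult of_nat_numeral)
  qed
  finally show ?thesis by (simp add: mult.assoc mult.left_commute)
qed

lemma lin_permute:
  assumes "\<pi> permutes {..<length \<alpha>}" "length a = length \<alpha>"
  shows "lin (permute_list \<pi> \<alpha>, permute_list \<pi> a) z = lin (\<alpha>, a) z"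
proof -
  have "lin (permute_list \<pi> \<alpha>, permute_list \<pi> a) z = (\<Sum>h<length \<alpha>. a ! \<pi> h * z (\<alpha> ! \<pi> h))"
    using assms by (auto simp: lin_def permute_list_nth intro!: sum.cong)
  also have "\<dots> = lin (\<alpha>, a) z"
    unfolding lin_def using sum.reindex_bij_betw[OF permutes_imp_bij[OF assms(1)], of "\<lambda>h. a ! h * z (\<alpha> ! h)"] by simp
  finally show ?thesis .
qed

text \<open>Each increasing list has \<open>fact k\<close> rearrangements. This is the passage from
  ordered positions to independent ones for symmetric functions.\<close>

lemma sum_positions_eq_distinct:
  fixes H :: "nat list \<Rightarrow> real"
  assumes "\<And>\<alpha> \<beta>. mset \<beta> = mset \<alpha> \<Longrightarrow> H \<beta> = H \<alpha>"
  shows "(\<Sum>\<beta>\<in>{\<beta>. distinct \<beta> \<and> set \<beta> \<subseteq> {..<n} \<and> length \<beta> = k}. H \<beta>) = fact k * (\<Sum>\<alpha>\<in>positions n k. H \<alpha>)"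
proof -
  let ?D = "{\<beta>. distinct \<beta> \<and> set \<beta> \<subseteq> {..<n} \<and> length \<beta> = k}"
  have fD: "finite ?D" by (rule finite_subset[OF _ finite_lists_length_eq[of "{..<n}" k]]) auto
  have "(\<Sum>\<beta>\<in>?D. H \<beta>) = (\<Sum>\<alpha>\<in>positions n k. \<Sum>\<beta>\<in>{\<beta> \<in> ?D. sort \<beta> = \<alpha>}. H \<beta>)"
    by (rule sum.group[symmetric, OF fD finite_positions]) (auto simp: positions_def strict_sorted_iff)
  also have "\<dots> = (\<Sum>\<alpha>\<in>positions n k. fact k * H \<alpha>)"
  proof (rule sum.cong[OF refl])
    fix \<alpha> assume \<alpha>: "\<alpha> \<in> positions n k"
    then have a: "length \<alpha> = k" "sorted \<alpha>" "distinct \<alpha>" "set \<alpha> \<subseteq> {..<n}" by (auto simp: positions_def strict_sorted_iff)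
    have E: "{\<beta> \<in> ?D. sort \<beta> = \<alpha>} = permutations_of_set (set \<alpha>)"
    proof (intro equalityI subsetI)
      fix \<beta> assume "\<beta> \<in> permutations_of_set (set \<alpha>)"
      then have b: "set \<beta> = set \<alpha>" "distinct \<beta>" by (auto simp: permutations_of_set_def)
      then have "length \<beta> = k" using a by (metis distinct_card)
      moreover have "sort \<beta> = \<alpha>" using a b by (intro sorted_distinct_set_unique) auto
      ultimately show "\<beta> \<in> {\<beta> \<in> ?D. sort \<beta> = \<alpha>}" using a b by auto
    qed (auto simp: permutations_of_set_def)
    have "H \<beta> = H \<alpha>" if "sort \<beta> = \<alpha>" for \<beta> using assms[of \<beta> \<alpha>] that by auto
    then have "(\<Sum>\<beta>\<in>{\<beta> \<in> ?D. sort \<beta> = \<alpha>}. H \<beta>) = (\<Sum>\<beta>\<in>{\<beta> \<in> ?D. sort \<beta> = \<alpha>}. H \<alpha>)"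
      by (intro sum.cong) auto
    also have "\<dots> = fact k * H \<alpha>"
      unfolding E using a distinct_card[of \<alpha>] by simp
    finally show "(\<Sum>\<beta>\<in>{\<beta> \<in> ?D. sort \<beta> = \<alpha>}. H \<beta>) = fact k * H \<alpha>" .
  qed
  finally show ?thesis by (simp add: sum_distrib_left)
qed

text \<open>The probability that a uniform right-hand side is attained.\<close>

definition sol_prob :: "nat \<Rightarrow> 'a :: {finite, field} srow list \<Rightarrow> real" where
  "sol_prob n rs = real CARD('a) ^ n / (real CARD('a) ^ length rs * card (ker n (set rs)))"

text \<open>The upper bound says that the rank is at most the number of rows.\<close>

lemma sol_prob_bounds:
  fixes rs :: "'a :: {finite, field} srow list"
  shows "0 < sol_prob n rs" "sol_prob n rs \<le> 1"
proof -
  have q: "real CARD('a) > 1" by (rule card_field_gt_1)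
  have c: "card (ker n (set rs)) > 0" by (rule card_ker_pos)
  show "0 < sol_prob n rs" using q c by (simp add: sol_prob_def)
  have "real n - length (filter (\<lambda>r. \<not> vanish n {} r) rs) \<le> nul n (set rs)"
    using nul_union_ge[of n "{} :: 'a srow set" rs] by simp
  moreover have "real (length (filter (\<lambda>r. \<not> vanish n {} r) rs)) \<le> length rs" by simp
  ultimately have nl: "nul n (set rs) \<ge> real n - length rs" by linarith
  have "real CARD('a) ^ n = CARD('a) powr (real (length rs) + (real n - length rs))"
    using q by (simp add: powr_realpow)
  also have "\<dots> \<le> CARD('a) powr (real (length rs) + nul n (set rs))"
    using q nl by (intro powr_mono) auto
  also have "\<dots> = real CARD('a) ^ length rs * card (ker n (set rs))"
    using q by (simp add: powr_add powr_realpow card_ker_eq_powr)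
  finally show "sol_prob n rs \<le> 1" using q c by (simp add: sol_prob_def divide_le_eq_1)
qed

lemma sol_prob_abs: "\<bar>sol_prob n rs\<bar> \<le> 1"
  using sol_prob_bounds[of n rs] by simp

context sparse_system begin

text \<open>Permutation invariance of \<open>P\<close> makes the average over the entries symmetric
  in the positions. Increasing positions thus become distinct ones, and then arbitrary tuples at the
  price of the first factor.\<close>

lemma prob_lin_zero_le:
  assumes "k \<le> n"
  shows "prob (urow n k P) {r. lin r z = 0}
    \<le> real n ^ k / (fact k * (n choose k)) * (1 / CARD('a) + dev n z ^ k)"
proof -
  have n: "0 < n" using assms k_pos by simp
  \<comment> \<open>The length guard makes the symmetry hold for lists of every length, as
    \<open>sum_positions_eq_distinct\<close> requires.\<close>
  define H :: "nat list \<Rightarrow> real" where "H \<alpha> = expt P (\<lambda>a. of_bool (length \<alpha> = k \<and> lin (\<alpha>, a) z = 0))" for \<alpha>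
  have H0: "0 \<le> H \<alpha>" for \<alpha> unfolding H_def by (intro expt_ge_const integrable_pmf_bounded[where B = 1]) auto
  have Hp: "H (permute_list \<pi> \<alpha>) = H \<alpha>" if pi: "\<pi> permutes {..<length \<alpha>}" for \<pi> \<alpha>
  proof (cases "length \<alpha> = k")
    case True
    have "map_pmf (permute_list \<pi>) P = P" using P_inv pi True by (simp add: perm_invariant_nonzero_def)
    then have "H (permute_list \<pi> \<alpha>) = expt (map_pmf (permute_list \<pi>) P) (\<lambda>a. of_bool (length (permute_list \<pi> \<alpha>) = k \<and> lin (permute_list \<pi> \<alpha>, a) z = 0))"
      by (simp add: H_def)
    also have "\<dots> = H \<alpha>" unfolding H_def integral_map_pmf
    proof (rule expt_cong)
      fix a assume "a \<in> set_pmf P"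
      then have "length a = length \<alpha>" using set_P True by simp
      from lin_permute[OF pi this, of z] show "of_bool (length (permute_list \<pi> \<alpha>) = k \<and> lin (permute_list \<pi> \<alpha>, permute_list \<pi> a) z = 0) = (of_bool (length \<alpha> = k \<and> lin (\<alpha>, a) z = 0) :: real)"
        by simp
    qed
    finally show ?thesis .
  qed (simp add: H_def)
  have Hm: "H \<beta> = H \<alpha>" if m: "mset \<beta> = mset \<alpha>" for \<alpha> \<beta>
  proof -
    obtain p where "p permutes {..<length \<alpha>}" "permute_list p \<alpha> = \<beta>" using mset_eq_permutation[OF m] .
    then show ?thesis using Hp by auto
  qed
  have "prob (urow n k P) {r. lin r z = 0} = expt (pmf_of_set (positions n k)) (\<lambda>\<alpha>. expt P (\<lambda>a. indicator {r. lin r z = 0} (\<alpha>, a)))"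
    unfolding urow_def by (subst expt_pair[where B = 1, symmetric]) auto
  also have "\<dots> = expt (pmf_of_set (positions n k)) H"
  proof (rule expt_cong)
    fix \<alpha> assume "\<alpha> \<in> set_pmf (pmf_of_set (positions n k))"
    then have "\<alpha> \<in> positions n k" using positions_nonempty[OF assms] by (simp add: set_pmf_of_set)
    then have "length \<alpha> = k" by (simp add: positions_def)
    then show "expt P (\<lambda>a. indicator {r. lin r z = 0} (\<alpha>, a)) = H \<alpha>" by (simp add: H_def indicator_def of_bool_def)
  qed
  also have "\<dots> = (\<Sum>\<alpha>\<in>positions n k. H \<alpha>) / (n choose k)"
    using positions_nonempty[OF assms] by (subst integral_pmf_of_set) (auto simp: card_positions)
  also have "\<dots> = (\<Sum>\<beta>\<in>{\<beta>. distinct \<beta> \<and> set \<beta> \<subseteq> {..<n} \<and> length \<beta> = k}. H \<beta>) / (fact k * (n choose k))"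
  proof -
    have "(\<Sum>\<beta>\<in>{\<beta>. distinct \<beta> \<and> set \<beta> \<subseteq> {..<n} \<and> length \<beta> = k}. H \<beta>) = fact k * (\<Sum>\<alpha>\<in>positions n k. H \<alpha>)"
      by (rule sum_positions_eq_distinct) (rule Hm)
    then show ?thesis by simp
  qed
  also have "\<dots> \<le> (\<Sum>\<beta>\<in>{\<beta>. set \<beta> \<subseteq> {..<n} \<and> length \<beta> = k}. H \<beta>) / (fact k * (n choose k))"
    by (intro divide_right_mono sum_mono2 finite_lists_length_eq) (auto simp: H0)
  also have "\<dots> = real n ^ k / (fact k * (n choose k)) * expt (replicate_pmf k (ucoord n)) H"
    using n by (simp add: expt_replicate_ucoord)
  also have "\<dots> \<le> real n ^ k / (fact k * (n choose k)) * (1 / CARD('a) + dev n z ^ k)"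
  proof (rule mult_left_mono)
    have "expt (replicate_pmf k (ucoord n)) H = expt P (\<lambda>a. expt (replicate_pmf k (ucoord n)) (\<lambda>\<beta>. of_bool (length \<beta> = k \<and> lin (\<beta>, a) z = 0)))"
      unfolding H_def by (rule expt_swap[where B = 1]) auto
    also have "\<dots> \<le> 1 / CARD('a) + dev n z ^ k"
    proof (rule expt_le_const)
      show "integrable P (\<lambda>a. expt (replicate_pmf k (ucoord n)) (\<lambda>\<beta>. of_bool (length \<beta> = k \<and> lin (\<beta>, a) z = 0)))"
        by (rule integrable_measure_pmf_finite[OF finite_set_P])
      fix a assume "a \<in> set_pmf P"
      then have a: "length a = k" "0 \<notin> set a" using set_P by auto
      have "expt (replicate_pmf k (ucoord n)) (\<lambda>\<beta>. of_bool (length \<beta> = k \<and> lin (\<beta>, a) z = 0))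
        = expt (replicate_pmf k (ucoord n)) (\<lambda>\<beta>. of_bool (lin (\<beta>, a) z = 0))"
        by (rule expt_cong) (auto simp: set_replicate_pmf)
      then show "expt (replicate_pmf k (ucoord n)) (\<lambda>\<beta>. of_bool (length \<beta> = k \<and> lin (\<beta>, a) z = 0)) \<le> 1 / CARD('a) + dev n z ^ k"
        using iid_row_near_uniform[OF n a(2), of z 0] a(1) by (simp add: abs_le_iff)
    qed
    finally show "expt (replicate_pmf k (ucoord n)) H \<le> 1 / CARD('a) + dev n z ^ k" .
  qed simp
  finally show ?thesis .
qed

text \<open>By independence of the rows, \<open>z\<close> lies in the kernel with the
  \<open>m\<close>-th power of its one-row probability. For small \<open>h\<close> the resulting
  excess over \<open>CARD('a) ^ - m\<close> is at most exponential in a small multiple of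
  \<open>n * dev n z ^ 2\<close>, which \<open>sum_exp_dev_le\<close> sums; the last condition on
  \<open>h\<close> is the bound on \<open>K\<close> there.\<close>

lemma expt_card_balanced_le:
  fixes C h :: real
  assumes n: "2 * k \<le> n" and m: "real m \<le> C * n" and C: "0 < C"
    and h: "0 < h" "h \<le> 1" "8 * C * real CARD('a) ^ 3 * h \<le> 1"
  shows "expt (urows n m) (\<lambda>rs. real (card {z \<in> ker n (set rs). dev n z \<le> h}))
    \<le> exp (2 * real k ^ 2 * C) * (sqrt 2 * CARD('a)) * (real CARD('a) ^ n / real CARD('a) ^ m)"
proof -
  let ?R = "urow n k P" and ?q = "real CARD('a)"
  have q: "?q > 1" by (rule card_field_gt_1)
  have n0: "0 < n" "k \<le> n" using n k_pos by auto
  let ?B = "{z \<in> space_n n. dev n z \<le> h} :: (nat \<Rightarrow> 'a) set"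
  have fB: "finite ?B" by simp
  have eq: "real (card {z \<in> ker n (set rs). dev n z \<le> h}) = (\<Sum>z\<in>?B. indicator {rs. \<forall>r\<in>set rs. lin r z = 0} rs)" for rs :: "'a srow list"
  proof -
    have "{z \<in> ker n (set rs). dev n z \<le> h} = {z \<in> ?B. \<forall>r\<in>set rs. lin r z = 0}" by (auto simp: ker_def)
    moreover have "(\<Sum>z\<in>?B. indicator {rs. \<forall>r\<in>set rs. lin r z = 0} rs) = real (card {z \<in> ?B. \<forall>r\<in>set rs. lin r z = 0})"
      by (simp add: indicator_def sum.If_cases Int_def)
    ultimately show ?thesis by simp
  qed
  have "expt (replicate_pmf m ?R) (\<lambda>rs. real (card {z \<in> ker n (set rs). dev n z \<le> h}))
    = (\<Sum>z\<in>?B. prob (replicate_pmf m ?R) {rs. \<forall>r\<in>set rs. lin r z = 0})"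
    unfolding eq by (subst Bochner_Integration.integral_sum) (auto intro: integrable_pmf_bounded[where B = 1])
  also have "\<dots> = (\<Sum>z\<in>?B. prob ?R {r. lin r z = 0} ^ m)" unfolding prob_replicate_all ..
  also have "\<dots> \<le> (\<Sum>z\<in>?B. exp (2 * real k ^ 2 * C) * (1 / ?q ^ m) * exp (?q * C * h * n * dev n z ^ 2))"
  proof (rule sum_mono)
    fix z :: "nat \<Rightarrow> 'a" assume z: "z \<in> ?B"
    let ?d = "dev n z"
    have d: "0 \<le> ?d" "?d \<le> h" using z dev_nonneg by auto
    \<comment> \<open>The cube leaves one spare factor \<open>h\<close>, which makes the coefficient
      of the square as small as desired.\<close>
    have dk: "?d ^ k \<le> h * ?d ^ 2"
    proof -
      have "?d ^ k \<le> ?d ^ 3" using d h k_ge_3 by (intro power_decreasing) auto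
      also have "\<dots> = ?d * ?d ^ 2" by (simp add: power3_eq_cube power2_eq_square)
      also have "\<dots> \<le> h * ?d ^ 2" using d by (intro mult_right_mono) auto
      finally show ?thesis .
    qed
    have "prob ?R {r. lin r z = 0} \<le> exp (2 * real k ^ 2 / n) * (1 / ?q + ?d ^ k)"
      using d q by (intro order_trans[OF prob_lin_zero_le[OF n0(2)]] mult_right_mono injective_ratio_le k_pos n) auto
    also have "1 / ?q + ?d ^ k \<le> 1 / ?q * exp (?q * h * ?d ^ 2)"
    proof -
      have "1 / ?q + ?d ^ k \<le> 1 / ?q * (1 + ?q * h * ?d ^ 2)" using dk q by (simp add: field_simps)
      also have "\<dots> \<le> 1 / ?q * exp (?q * h * ?d ^ 2)" by (intro mult_left_mono exp_ge_add_one_self) auto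
      finally show ?thesis .
    qed
    finally have "prob ?R {r. lin r z = 0} \<le> exp (2 * real k ^ 2 / n) * (1 / ?q * exp (?q * h * ?d ^ 2))" by simp
    then have "prob ?R {r. lin r z = 0} ^ m \<le> (exp (2 * real k ^ 2 / n) * (1 / ?q * exp (?q * h * ?d ^ 2))) ^ m"
      by (intro power_mono) auto
    also have "\<dots> = exp (m * (2 * real k ^ 2 / n)) * (1 / ?q ^ m) * exp (m * (?q * h * ?d ^ 2))"
      unfolding power_mult_distrib exp_of_nat_mult by (simp add: power_divide)
    also have "\<dots> \<le> exp (2 * real k ^ 2 * C) * (1 / ?q ^ m) * exp (?q * C * h * n * ?d ^ 2)"
    proof (intro mult_mono order_refl)
      have "m * (2 * real k ^ 2 / n) \<le> C * n * (2 * real k ^ 2 / n)" using m by (intro mult_right_mono) auto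
      then show "exp (m * (2 * real k ^ 2 / n)) \<le> exp (2 * real k ^ 2 * C)" using n0 by (simp add: algebra_simps)
      have "m * (?q * h * ?d ^ 2) \<le> C * n * (?q * h * ?d ^ 2)" using m h q by (intro mult_right_mono) auto
      then show "exp (m * (?q * h * ?d ^ 2)) \<le> exp (?q * C * h * n * ?d ^ 2)" by (simp add: algebra_simps)
    qed auto
    finally show "prob ?R {r. lin r z = 0} ^ m \<le> exp (2 * real k ^ 2 * C) * (1 / ?q ^ m) * exp (?q * C * h * n * ?d ^ 2)" .
  qed
  also have "\<dots> = exp (2 * real k ^ 2 * C) * (1 / ?q ^ m) * (\<Sum>z\<in>?B. exp (?q * C * h * n * dev n z ^ 2))"
    by (simp only: sum_distrib_left)
  also have "\<dots> \<le> exp (2 * real k ^ 2 * C) * (1 / ?q ^ m) * (\<Sum>z\<in>(space_n n :: (nat \<Rightarrow> 'a) set). exp (?q * C * h * n * dev n z ^ 2))"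
    by (intro mult_left_mono sum_mono2) auto
  also have "\<dots> \<le> exp (2 * real k ^ 2 * C) * (1 / ?q ^ m) * (sqrt 2 * CARD('a) * real CARD('a) ^ n)"
  proof (intro mult_left_mono sum_exp_dev_le n0)
    show "?q * C * h * real CARD('a) ^ 2 \<le> 1 / 8" using h by (simp add: power3_eq_cube power2_eq_square algebra_simps)
  qed (use C h in auto)
  finally show ?thesis by (simp add: algebra_simps)
qed

text \<open>When \<open>dep\<close> is small, at least half of the kernel is balanced, so
  \<open>1 / w\<close> is at most twice the normalised number of balanced kernel vectors, whose mean
  is at most the constant \<open>A\<close>.\<close>

lemma expt_sol_prob_ge:
  fixes d d' :: real
  assumes d: "0 < d" "d < d'" and M: "\<And>\<alpha>. 0 \<le> \<alpha> \<Longrightarrow> \<alpha> \<le> 1 \<Longrightarrow> Phi d' \<alpha> \<le> 1 - d' / k"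
  obtains c where "0 < c" "\<forall>\<^sub>F n in sequentially. \<forall>m. real m \<le> d * n / k \<longrightarrow> c \<le> expt (urows n m) (sol_prob n)"
proof -
  let ?q = "real CARD('a)"
  have q: "?q > 1" by (rule card_field_gt_1)
  define C where "C = d / k"
  have C: "0 < C" using d k_pos by (simp add: C_def)
  define h where "h = min 1 (1 / (8 * C * ?q ^ 3))"
  have h: "0 < h" "h \<le> 1" "8 * C * ?q ^ 3 * h \<le> 1"
  proof -
    have "h \<le> 1 / (8 * C * ?q ^ 3)" by (simp add: h_def)
    then show "8 * C * ?q ^ 3 * h \<le> 1" using C q by (simp add: field_simps)
  qed (use C q in \<open>auto simp: h_def\<close>)
  \<comment> \<open>Chosen so that \<open>card_unbalanced_le\<close> leaves at most half of the
    kernel unbalanced.\<close>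
  define e where "e = h ^ 2 / (2 * ?q ^ 2)"
  have e: "0 < e" using h q by (simp add: e_def)
  define A where "A = exp (2 * real k ^ 2 * C) * (sqrt 2 * ?q)"
  have A: "0 < A" using q by (simp add: A_def)
  have ev: "\<forall>\<^sub>F n in sequentially. \<forall>m. real m \<le> d * n / k \<longrightarrow> expt (urows n m) (\<lambda>rs. dep n (set rs)) \<le> e / 4"
    using e by (intro expt_dep_small[OF d M]) auto
  have "\<forall>\<^sub>F n in sequentially. \<forall>m. real m \<le> d * n / k \<longrightarrow> 1 / (4 * A) \<le> expt (urows n m) (sol_prob n)"
    using ev eventually_ge_at_top[of "2 * k"]
  proof eventually_elim
    case (elim n)
    have n0: "0 < n" using elim k_pos by simp
    show ?case
    proof (intro allI impI)
      fix m assume m: "real m \<le> d * n / k"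
      let ?M = "urows n m"
      let ?bal = "\<lambda>rs. real (card {z \<in> ker n (set rs). dev n z \<le> h}) * (?q ^ m / ?q ^ n)"
      \<comment> \<open>Once the means are inserted, the lower bound is 3/2 s - 2 A s^2; it equals s
        exactly at this value.\<close>
      let ?s = "1 / (4 * A)"
      have iw: "integrable (measure_pmf N) (sol_prob n)" for N
        by (rule integrable_pmf_bounded) (rule sol_prob_abs)
      have idp: "integrable ?M (\<lambda>rs. dep n (set rs))"
        by (rule integrable_pmf_bounded) (rule dep_abs)
      have cb: "card {z \<in> ker n (set rs). dev n z \<le> h} \<le> CARD('a) ^ n" for rs :: "'a srow list"
        unfolding card_space_n[symmetric] using ker_subset_space by (intro card_mono) auto
      have icard: "integrable ?M (\<lambda>rs. real (card {z \<in> ker n (set rs). dev n z \<le> h}))"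
        by (rule integrable_pmf_bounded[where B = "real CARD('a) ^ n"]) (use cb in \<open>simp flip: of_nat_power\<close>)
      then have ib: "integrable ?M ?bal" by simp
      \<comment> \<open>A pointwise inequality that is linear in \<open>dep\<close> and in the
        balanced count, so that only their means enter. The factor \<open>1 - dep / e\<close> makes
        the left side nonpositive on the matrices with large \<open>dep\<close>.\<close>
      have key: "2 * ?s * (1 - dep n (set rs) / e) - ?s ^ 2 * (2 * ?bal rs) \<le> sol_prob n rs"
        if rs: "rs \<in> set_pmf ?M" for rs
      proof (cases "dep n (set rs) \<le> e")
        case True
        let ?K = "card (ker n (set rs))"
        have K: "real ?K > 0" using card_ker_pos by simp
        have len: "length rs = m" using rs by (simp add: set_replicate_pmf)
        have "real (card {z \<in> ker n (set rs). dev n z > h}) \<le> ?q ^ 2 * dep n (set rs) / h ^ 2 * ?K"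
          using card_unbalanced_le[OF n0 h(1), of "set rs"] by simp
        also have "\<dots> \<le> ?q ^ 2 * e / h ^ 2 * ?K"
          using True q h by (intro mult_right_mono divide_right_mono mult_left_mono) auto
        also have "\<dots> = ?K / 2" using h q by (simp add: e_def)
        finally have un: "real (card {z \<in> ker n (set rs). dev n z > h}) \<le> ?K / 2" .
        have "?K = card ({z \<in> ker n (set rs). dev n z \<le> h} \<union> {z \<in> ker n (set rs). dev n z > h})"
          by (intro arg_cong[where f = card]) auto
        also have "\<dots> = card {z \<in> ker n (set rs). dev n z \<le> h} + card {z \<in> ker n (set rs). dev n z > h}"
          by (rule card_Un_disjoint) auto
        finally have half: "?K \<le> 2 * real (card {z \<in> ker n (set rs). dev n z \<le> h})" using un by simp
        let ?w = "sol_prob n rs"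
        have w: "0 < ?w" by (rule sol_prob_bounds)
        have "1 / ?w = ?K * (?q ^ m / ?q ^ n)" using q K by (simp add: sol_prob_def len)
        also have "\<dots> \<le> 2 * real (card {z \<in> ker n (set rs). dev n z \<le> h}) * (?q ^ m / ?q ^ n)"
          using half q by (intro mult_right_mono) auto
        finally have inv: "1 / ?w \<le> 2 * ?bal rs" by simp
        \<comment> \<open>trades a lower bound on the mean of \<open>w\<close> for an upper bound on the mean of \<open>1 / w\<close>\<close>
        have "2 * ?s - ?s ^ 2 * (1 / ?w) \<le> ?w"
        proof -
          have "0 \<le> (?w - ?s) ^ 2 / ?w" using w by simp
          also have "(?w - s) ^ 2 / ?w = ?w - 2 * s + s ^ 2 * (1 / ?w)" for s
            using w by (simp add: power2_eq_square field_simps)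
          finally show ?thesis by simp
        qed
        moreover have "?s ^ 2 * (1 / ?w) \<le> ?s ^ 2 * (2 * ?bal rs)" by (intro mult_left_mono inv) auto
        moreover have "2 * ?s * (1 - dep n (set rs) / e) \<le> 2 * ?s * 1"
          using A e dep_bounds(1)[of n "set rs"] by (intro mult_left_mono) auto
        ultimately show ?thesis by linarith
      next
        case False
        then have "2 * ?s * (1 - dep n (set rs) / e) \<le> 0" using A e by (intro mult_nonneg_nonpos) auto
        moreover have "0 \<le> ?s ^ 2 * (2 * ?bal rs)" by simp
        ultimately show ?thesis using sol_prob_bounds(1)[of n rs] by linarith
      qed
      have bal: "expt ?M ?bal \<le> A"
      proof -
        have "expt ?M (\<lambda>rs. real (card {z \<in> ker n (set rs). dev n z \<le> h})) \<le> A * (?q ^ n / ?q ^ m)"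
          unfolding A_def using m elim C h by (intro expt_card_balanced_le) (auto simp: C_def)
        then have "expt ?M (\<lambda>rs. real (card {z \<in> ker n (set rs). dev n z \<le> h})) * (?q ^ m / ?q ^ n) \<le> A * (?q ^ n / ?q ^ m) * (?q ^ m / ?q ^ n)"
          by (intro mult_right_mono) auto
        then show ?thesis using q by simp
      qed
      have "?s \<le> 2 * ?s * (1 - 1 / 4) - ?s ^ 2 * (2 * A)" using A by (simp add: field_simps power2_eq_square)
      also have "\<dots> \<le> 2 * ?s * (1 - expt ?M (\<lambda>rs. dep n (set rs)) / e) - ?s ^ 2 * (2 * expt ?M ?bal)"
      proof -
        have "expt ?M (\<lambda>rs. dep n (set rs)) / e \<le> 1 / 4" using elim m e by (simp add: field_simps)
        then have "2 * ?s * (1 - 1 / 4) \<le> 2 * ?s * (1 - expt ?M (\<lambda>rs. dep n (set rs)) / e)"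
          using A by (intro mult_left_mono) auto
        moreover have "?s ^ 2 * (2 * expt ?M ?bal) \<le> ?s ^ 2 * (2 * A)"
          using bal by (intro mult_left_mono) auto
        ultimately show ?thesis by linarith
      qed
      also have "\<dots> = expt ?M (\<lambda>rs. 2 * ?s * (1 - dep n (set rs) / e) - ?s ^ 2 * (2 * ?bal rs))"
        using idp icard by simp
      also have "\<dots> \<le> expt ?M (sol_prob n)"
        using idp icard by (intro expt_mono iw key) auto
      finally show "1 / (4 * A) \<le> expt ?M (sol_prob n)" .
    qed
  qed
  then show ?thesis using that[of "1 / (4 * A)"] A by simp
qed

end

section \<open>From rows to the random linear system\<close>

lemma expt_cond_pmf:
  assumes "set_pmf M \<inter> S \<noteq> {}" "\<And>x. \<bar>f x\<bar> \<le> B"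
  shows "expt (cond_pmf M S) f = expt M (\<lambda>x. indicator S x * f x) / prob M S"
proof -
  have pos: "prob M S > 0"
    using assms(1) by (metis measure_pmf_zero_iff zero_less_measure_iff)
  have "measure_pmf (cond_pmf M S) = density (measure_pmf M) (\<lambda>x. ennreal (indicator S x / prob M S))"
    unfolding cond_pmf.rep_eq[OF assms(1)] uniform_measure_def
    using pos by (intro density_cong) (auto simp: measure_pmf.emeasure_eq_measure indicator_def divide_ennreal simp flip: ennreal_1)
  then have "expt (cond_pmf M S) f = expt M (\<lambda>x. indicator S x / prob M S * f x)"
    by (simp add: integral_real_density)
  then show ?thesis by simp
qed

lemma row_pmf_eq: "row_pmf n k P = map_pmf (\<lambda>r. sparse_row n (fst r) (snd r)) (urow n k P)"
  by (simp add: row_pmf_def urow_def pair_pmf_def map_pmf_def bind_assoc_pmf bind_return_pmf)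

definition sys_mat :: "nat \<Rightarrow> 'a :: {finite, field} srow list \<Rightarrow> 'a mat" where
  "sys_mat n rs = mat_of_rows n (map (\<lambda>r. sparse_row n (fst r) (snd r)) rs)"

lemma system_pmf_eq:
  fixes P :: "'a :: {finite, field} list pmf"
  shows "system_pmf n k d P = bind_pmf (poisson_pmf (d * n / k)) (\<lambda>m. bind_pmf (replicate_pmf m (urow n k P))
    (\<lambda>rs. map_pmf (\<lambda>y. (sys_mat n rs, y)) (pmf_of_set (carrier_vec m))))"
  unfolding system_pmf_def row_pmf_eq replicate_map_pmf sys_mat_def
  by (simp add: map_pmf_def bind_assoc_pmf bind_return_pmf)

lemma sparse_row_scalar_prod:
  fixes x :: "nat \<Rightarrow> 'a :: {finite, field}"
  assumes "r \<in> rows_below n"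
  shows "sparse_row n (fst r) (snd r) \<bullet> vec n x = lin r x"
proof -
  have lt: "fst r ! h < n" if "h < length (fst r)" for h
    using assms that by (auto simp: rows_below_def dest!: nth_mem)
  have "sparse_row n (fst r) (snd r) \<bullet> vec n x = (\<Sum>j<n. (\<Sum>h<length (fst r). if fst r ! h = j then snd r ! h else 0) * x j)"
    by (simp add: scalar_prod_def sparse_row_def lessThan_atLeast0)
  also have "\<dots> = (\<Sum>h<length (fst r). \<Sum>j<n. if j = fst r ! h then snd r ! h * x j else 0)"
    unfolding sum_distrib_right by (subst sum.swap) (auto intro!: sum.cong)
  also have "\<dots> = lin r x" unfolding lin_def by (intro sum.cong refl) (simp add: sum.delta lt)
  finally show ?thesis .
qed

definition row_vals :: "'a :: {finite, field} srow list \<Rightarrow> (nat \<Rightarrow> 'a) \<Rightarrow> 'a vec" where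
  "row_vals rs x = vec (length rs) (\<lambda>i. lin (rs ! i) x)"

lemma sys_mat_mult:
  assumes "set rs \<subseteq> rows_below n"
  shows "sys_mat n rs *\<^sub>v vec n x = row_vals rs x"
proof (rule eq_vecI)
  show "dim_vec (sys_mat n rs *\<^sub>v vec n x) = dim_vec (row_vals rs x)" by (simp add: sys_mat_def row_vals_def)
  fix i assume "i < dim_vec (row_vals rs x)"
  then have i: "i < length rs" by (simp add: row_vals_def)
  have "rs ! i \<in> rows_below n" using assms i nth_mem by blast
  then show "(sys_mat n rs *\<^sub>v vec n x) $ i = row_vals rs x $ i"
    using i sparse_row_scalar_prod[of "rs ! i" n x]
    by (simp add: sys_mat_def row_vals_def sparse_row_def mat_of_rows_row)
qed

lemma bij_vec: "bij_betw (vec n) (space_n n :: (nat \<Rightarrow> 'a :: {finite, field}) set) (carrier_vec n)"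
  by (rule bij_betwI[where g = "\<lambda>v i. if i < n then v $ i else 0"])
     (auto simp: space_n_def fun_eq_iff not_less)

lemma card_carrier_vec: "card (carrier_vec n :: 'a :: {finite, field} vec set) = CARD('a) ^ n"
  using bij_betw_same_card[OF bij_vec[of n, where 'a = 'a]] by (simp add: card_space_n)

lemma finite_carrier_vec: "finite (carrier_vec n :: 'a :: {finite, field} vec set)"
  using bij_betw_finite[OF bij_vec[of n, where 'a = 'a]] by simp

lemma carrier_vec_nonempty: "(carrier_vec n :: 'a :: {finite, field} vec set) \<noteq> {}"
  using zero_carrier_vec by blast

lemma row_vals_lincomb_eq:
  "row_vals rs (\<lambda>i. x i + z i) = row_vals rs x \<longleftrightarrow> (\<forall>r\<in>set rs. lin r z = 0)"
  using lin_lincomb[of _ x 1 z] by (auto simp: row_vals_def vec_eq_iff all_set_conv_all_nth)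

definition sols :: "nat \<Rightarrow> 'a :: {finite, field} srow list \<Rightarrow> 'a vec \<Rightarrow> (nat \<Rightarrow> 'a) set" where
  "sols n rs y = {x \<in> space_n n. row_vals rs x = y}"

lemma sols_eq:
  assumes "x \<in> space_n n"
  shows "sols n rs (row_vals rs x) = (\<lambda>z i. x i + z i) ` ker n (set rs)"
proof (intro equalityI subsetI)
  fix x' assume x': "x' \<in> sols n rs (row_vals rs x)"
  define z where "z = (\<lambda>i. x' i - x i)"
  have e: "x' = (\<lambda>i. x i + z i)" by (simp add: z_def)
  have "\<forall>r\<in>set rs. lin r z = 0" using x' row_vals_lincomb_eq[of rs x z] by (simp add: sols_def e[symmetric])
  moreover have "z \<in> space_n n" using assms x' by (auto simp: sols_def space_n_def z_def)
  ultimately show "x' \<in> (\<lambda>z i. x i + z i) ` ker n (set rs)" using e by (auto simp: ker_def)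
next
  fix x' assume "x' \<in> (\<lambda>z i. x i + z i) ` ker n (set rs)"
  then obtain z where z: "z \<in> ker n (set rs)" "x' = (\<lambda>i. x i + z i)" by auto
  then show "x' \<in> sols n rs (row_vals rs x)"
    using assms row_vals_lincomb_eq[of rs x z] by (auto simp: sols_def ker_def space_n_def)
qed

lemma inj_translate: "inj_on (\<lambda>z i. x i + z i) (A :: (nat \<Rightarrow> 'a :: {finite, field}) set)"
  by (rule inj_onI) (simp add: fun_eq_iff)

lemma solutions_eq:
  fixes rs :: "'a :: {finite, field} srow list"
  assumes "set rs \<subseteq> rows_below n"
  shows "solutions n (sys_mat n rs) y = vec n ` sols n rs y"
proof -
  have "carrier_vec n = vec n ` (space_n n :: (nat \<Rightarrow> 'a) set)" using bij_vec[of n, where 'a = 'a] by (simp add: bij_betw_def)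
  then show ?thesis unfolding solutions_def sols_def using sys_mat_mult[OF assms] by auto
qed

lemma expt_pair_of_set:
  assumes "finite S" "S \<noteq> {}"
  shows "expt (pair_pmf (pmf_of_set S) (pmf_of_set S)) (\<lambda>(x, x'). f x x') = (\<Sum>x\<in>S. \<Sum>x'\<in>S. f x x') / real (card S) ^ 2"
proof -
  have "expt (pair_pmf (pmf_of_set S) (pmf_of_set S)) (\<lambda>(x, x'). f x x')
    = (\<Sum>z\<in>S \<times> S. (case z of (x, x') \<Rightarrow> f x x') * pmf (pair_pmf (pmf_of_set S) (pmf_of_set S)) z)"
    using assms by (intro integral_measure_pmf_real) (auto simp: set_pmf_of_set)
  also have "\<dots> = (\<Sum>z\<in>S \<times> S. (case z of (x, x') \<Rightarrow> f x x') * (1 / real (card S) ^ 2))"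
    by (intro sum.cong refl) (auto simp: pmf_pair pmf_of_set[OF assms(2,1)] power2_eq_square)
  finally show ?thesis by (simp add: sum.cartesian_product case_prod_unfold sum_divide_distrib)
qed

text \<open>Every \<open>x\<close> solves exactly one system, so summing over the attained
  right-hand sides and their solutions runs through the whole space once. All nonempty solution sets
  are translates of the kernel, which explains the common normalisation.\<close>

lemma expt_rhs:
  fixes rs :: "'a :: {finite, field} srow list"
  assumes "set rs \<subseteq> rows_below n"
  shows "expt (pmf_of_set (carrier_vec (length rs))) (\<lambda>y. indicator (solvable n) (sys_mat n rs, y) * gibbs_avg2 n (sys_mat n rs) y f)
    = (\<Sum>x\<in>space_n n. \<Sum>z\<in>ker n (set rs). f (vec n x) (vec n (\<lambda>i. x i + z i))) / (real CARD('a) ^ length rs * real (card (ker n (set rs))) ^ 2)"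
proof -
  let ?M = "sys_mat n rs" and ?K = "ker n (set rs)" and ?m = "length rs"
  let ?g = "\<lambda>y. indicator (solvable n) (?M, y) * gibbs_avg2 n ?M y f"
  have inj: "inj_on (vec n) (sols n rs y)" for y
    using bij_vec[of n, where 'a = 'a] by (auto simp: bij_betw_def sols_def intro: inj_on_subset)
  have fs: "finite (sols n rs y)" for y by (simp add: sols_def)
  have solv: "(?M, y) \<in> solvable n \<longleftrightarrow> sols n rs y \<noteq> {}" for y
    using solutions_eq[OF assms, of y] by (auto simp: solvable_def solutions_def)
  \<comment> \<open>The formula also covers unattained \<open>y\<close>: there the indicator
    suppresses the meaningless average, and the sum is empty.\<close>
  have one: "?g y = (\<Sum>x\<in>sols n rs y. \<Sum>z\<in>?K. f (vec n x) (vec n (\<lambda>i. x i + z i))) / real (card ?K) ^ 2" for y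
  proof (cases "sols n rs y = {}")
    case False
    have inner: "(\<Sum>x'\<in>sols n rs y. f (vec n x) (vec n x')) = (\<Sum>z\<in>?K. f (vec n x) (vec n (\<lambda>i. x i + z i)))" if "x \<in> sols n rs y" for x
    proof -
      have x: "x \<in> space_n n" "y = row_vals rs x" using that by (auto simp: sols_def)
      show ?thesis unfolding x(2) sols_eq[OF x(1)] by (subst sum.reindex[OF inj_translate]) simp
    qed
    have card: "card (sols n rs y) = card ?K"
    proof -
      obtain x where "x \<in> sols n rs y" using False by auto
      then have x: "x \<in> space_n n" "y = row_vals rs x" by (auto simp: sols_def)
      show ?thesis unfolding x(2) sols_eq[OF x(1)] by (rule card_image[OF inj_translate])
    qed
    have "?g y = gibbs_avg2 n ?M y f" using False solv by simp
    also have "\<dots> = (\<Sum>x\<in>vec n ` sols n rs y. \<Sum>x'\<in>vec n ` sols n rs y. f x x') / real (card (vec n ` sols n rs y)) ^ 2"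
      unfolding gibbs_avg2_def solutions_eq[OF assms] using False fs by (intro expt_pair_of_set) auto
    also have "\<dots> = (\<Sum>x\<in>sols n rs y. \<Sum>x'\<in>sols n rs y. f (vec n x) (vec n x')) / real (card ?K) ^ 2"
      by (simp add: sum.reindex[OF inj] card_image[OF inj] card)
    finally show ?thesis using inner by simp
  qed (use solv in simp)
  have sub: "row_vals rs ` space_n n \<subseteq> carrier_vec ?m" by (auto simp: row_vals_def)
  have "expt (pmf_of_set (carrier_vec ?m)) ?g = (\<Sum>y\<in>carrier_vec ?m. ?g y) / real CARD('a) ^ ?m"
    by (subst integral_pmf_of_set) (auto simp: finite_carrier_vec carrier_vec_nonempty card_carrier_vec)
  also have "(\<Sum>y\<in>carrier_vec ?m. ?g y) = (\<Sum>y\<in>row_vals rs ` space_n n. ?g y)"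
    using sub by (intro sum.mono_neutral_right finite_carrier_vec) (auto simp: solv sols_def indicator_def)
  also have "\<dots> = (\<Sum>y\<in>row_vals rs ` space_n n. \<Sum>x\<in>{x \<in> space_n n. row_vals rs x = y}. (\<Sum>z\<in>?K. f (vec n x) (vec n (\<lambda>i. x i + z i))) / real (card ?K) ^ 2)"
    unfolding one sols_def by (simp add: sum_divide_distrib)
  also have "\<dots> = (\<Sum>x\<in>space_n n. (\<Sum>z\<in>?K. f (vec n x) (vec n (\<lambda>i. x i + z i))) / real (card ?K) ^ 2)"
    by (rule sum.image_gen[symmetric]) simp
  finally show ?thesis by (simp add: sum_divide_distrib[symmetric] mult.commute)
qed

section \<open>The overlap distance and the Poisson tail\<close>

definition tv_overlap :: "nat \<Rightarrow> 'a :: {finite, field} vec \<Rightarrow> 'a vec \<Rightarrow> real" where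
  "tv_overlap n x x' = tv_dist (overlap n x x') overlap_bar"

lemma tv_overlap_bounds:
  fixes x x' :: "'a :: {finite, field} vec"
  shows "0 \<le> tv_overlap n x x'" "tv_overlap n x x' \<le> real CARD('a) ^ 2"
proof -
  show "0 \<le> tv_overlap n x x'" by (simp add: tv_overlap_def tv_dist_def sum_nonneg)
  have "\<bar>overlap n x x' w - overlap_bar w\<bar> \<le> 1" for w :: "'a \<times> 'a"
  proof -
    obtain s t where w: "w = (s, t)" by (cases w)
    have "card {i \<in> {..<n}. x $ i = s \<and> x' $ i = t} \<le> card {..<n}" by (intro card_mono) auto
    then have o1: "0 \<le> overlap n x x' w" "overlap n x x' w \<le> 1" by (auto simp: overlap_def w divide_le_eq_1)
    have "1 \<le> real CARD('a \<times> 'a)"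
      using mult_mono[of 1 "real CARD('a)" 1 "real CARD('a)"] card_field_gt_1[where 'a = 'a] by simp
    then have "0 \<le> overlap_bar w" "overlap_bar w \<le> 1" by (auto simp: overlap_bar_def divide_le_eq_1)
    then show ?thesis using o1 by (simp add: abs_le_iff)
  qed
  then have "(\<Sum>w\<in>(UNIV :: ('a \<times> 'a) set). \<bar>overlap n x x' w - overlap_bar w\<bar>) \<le> (\<Sum>w\<in>(UNIV :: ('a \<times> 'a) set). 1)"
    by (intro sum_mono)
  also have "\<dots> = real CARD('a) ^ 2" by (simp add: power2_eq_square)
  finally show "tv_overlap n x x' \<le> real CARD('a) ^ 2"
    unfolding tv_overlap_def tv_dist_def using zero_le_power2[of "real CARD('a)"] by linarith
qed

lemma tv_overlap_abs: "\<bar>tv_overlap n x x'\<bar> \<le> real CARD('a) ^ 2" for x x' :: "'a :: {finite, field} vec"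
  using tv_overlap_bounds[of n x x'] by simp

lemma gibbs_avg2_abs_le:
  assumes "\<And>x x'. \<bar>f x x'\<bar> \<le> B" shows "\<bar>gibbs_avg2 n A y f\<bar> \<le> B"
  unfolding gibbs_avg2_def by (rule abs_expt_le) (use assms in auto)

text \<open>Chernoff's bound with the optimal tilt \<open>d1 / d\<close>; the rate
  \<open>\<kappa>\<close> is positive because the logarithm lies strictly below its tangent away
  from 1.\<close>

lemma poisson_upper_tail:
  fixes d d1 c :: real
  assumes "0 < d" "d < d1" "0 < c"
  shows "(\<lambda>n. prob (poisson_pmf (d * real n / c)) {m. d1 * n / c < real m}) \<longlonglongrightarrow> 0"
proof -
  define \<kappa> where "\<kappa> = (d1 * ln (d1 / d) - (d1 - d)) / c"
  have \<kappa>: "0 < \<kappa>"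
  proof -
    have d1: "0 < d1" using assms by simp
    have "ln (d / d1) \<noteq> d / d1 - 1" using ln_eq_minus_one[of "d / d1"] assms d1 by auto
    moreover have "ln (d / d1) \<le> d / d1 - 1" using assms d1 by (intro ln_le_minus_one) auto
    ultimately have "ln (d / d1) < d / d1 - 1" by simp
    moreover have "ln (d1 / d) = - ln (d / d1)" using assms d1 by (simp add: ln_div)
    ultimately have "1 - d / d1 < ln (d1 / d)" by simp
    then have "d1 * (1 - d / d1) < d1 * ln (d1 / d)" using d1 by (intro mult_strict_left_mono)
    then show ?thesis using d1 assms by (simp add: \<kappa>_def right_diff_distrib)
  qed
  have bound: "prob (poisson_pmf (d * real n / c)) {m. d1 * n / c < real m} \<le> exp (- \<kappa>) ^ n" if n: "0 < n" for n
  proof -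
    define l where "l = d * real n / c"
    have l: "0 < l" using assms n by (simp add: l_def)
    define B where "B = d1 / d"
    have B: "1 < B" using assms by (simp add: B_def)
    let ?b = "d1 * n / c"
    have "B powr ?b * prob (poisson_pmf l) {m. ?b < real m} = expt (poisson_pmf l) (\<lambda>m. B powr ?b * indicator {m. ?b < real m} m)"
      by simp
    also have "\<dots> \<le> expt (poisson_pmf l) (\<lambda>m. B ^ m)"
    proof (rule expt_mono)
      show "integrable (poisson_pmf l) (\<lambda>m. B ^ m)" using expt_poisson_power(1)[OF l, of B] B by simp
      show "integrable (poisson_pmf l) (\<lambda>m. B powr ?b * indicator {m. ?b < real m} m)"
        by (intro integrable_mult_right integrable_pmf_bounded[where B = 1]) (auto simp: indicator_def)
      fix m
      show "B powr ?b * indicator {m. ?b < real m} m \<le> B ^ m"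
        using B powr_mono[of ?b "real m" B] by (auto simp: indicator_def powr_realpow)
    qed
    also have "\<dots> = exp (l * (B - 1))" using expt_poisson_power(2)[OF l, of B] B by simp
    finally have "prob (poisson_pmf l) {m. ?b < real m} \<le> exp (l * (B - 1)) / B powr ?b"
      using B by (simp add: field_simps)
    also have "\<dots> = exp (l * (B - 1) - ?b * ln B)" using B by (simp add: powr_def exp_diff)
    also have "l * (B - 1) - ?b * ln B = n * (- \<kappa>)"
      using assms by (simp add: l_def B_def \<kappa>_def field_simps)
    finally show ?thesis by (simp add: l_def exp_of_nat_mult[symmetric])
  qed
  have "(\<lambda>n. exp (- \<kappa>) ^ n) \<longlonglongrightarrow> 0" using \<kappa> by (intro LIMSEQ_power_zero) auto
  then show ?thesis
  proof (rule tendsto_sandwich[OF _ _ tendsto_const, rotated 2])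
    show "\<forall>\<^sub>F n in sequentially. prob (poisson_pmf (d * real n / c)) {m. d1 * n / c < real m} \<le> exp (- \<kappa>) ^ n"
      by (rule eventually_mono[OF eventually_gt_at_top[of 0]]) (rule bound)
  qed simp
qed


lemma overlap_vec: "overlap n (vec n x) (vec n x') (s, t) = ov n x x' s t"
proof -
  have "{i \<in> {..<n}. vec n x $ i = s \<and> vec n x' $ i = t} = {i \<in> {..<n}. x i = s \<and> x' i = t}" by auto
  then show ?thesis by (simp add: overlap_def ov_def)
qed

lemma sum_tv_overlap_le:
  fixes S :: "'a :: {finite, field} srow set"
  assumes n: "0 < n" and e: "0 < e"
  shows "(\<Sum>x\<in>space_n n. \<Sum>z\<in>ker n S. tv_overlap n (vec n x) (vec n (\<lambda>i. x i + z i)))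
    \<le> real CARD('a) ^ 2 * (e + dep n S / e) * (real CARD('a) ^ n * card (ker n S))"
proof -
  let ?q = "real CARD('a)"
  let ?D = "\<lambda>x z w. ov n x (\<lambda>i. x i + z i) (fst w) (snd w) - 1 / ?q ^ 2"
  let ?N = "?q ^ n * card (ker n S)"
  \<comment> \<open>This keeps the bound linear in the second moment, hence linear in
    \<open>dep\<close>, so that it can be averaged over the matrix.\<close>
  have abs_le: "\<bar>t\<bar> \<le> e + t ^ 2 / e" for t
  proof -
    have "0 \<le> (\<bar>t\<bar> - e) ^ 2" by simp
    then have "2 * e * \<bar>t\<bar> \<le> e ^ 2 + t ^ 2" by (simp add: power2_diff algebra_simps)
    moreover have "e * \<bar>t\<bar> \<ge> 0" using e by simp
    ultimately have "e * \<bar>t\<bar> \<le> e ^ 2 + t ^ 2" by linarith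
    then show ?thesis using e by (simp add: field_simps power2_eq_square)
  qed
  have tv: "tv_overlap n (vec n x) (vec n (\<lambda>i. x i + z i)) \<le> (\<Sum>w\<in>UNIV. e + ?D x z w ^ 2 / e)" for x z :: "nat \<Rightarrow> 'a"
  proof -
    have "tv_overlap n (vec n x) (vec n (\<lambda>i. x i + z i)) \<le> (\<Sum>w\<in>(UNIV :: ('a \<times> 'a) set). \<bar>?D x z w\<bar>)"
    proof -
      have "overlap n (vec n x) (vec n (\<lambda>i. x i + z i)) w - overlap_bar w = ?D x z w" for w :: "'a \<times> 'a"
        using overlap_vec[of n x "\<lambda>i. x i + z i" "fst w" "snd w"] by (simp add: overlap_bar_def power2_eq_square)
      then have "tv_overlap n (vec n x) (vec n (\<lambda>i. x i + z i)) = (\<Sum>w\<in>(UNIV :: ('a \<times> 'a) set). \<bar>?D x z w\<bar>) / 2"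
        by (simp add: tv_overlap_def tv_dist_def)
      moreover have "0 \<le> (\<Sum>w\<in>(UNIV :: ('a \<times> 'a) set). \<bar>?D x z w\<bar>)" by (intro sum_nonneg) auto
      ultimately show ?thesis by linarith
    qed
    also have "\<dots> \<le> (\<Sum>w\<in>UNIV. e + ?D x z w ^ 2 / e)" by (intro sum_mono abs_le)
    finally show ?thesis .
  qed
  have "(\<Sum>x\<in>space_n n. \<Sum>z\<in>ker n S. tv_overlap n (vec n x) (vec n (\<lambda>i. x i + z i)))
    \<le> (\<Sum>x\<in>space_n n. \<Sum>z\<in>ker n S. \<Sum>w\<in>UNIV. e + ?D x z w ^ 2 / e)"
    by (intro sum_mono tv)
  also have "\<dots> = (\<Sum>w\<in>(UNIV :: ('a \<times> 'a) set). \<Sum>x\<in>space_n n. \<Sum>z\<in>ker n S. e + ?D x z w ^ 2 / e)"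
    by (subst sum.swap[of _ UNIV]) (intro sum.cong refl sum.swap)
  also have "\<dots> \<le> (\<Sum>w\<in>(UNIV :: ('a \<times> 'a) set). ?N * (e + dep n S / e))"
  proof (rule sum_mono)
    fix w :: "'a \<times> 'a"
    have "(\<Sum>x\<in>space_n n. \<Sum>z\<in>ker n S. e + ?D x z w ^ 2 / e) = ?N * e + (\<Sum>x\<in>space_n n. \<Sum>z\<in>ker n S. ?D x z w ^ 2) / e"
      by (simp add: sum.distrib sum_divide_distrib card_space_n)
    also have "\<dots> \<le> ?N * e + dep n S * ?N / e"
      using sum_ov_le[OF n, where S = S and s = "fst w" and t = "snd w"] e by (intro add_left_mono divide_right_mono) auto
    finally show "(\<Sum>x\<in>space_n n. \<Sum>z\<in>ker n S. e + ?D x z w ^ 2 / e) \<le> ?N * (e + dep n S / e)"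
      by (simp add: algebra_simps)
  qed
  finally show ?thesis by (simp add: power2_eq_square algebra_simps)
qed

section \<open>Averages over the full random system\<close>

context sparse_system begin

lemma rows_below_replicate:
  assumes "k \<le> n" "rs \<in> set_pmf (urows n m)"
  shows "set rs \<subseteq> rows_below n" "length rs = m"
  using assms set_urow_below by (auto simp: set_replicate_pmf)

lemma expt_system:
  assumes "\<And>w. \<bar>F w\<bar> \<le> B"
  shows "expt (system_pmf n k d P) F = expt (poisson_pmf (d * n / k)) (\<lambda>m. expt (urows n m)
    (\<lambda>rs. expt (pmf_of_set (carrier_vec m)) (\<lambda>y. F (sys_mat n rs, y))))"
  unfolding system_pmf_eq using assms by (simp add: expt_bind[where B = B])

definition mean_sol :: "real \<Rightarrow> nat \<Rightarrow> real" where
  "mean_sol d n = expt (poisson_pmf (d * n / k)) (\<lambda>m. expt (urows n m) (sol_prob n))"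

definition mean_dep :: "real \<Rightarrow> nat \<Rightarrow> real" where
  "mean_dep d n = expt (poisson_pmf (d * n / k)) (\<lambda>m. expt (urows n m) (\<lambda>rs. dep n (set rs)))"

text \<open>The average of the constant 1 over pairs of solutions is 1, so \<open>expt_rhs\<close>
  applies to it.\<close>

lemma prob_solvable:
  assumes "k \<le> n"
  shows "prob (system_pmf n k d P) (solvable n) = mean_sol d n"
proof -
  have "prob (system_pmf n k d P) (solvable n) = expt (system_pmf n k d P) (\<lambda>(A, y). indicator (solvable n) (A, y) * gibbs_avg2 n A y (\<lambda>_ _. 1))"
    by (simp add: gibbs_avg2_def case_prod_unfold)
  also have "\<dots> = expt (poisson_pmf (d * n / k)) (\<lambda>m. expt (urows n m)
    (\<lambda>rs. expt (pmf_of_set (carrier_vec m)) (\<lambda>y. indicator (solvable n) (sys_mat n rs, y) * gibbs_avg2 n (sys_mat n rs) y (\<lambda>_ _. 1))))"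
    by (subst expt_system[where B = 1]) (auto simp: gibbs_avg2_def case_prod_unfold indicator_def)
  also have "\<dots> = mean_sol d n"
    unfolding mean_sol_def
  proof (intro expt_cong)
    fix m rs assume "rs \<in> set_pmf (urows n m)"
    note rs = rows_below_replicate[OF assms this]
    have "real (card (ker n (set rs))) > 0" using card_ker_pos by simp
    then show "expt (pmf_of_set (carrier_vec m)) (\<lambda>y. indicator (solvable n) (sys_mat n rs, y) * gibbs_avg2 n (sys_mat n rs) y (\<lambda>_ _. 1)) = sol_prob n rs"
      using expt_rhs[OF rs(1), of "\<lambda>_ _. 1"] by (simp add: rs(2) card_space_n sol_prob_def power2_eq_square)
  qed
  finally show ?thesis .
qed

text \<open>The term with \<open>e\<close> keeps the weight \<open>sol_prob\<close>, which cancels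
  after conditioning. In the other term the weight is bounded by 1, which is affordable because
  \<open>mean_dep\<close> tends to 0.\<close>

lemma expt_solvable_tv_le:
  assumes n: "k \<le> n" and e: "0 < e"
  shows "expt (system_pmf n k d P) (\<lambda>(A, y). indicator (solvable n) (A, y) * gibbs_avg2 n A y (tv_overlap n))
    \<le> real CARD('a) ^ 2 * (e * mean_sol d n + mean_dep d n / e)"
proof -
  let ?q = "real CARD('a)"
  have n0: "0 < n" using n k_pos by simp
  have g: "\<bar>gibbs_avg2 n A y (tv_overlap n)\<bar> \<le> ?q ^ 2" for A :: "'a mat" and y
    by (rule gibbs_avg2_abs_le) (rule tv_overlap_abs)
  then have g': "\<bar>indicator X w * gibbs_avg2 n A y (tv_overlap n)\<bar> \<le> ?q ^ 2" for A :: "'a mat" and y and X :: "('a mat \<times> 'a vec) set" and w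
    by (auto simp: indicator_def)
  have isol: "integrable (measure_pmf M) (sol_prob n)" for M :: "'a srow list pmf" by (rule integrable_pmf_bounded) (rule sol_prob_abs)
  have id: "integrable (measure_pmf M) (\<lambda>rs. dep n (set rs))" for M :: "'a srow list pmf"
    by (rule integrable_pmf_bounded) (rule dep_abs)
  have is2: "integrable (measure_pmf M) (\<lambda>m. expt (N m) (sol_prob n))" for M :: "nat pmf" and N :: "nat \<Rightarrow> 'a srow list pmf"
    by (rule integrable_pmf_bounded, rule abs_expt_le) (rule sol_prob_abs)
  have id2: "integrable (measure_pmf M) (\<lambda>m. expt (N m) (\<lambda>rs. dep n (set rs)))" for M :: "nat pmf" and N :: "nat \<Rightarrow> 'a srow list pmf"
    by (rule integrable_pmf_bounded, rule abs_expt_le) (rule dep_abs)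
  have "expt (system_pmf n k d P) (\<lambda>(A, y). indicator (solvable n) (A, y) * gibbs_avg2 n A y (tv_overlap n))
    = expt (poisson_pmf (d * n / k)) (\<lambda>m. expt (urows n m)
    (\<lambda>rs. expt (pmf_of_set (carrier_vec m)) (\<lambda>y. indicator (solvable n) (sys_mat n rs, y) * gibbs_avg2 n (sys_mat n rs) y (tv_overlap n))))"
  proof -
    have "\<bar>case w of (A, y) \<Rightarrow> indicator (solvable n) (A, y) * gibbs_avg2 n A y (tv_overlap n)\<bar> \<le> ?q ^ 2" for w :: "'a mat \<times> 'a vec"
      unfolding case_prod_unfold by (rule g')
    note * = expt_system[of "\<lambda>(A, y). indicator (solvable n) (A, y) * gibbs_avg2 n A y (tv_overlap n)", OF this]
    show ?thesis unfolding * prod.case ..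
  qed
  also have "\<dots> \<le> expt (poisson_pmf (d * n / k)) (\<lambda>m. expt (urows n m)
    (\<lambda>rs. ?q ^ 2 * (e * sol_prob n rs + dep n (set rs) / e)))"
  proof (intro expt_mono)
    fix m rs assume "rs \<in> set_pmf (urows n m)"
    note rs = rows_below_replicate[OF n this]
    let ?K = "real (card (ker n (set rs)))"
    have K: "?K > 0" using card_ker_pos by simp
    have q: "?q > 1" by (rule card_field_gt_1)
    have "expt (pmf_of_set (carrier_vec m)) (\<lambda>y. indicator (solvable n) (sys_mat n rs, y) * gibbs_avg2 n (sys_mat n rs) y (tv_overlap n))
      \<le> ?q ^ 2 * (e + dep n (set rs) / e) * (?q ^ n * ?K) / (?q ^ m * ?K ^ 2)"
      using sum_tv_overlap_le[OF n0 e, of "set rs"] q unfolding expt_rhs[OF rs(1), of "tv_overlap n", unfolded rs(2)]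
      by (intro divide_right_mono) auto
    also have "\<dots> = ?q ^ 2 * (e + dep n (set rs) / e) * sol_prob n rs"
      using K by (simp add: sol_prob_def rs(2) power2_eq_square)
    also have "\<dots> = ?q ^ 2 * (e * sol_prob n rs + dep n (set rs) / e * sol_prob n rs)" by (simp add: algebra_simps)
    also have "\<dots> \<le> ?q ^ 2 * (e * sol_prob n rs + dep n (set rs) / e)"
      using dep_bounds(1)[of n "set rs"] e sol_prob_bounds[of n rs]
      by (intro mult_left_mono add_left_mono mult_right_le_one_le) auto
    finally show "expt (pmf_of_set (carrier_vec m)) (\<lambda>y. indicator (solvable n) (sys_mat n rs, y) * gibbs_avg2 n (sys_mat n rs) y (tv_overlap n))
      \<le> ?q ^ 2 * (e * sol_prob n rs + dep n (set rs) / e)" .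
  next
    show "integrable (poisson_pmf (d * n / k)) (\<lambda>m. expt (urows n m)
      (\<lambda>rs. expt (pmf_of_set (carrier_vec m)) (\<lambda>y. indicator (solvable n) (sys_mat n rs, y) * gibbs_avg2 n (sys_mat n rs) y (tv_overlap n))))"
      by (rule integrable_pmf_bounded, rule abs_expt_le, rule abs_expt_le) (rule g')
    show "integrable (urows n m) (\<lambda>rs. expt (pmf_of_set (carrier_vec m)) (\<lambda>y. indicator (solvable n) (sys_mat n rs, y) * gibbs_avg2 n (sys_mat n rs) y (tv_overlap n)))" for m
      by (rule integrable_pmf_bounded, rule abs_expt_le) (rule g')
    show "integrable (poisson_pmf (d * n / k)) (\<lambda>m. expt (urows n m) (\<lambda>rs. ?q ^ 2 * (e * sol_prob n rs + dep n (set rs) / e)))"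
      using isol id is2 id2 by simp
    show "integrable (urows n m) (\<lambda>rs. ?q ^ 2 * (e * sol_prob n rs + dep n (set rs) / e))" for m
      using isol id by simp
  qed
  also have "\<dots> = ?q ^ 2 * (e * mean_sol d n + mean_dep d n / e)"
    unfolding mean_sol_def mean_dep_def using isol id is2 id2 by simp
  finally show ?thesis .
qed

text \<open>The intermediate density \<open>d1\<close> captures the Poisson number of rows up to a
  vanishing tail. The constant \<open>c\<close> is fixed before \<open>e\<close>, so that
  \<open>mean_dep\<close> can be made small relative to it.\<close>

lemma mean_dep_and_sol:
  assumes d: "0 < d" "d < d_crit k"
  obtains c where "0 < c" "\<And>e. 0 < e \<Longrightarrow> \<forall>\<^sub>F n in sequentially. mean_dep d n \<le> e \<and> c \<le> mean_sol d n"
proof -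
  obtain d' where d': "d < d'" and M: "\<And>\<alpha>. 0 \<le> \<alpha> \<Longrightarrow> \<alpha> \<le> 1 \<Longrightarrow> Phi d' \<alpha> \<le> 1 - d' / k"
    using ex_subcritical[OF d] by metis
  define d1 where "d1 = (d + d') / 2"
  have d1: "0 < d1" "d < d1" "d1 < d'" using d' d by (auto simp: d1_def)
  obtain c where c: "0 < c" "\<forall>\<^sub>F n in sequentially. \<forall>m. real m \<le> d1 * n / k \<longrightarrow> c \<le> expt (urows n m) (sol_prob n)"
    by (rule expt_sol_prob_ge[OF d1(1,3) M])
  have "\<forall>\<^sub>F n in sequentially. mean_dep d n \<le> e \<and> c / 2 \<le> mean_sol d n" if e: "0 < e" for e
  proof -
    let ?e = "min (e / 2) (1 / 2)"
    have ev1: "\<forall>\<^sub>F n in sequentially. \<forall>m. real m \<le> d1 * n / k \<longrightarrow> expt (urows n m) (\<lambda>rs. dep n (set rs)) \<le> ?e"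
      by (intro expt_dep_small[OF d1(1,3) M]) (use e in auto)
    have ev2: "\<forall>\<^sub>F n in sequentially. prob (poisson_pmf (d * real n / k)) {m. d1 * n / k < real m} < ?e"
      using poisson_upper_tail[OF d(1) d1(2), of "real k"] k_pos e by (intro order_tendstoD(2)) auto
    from ev1 ev2 c(2) show ?thesis
    proof eventually_elim
      case (elim n)
      let ?Po = "poisson_pmf (d * real n / k)"
      let ?T = "{m. d1 * n / k < real m}"
      have iT: "integrable ?Po (indicator ?T :: nat \<Rightarrow> real)" by (rule integrable_pmf_bounded[where B = 1]) (auto simp: indicator_def)
      have "mean_dep d n \<le> expt ?Po (\<lambda>m. ?e + indicator ?T m)"
        unfolding mean_dep_def
      proof (rule expt_mono)
        show "integrable ?Po (\<lambda>m. expt (urows n m) (\<lambda>rs. dep n (set rs)))"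
          by (rule integrable_pmf_bounded, rule abs_expt_le) (rule dep_abs)
        fix m
        have "\<bar>expt (urows n m) (\<lambda>rs. dep n (set rs))\<bar> \<le> 1"
          by (rule abs_expt_le) (rule dep_abs)
        then show "expt (urows n m) (\<lambda>rs. dep n (set rs)) \<le> ?e + indicator ?T m"
          using elim(1) e by (cases "m \<in> ?T") (auto simp: indicator_def not_less)
      qed (use iT in simp)
      also have "\<dots> = ?e + prob ?Po ?T" using iT by simp
      also have "\<dots> \<le> e" using elim(2) by linarith
      finally have dep: "mean_dep d n \<le> e" .
      have "c / 2 \<le> c * (1 - prob ?Po ?T)" using elim(2) c(1) by simp
      also have "\<dots> = expt ?Po (\<lambda>m. c * (1 - indicator ?T m))" using iT by simp
      also have "\<dots> \<le> mean_sol d n"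
        unfolding mean_sol_def
      proof (rule expt_mono)
        show "integrable ?Po (\<lambda>m. expt (urows n m) (sol_prob n))"
          by (rule integrable_pmf_bounded, rule abs_expt_le) (rule sol_prob_abs)
        fix m
        have "0 \<le> expt (urows n m) (sol_prob n)"
          by (intro expt_ge_const integrable_pmf_bounded[where B = 1] sol_prob_abs) (simp add: sol_prob_bounds less_imp_le)
        then show "c * (1 - indicator ?T m) \<le> expt (urows n m) (sol_prob n)"
          using elim(3) by (cases "m \<in> ?T") (auto simp: indicator_def not_less)
      qed (use iT in simp)
      finally show ?case using dep by simp
    qed
  qed
  then show ?thesis using that[of "c / 2"] c by simp
qed

lemma overlap_limit:
  assumes d: "0 < d" "d < d_crit k"
  shows "(\<lambda>n. expt (cond_pmf (system_pmf n k d P) (solvable n)) (\<lambda>(A, y). gibbs_avg2 n A y (tv_overlap n))) \<longlonglongrightarrow> 0"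
proof (rule tendstoI)
  fix r :: real assume r: "0 < r"
  let ?q = "real CARD('a)"
  have q: "?q > 1" by (rule card_field_gt_1)
  obtain c where c: "0 < c" "\<And>e. 0 < e \<Longrightarrow> \<forall>\<^sub>F n in sequentially. mean_dep d n \<le> e \<and> c \<le> mean_sol d n"
    using mean_dep_and_sol[OF d] by metis
  \<comment> \<open>The two constants \<open>e\<close> and \<open>e'\<close> are chosen so that each
    of the two error terms equals r / 4.\<close>
  define e where "e = r / (4 * ?q ^ 2)"
  have e: "0 < e" using r q by (simp add: e_def)
  define e' where "e' = c * e * r / (4 * ?q ^ 2)"
  have e': "0 < e'" using c e r q by (simp add: e'_def)
  from c(2)[OF e'] eventually_ge_at_top[of k]
  show "\<forall>\<^sub>F n in sequentially. dist (expt (cond_pmf (system_pmf n k d P) (solvable n)) (\<lambda>(A, y). gibbs_avg2 n A y (tv_overlap n))) 0 < r"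
  proof eventually_elim
    case (elim n)
    let ?S = "system_pmf n k d P" and ?g = "\<lambda>(A, y). gibbs_avg2 n A y (tv_overlap n)"
    have ms: "prob ?S (solvable n) = mean_sol d n" using elim by (intro prob_solvable)
    have pos: "0 < mean_sol d n" using elim c by linarith
    then have ne: "set_pmf ?S \<inter> solvable n \<noteq> {}" using ms by (metis less_irrefl measure_pmf_zero_iff)
    have g: "\<bar>?g w\<bar> \<le> ?q ^ 2" for w :: "'a mat \<times> 'a vec"
      unfolding case_prod_unfold
      by (rule gibbs_avg2_abs_le) (rule tv_overlap_abs)
    have g0: "0 \<le> ?g w" for w :: "'a mat \<times> 'a vec"
      unfolding case_prod_unfold gibbs_avg2_def
      by (intro expt_ge_const integrable_pmf_bounded[where B = "?q ^ 2"])
         (auto simp: tv_overlap_abs tv_overlap_bounds)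
    have "expt (cond_pmf ?S (solvable n)) ?g = expt ?S (\<lambda>w. indicator (solvable n) w * ?g w) / mean_sol d n"
      using expt_cond_pmf[OF ne g] ms by simp
    also have "(\<lambda>w. indicator (solvable n) w * ?g w) = (\<lambda>(A, y). indicator (solvable n) (A, y) * gibbs_avg2 n A y (tv_overlap n))"
      by (auto simp: fun_eq_iff)
    also have "expt ?S \<dots> / mean_sol d n \<le> ?q ^ 2 * (e * mean_sol d n + mean_dep d n / e) / mean_sol d n"
      using elim pos by (intro divide_right_mono expt_solvable_tv_le e) auto
    also have "\<dots> = ?q ^ 2 * e + ?q ^ 2 / e * (mean_dep d n / mean_sol d n)"
      using pos e by (simp add: field_simps)
    also have "\<dots> \<le> ?q ^ 2 * e + ?q ^ 2 / e * (e' / c)"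
      using elim pos c e e' by (intro add_left_mono mult_left_mono frac_le) auto
    also have "\<dots> = r / 2" using c e r q by (simp add: e'_def) (simp add: e_def)
    also have "\<dots> < r" using r by simp
    finally have "expt (cond_pmf ?S (solvable n)) ?g < r" .
    moreover have "0 \<le> expt (cond_pmf ?S (solvable n)) ?g"
      by (intro expt_ge_const integrable_pmf_bounded[where B = "?q ^ 2"] g g0)
    ultimately show ?case by (simp add: dist_real_def)
  qed
qed

end

theorem theorem1p3:
  fixes P :: "'a :: {finite, field} list pmf" and k :: nat and d :: real
  assumes "k \<ge> 3"
    and "perm_invariant_nonzero k P"
    and "0 < d" and "d < d_crit k"
  shows "(\<lambda>n. measure_pmf.expectation (cond_pmf (system_pmf n k d P) (solvable n))
            (\<lambda>(A, y). gibbs_avg2 n A y (\<lambda>x x'. tv_dist (overlap n x x') overlap_bar)))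
         \<longlonglongrightarrow> 0"
proof -
  interpret sparse_system k P by unfold_locales (use assms in auto)
  show ?thesis using overlap_limit[OF assms(3,4)] by (simp only: tv_overlap_def[abs_def])
qed

end
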